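(* Let $G=\mathbb{Z}_{p^2}\times\mathbb{Z}_{q^2}$ for distinct primes $p$ and $q$, let $S$ be a proper subset of $G\setminus\{0\}$ that generates $G$, and let $S_0=S\cup\{0\}$. Let $0\in C\subseteq G$ be such that $|C|$ is not relatively prime to $|S_0|$. Then $C$ is a perfect code in $\mathrm{Cay}(G,S)$ if and only if, for some integer parameters, $(S_0,C)$ is one of the following pairs: (1) $S_0=\{(i+\alpha_ip,\beta_i)\mid i\in[p]\}$, $C=\{(ip,j)\mid i\in[p],j\in[q^2]\}$; (2) $S_0=\{(\alpha_i,i+\beta_iq)\mid i\in[q]\}$, $C=\{(i,jq)\mid i\in[p^2],j\in[q]\}$; (3) $S_0=\{(i+\alpha_ip,\alpha_i+jq)\mid i\in[p],j\in[q]\}$, $C=\{(ip,j+\lambda_{ij}q)\mid i\in[p],j\in[q]\}$; (4) $S_0=\{(\alpha_i+jp,i+\alpha_iq)\mid i\in[q],j\in[p]\}$, $C=\{(i+\lambda_{ij}p,jq)\mid i\in[p],j\in[q]\}$; (5) $S_0=\{(j+\alpha_{ij}p,i+\alpha_iq)\mid i\in[q],j\in[p]\}$, $C=\{(\lambda_i+jp,iq)\mid i\in[q],j\in[p]\}$; (6) $S_0=\{(i+\alpha_{ij}p,\alpha_i+jq)\mid i\in[p],j\in[q]\}$, $C=\{(jp,i+\lambda_iq)\mid i\in[q],j\in[p]\}$; (7) $S_0=\{(i+\alpha_ip,j+\alpha_{ij}q)\mid i\in[p],j\in[q]\}$, $C=\{(ip,\lambda_i+jq)\mid i\in[p],j\in[q]\}$;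 (8) $S_0=\{(\alpha_i+jp,i+\alpha_{ij}q)\mid i\in[q],j\in[p]\}$, $C=\{(i+\lambda_ip,jq)\mid i\in[p],j\in[q]\}$; (9) $S_0=\{(i+\alpha_{ij}p,j+\alpha_{ij}q)\mid i\in[p],j\in[q]\}$, $C=\{(ip,jq)\mid i\in[p],j\in[q]\}$; (10) $S_0=\{(j+kp,i+\alpha_{ij}q)\mid i\in[q],j,k\in[p]\}$, $C=\{(p\lambda_i,iq)\mid i\in[q]\}$; (11) $S_0=\{(i,\alpha_i+jq)\mid i\in[p^2],j\in[q]\}$, $C=\{(0,i+\lambda_iq)\mid i\in[q]\}$; (12) $S_0=\{(j,i+\alpha_iq)\mid i\in[q],j\in[p^2]\}$, $C=\{(\lambda_i,iq)\mid i\in[q]\}$; (13) $S_0=\{(i+jp,\alpha_i+kq)\mid i,j\in[p],k\in[q]\}$, $C=\{(p\lambda_i,i+q\lambda_i)\mid i\in[q]\}$; (14) $S_0=\{(i,j+\alpha_{ij}q)\mid i\in[p^2],j\in[q]\}$, $C=\{(0,iq)\mid i\in[q]\}$; (15) $S_0=\{(i+\alpha_{ij}p,j+kq)\mid i\in[p],j,k\in[q]\}$, $C=\{(ip,\lambda_iq)\mid i\in[p]\}$; (16) $S_0=\{(\alpha_i+jp,i)\mid i\in[q^2],j\in[p]\}$, $C=\{(i+\lambda_ip,0)\mid i\in[p]\}$; (17) $S_0=\{(i+\alpha_ip,j)\mid i\in[p],j\in[q^2]\}$, $C=\{(ip,\lambda_i)\mid i\in[p]\}$; (18) $S_0=\{(\alpha_i+jp,i+kq)\mid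 i,k\in[q],j\in[p]\}$, $C=\{(i+p\lambda_i,q\lambda_i)\mid i\in[p]\}$; (19) $S_0=\{(i+\alpha_{ij}p,j)\mid i\in[p],j\in[q^2]\}$, $C=\{(ip,0)\mid i\in[p]\}$.
   Context: Groups are finite abelian, written additively; $\mathbb{Z}_n$ is the group of integers modulo $n$ and $[n]=\{0,1,\dots,n-1\}$; integers in coordinates are read modulo the relevant modulus. For $S\subseteq G\setminus\{0\}$, $\mathrm{Cay}(G,S)$ is the directed graph with vertex set $G$ and an arc from $x$ to $y$ if and only if $y-x\in S$ ($S$ is not assumed to be inverse-closed). A subset $C\subseteq G$ is a perfect code in $\mathrm{Cay}(G,S)$ if the sets $\{c\}\cup\{v:\text{there is an arc from } c \text{ to } v\}$, $c\in C$, form a partition of $G$. Greek letters with subscripts denote arbitrary integers, one for each value of the displayed indices, subject only to being $0$ when all subscripts are $0$; different letters (or index patterns) denote independent families, and an integer occurring several times in one element is the same integer each time. *)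

theory Defs
  imports
    "HOL-Algebra.Elementary_Groups"
    "HOL-Algebra.Generated_Groups"
    "HOL-Library.Disjoint_Sets"
    "HOL-Computational_Algebra.Primes"
    "Graph_Theory.Digraph"
begin

text \<open>
  The groups of HOL-Algebra are written multiplicatively: below, \<open>y \<otimes> inv x\<close> is the
  difference \<open>y - x\<close> and \<open>\<one>\<close> is the element 0.
\<close>

definition Cay :: "('a, 'm) monoid_scheme \<Rightarrow> 'a set \<Rightarrow> ('a, 'a \<times> 'a) pre_digraph" where
  "Cay G S =
    \<lparr>verts = carrier G,
     arcs = {(x, y). x \<in> carrier G \<and> y \<in> carrier G \<and> y \<otimes>\<^bsub>G\<^esub> inv\<^bsub>G\<^esub> x \<in> S},
     tail = fst,
     head = snd\<rparr>"

text \<open>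
  The partition is read as one of the family indexed by \<open>C\<close>: distinct code vertices have
  disjoint closed out-neighbourhoods, so that each vertex is covered by exactly one of them.
\<close>

definition perfect_code :: "('a, 'b) pre_digraph \<Rightarrow> 'a set \<Rightarrow> bool" where
  "perfect_code D C \<longleftrightarrow>
    C \<subseteq> verts D \<and>
    disjoint_family_on (\<lambda>c. {c} \<union> {v. c \<rightarrow>\<^bsub>D\<^esub> v}) C \<and>
    (\<Union>c\<in>C. {c} \<union> {v. c \<rightarrow>\<^bsub>D\<^esub> v}) = verts D"

definition Zsq :: "nat \<Rightarrow> nat \<Rightarrow> (int \<times> int) monoid" where
  "Zsq p q = integer_mod_group (p\<^sup>2) \<times>\<times> integer_mod_group (q\<^sup>2)"

text \<open>
  The carrier of \<^term>\<open>integer_mod_group n\<close> consists of the reduced residues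
  \<open>{0..<int n}\<close>, so that integer coordinates have to be reduced.
\<close>

definition elt :: "nat \<Rightarrow> nat \<Rightarrow> int \<Rightarrow> int \<Rightarrow> int \<times> int" where
  "elt p q a b = (a mod int (p\<^sup>2), b mod int (q\<^sup>2))"

end

theory Submission
  imports Defs "HOL-Number_Theory.Residues" "HOL-Library.Product_Plus"
begin

text \<open>
  Write \<open>G = \<int>\<^sub>m \<times> \<int>\<^sub>n\<close> with \<open>m = p\<^sup>2\<close> and \<open>n = q\<^sup>2\<close>. A perfect code \<open>C\<close> in the Cayley digraph of \<open>S\<close>
  is the same as a factorization \<open>G = S\<^sub>0 \<oplus> C\<close>: every element of \<open>G\<close> is \<open>s + c\<close> for exactly one
  pair (\<open>perfect_code_iff_tiling\<close>). So the task is to find all factorizations \<open>G = A \<oplus> B\<close> in which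
  \<open>A\<close> generates \<open>G\<close> and \<open>|A|\<close>, \<open>|B|\<close> have a common prime factor.

  The key fact is the replacement principle of Sands and Tijdeman (\<open>tiling_multiple\<close>): if
  \<open>A \<oplus> B\<close> is a factorization and \<open>k\<close> is coprime to \<open>|B|\<close>, then so is \<open>A \<oplus> kB\<close>. For a prime \<open>k\<close>, count
  the \<open>k\<close>-tuples from \<open>B\<close> whose sum completes some element of \<open>A\<close> to a given \<open>g\<close>. There are
  \<open>|B| ^ (k - 1)\<close> of them, which is 1 modulo \<open>k\<close>; cyclic shifts permute them, so modulo \<open>k\<close> only the
  constant tuples \<open>(b, \<dots>, b)\<close> count, and there must be one, that is, \<open>g \<in> A + kB\<close>.

  Consequently, for such \<open>k\<close>, a difference of two elements of \<open>A\<close> is never congruent to \<open>k\<close> times a nonzero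
  difference of two elements of \<open>B\<close>. Call the pair of valuations (at \<open>p\<close> of the first coordinate, at \<open>q\<close> of the
  second one, both cut off at 2) the type of a difference. As units act transitively on the elements
  of a given type, \<open>A\<close> and \<open>B\<close> have no type of a nonzero difference in common (\<open>no_common_type\<close>). If \<open>A\<close>
  generates \<open>G\<close>, it has a difference with both coordinates units, hence \<open>B\<close> has none, which forces
  \<open>B \<subseteq> pG\<close> or \<open>B \<subseteq> qG\<close> (\<open>B_in_proper_subgroup\<close>). Exchanging the coordinates reduces everything to
  \<open>B \<subseteq> pG\<close>.

  In that case \<open>|B|\<close> divides \<open>pq\<^sup>2\<close>, which leaves four possible pairs of cardinalities (\<open>card_cases\<close>). In
  each of them, the absence of common types is sharpened by multiplying with \<open>k\<close> that are not units
  but still coprime to the cardinality concerned. The outcome says that some base-\<open>p\<close> and base-\<open>q\<close>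
  digits of the elements of \<open>A\<close> and of \<open>B\<close> are free and the others are functions of them. Recording
  these functions as the parameters of the theorem gives an inclusion in one of its families, and
  comparing cardinalities turns it into an equality. Conversely, in every family the digits
  of a given group element can be matched one after another, in an order in which the carries and
  parameters are known, so that the family is a factorization (the lemmas \<open>form_1_tiling\<close> and so on).
\<close>

section \<open>Fixed points of maps of prime order\<close>

text \<open>
  The points that are not fixed fall into cycles whose length divides the prime \<open>k\<close>, hence equals \<open>k\<close>.
  One such cycle is removed at a time.
\<close>
lemma card_cong_fixed_points:
  fixes f :: "'a \<Rightarrow> 'a"
  assumes "finite X" and "f \<in> X \<rightarrow> X" and "prime k" and "\<And>x. x \<in> X \<Longrightarrow> (f ^^ k) x = x"
  shows "[card X = card {x \<in> X. f x = x}] (mod k)"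
  using assms
proof (induction X rule: finite_psubset_induct)
  case (psubset X)
  show ?case
  proof (cases "\<forall>x \<in> X. f x = x")
    case True
    then have "{x \<in> X. f x = x} = X" by auto
    then show ?thesis by simp
  next
    case False
    then obtain x where x: "x \<in> X" "f x \<noteq> x" by auto
    have period: "(f ^^ k) x = x" using psubset.prems x by blast
    have k: "k > 0" using \<open>prime k\<close> prime_gt_0_nat by blast
    have unfixed: "(f ^^ d) x \<noteq> x" if d: "0 < d" "d < k" for d
    proof
      assume fx: "(f ^^ d) x = x"
      have "coprime d k"
        using d \<open>prime k\<close> by (metis coprime_commute nat_dvd_not_less prime_imp_coprime)
      then obtain u where "[d * u = 1] (mod k)" using cong_solve_coprime_nat by (metis One_nat_def)
      then have "(d * u) mod k = 1"
        using prime_gt_1_nat[OF \<open>prime k\<close>] by (simp add: cong_def)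
      then have "f x = (f ^^ (d * u)) x"
        using funpow_mod_eq[OF period, of "d * u"] by simp
      also have "\<dots> = x"
        using funpow_mod_eq[OF fx, of "d * u"] by simp
      finally show False using x by simp
    qed
    define orb where "orb = (\<lambda>i. (f ^^ i) x) ` {..<k}"
    have inj: "inj_on (\<lambda>i. (f ^^ i) x) {..<k}"
    proof (rule linorder_inj_onI)
      fix i j assume ij: "i < j" "i \<in> {..<k}" "j \<in> {..<k}"
      show "(f ^^ i) x \<noteq> (f ^^ j) x"
      proof
        assume "(f ^^ i) x = (f ^^ j) x"
        then have "(f ^^ (k - i)) ((f ^^ i) x) = (f ^^ (k - i)) ((f ^^ j) x)" by simp
        then have "(f ^^ (k - i + i)) x = (f ^^ (k - i + j)) x"
          by (simp only: funpow_add comp_apply)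
        moreover have "k - i + j = j - i + k" using ij by auto
        ultimately have "(f ^^ k) x = (f ^^ (j - i + k)) x" using ij by simp
        also have "\<dots> = (f ^^ (j - i)) ((f ^^ k) x)" by (simp only: funpow_add comp_apply)
        finally have "(f ^^ (j - i)) x = x" using period by simp
        moreover have "0 < j - i" "j - i < k" using ij by auto
        ultimately show False using unfixed by blast
      qed
    qed auto
    have in_orb: "(f ^^ n) x \<in> orb" for n
      using funpow_mod_eq[OF period, of n] k unfolding orb_def
      by (metis image_eqI lessThan_iff mod_less_divisor)
    have orb_X: "orb \<subseteq> X"
    proof -
      have "(f ^^ i) x \<in> X" for i
        by (induction i) (use x psubset.prems(1) in auto)
      then show ?thesis by (auto simp: orb_def)
    qed
    have no_fixed: "f y \<noteq> y" if y: "y \<in> orb" for y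
    proof
      assume fy: "f y = y"
      obtain i where i: "y = (f ^^ i) x" "i < k" using y unfolding orb_def by blast
      have "(f ^^ n) y = y" for n by (induction n) (use fy in auto)
      then have "y = (f ^^ (k - i)) ((f ^^ i) x)" using i by metis
      also have "\<dots> = (f ^^ (k - i + i)) x" by (simp only: funpow_add comp_apply)
      also have "\<dots> = x" using i period by simp
      finally show False using x fy by simp
    qed
    have closed: "f \<in> (X - orb) \<rightarrow> (X - orb)"
    proof (intro Pi_I, intro DiffI)
      fix y assume y: "y \<in> X - orb"
      show "f y \<in> X" using y psubset.prems(1) by auto
      show "f y \<notin> orb"
      proof
        assume "f y \<in> orb"
        then obtain i where i: "f y = (f ^^ i) x" by (auto simp: orb_def)
        have "y = (f ^^ (k - 1)) (f y)"
          using psubset.prems(3)[of y] y k by (metis DiffD1 Suc_diff_1 comp_apply funpow_Suc_right)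
        also have "\<dots> = (f ^^ (k - 1 + i)) x" by (simp add: i funpow_add)
        finally show False using in_orb y by (metis DiffD2)
      qed
    qed
    have "[card (X - orb) = card {y \<in> X - orb. f y = y}] (mod k)"
      using x in_orb[of 0] psubset.prems closed by (intro psubset.IH) (auto simp del: funpow_simps_right)
    moreover have "{y \<in> X - orb. f y = y} = {y \<in> X. f y = y}" using no_fixed by auto
    moreover have "card X = card (X - orb) + k"
      using card_image[OF inj] orb_X psubset.hyps
      by (metis card_Diff_subset card_lessThan card_mono finite_subset le_add_diff_inverse2 orb_def)
    ultimately show ?thesis by (simp add: cong_def)
  qed
qed

lemma funpow_rotate1: "(rotate1 ^^ n) xs = rotate n xs"
  by (simp add: rotate_def)

lemma rotate1_fixed_replicate:
  assumes "rotate1 xs = xs" and "length xs = k" and "k > 0"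
  shows "xs = replicate k (hd xs)"
proof -
  have "rotate n xs = xs" for n
    by (induction n) (use assms in auto)
  then have "hd (rotate n xs) = hd xs" for n by simp
  then have "xs ! n = hd xs" if "n < k" for n
    using that assms hd_rotate_conv_nth[of xs n] by (metis length_greater_0_conv mod_less)
  then show ?thesis using assms by (intro nth_equalityI) auto
qed

section \<open>The replacement principle\<close>

text \<open>
  The heart of the replacement principle, by counting modulo \<open>k\<close>. The \<open>k\<close>-tuples \<open>bs\<close> from \<open>B\<close> with
  \<open>t - sum_list bs \<in> A\<close> are determined by their tails, because the head is the unique completion; so there
  are \<open>|B| ^ (k - 1)\<close> of them, and Fermat's little theorem reduces this to 1. Rotation preserves the
  sum, hence constant tuples remain after cancelling the free orbits. \<open>A\<close> may be infinite: it is later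
  taken to be a union of cosets of a lattice.
\<close>
lemma tiling_prime_multiple_covers:
  fixes A B :: "'a::ab_group_add set"
  assumes "finite B" and tiles: "\<And>t. \<exists>!b. b \<in> B \<and> t - b \<in> A"
    and "prime k" and "\<not> k dvd card B"
  shows "\<exists>b\<in>B. t - sum_list (replicate k b) \<in> A"
proof -
  define X where "X = {bs. set bs \<subseteq> B \<and> length bs = k \<and> t - sum_list bs \<in> A}"
  define Y where "Y = {bs. set bs \<subseteq> B \<and> length bs = k - 1}"
  have k: "k > 0" using \<open>prime k\<close> prime_gt_0_nat by blast
  have "finite X"
    by (rule finite_subset[OF _ finite_lists_length_eq[OF \<open>finite B\<close>, of k]]) (auto simp: X_def)
  have "bij_betw tl X Y"
  proof (rule bij_betwI')
    fix bs cs assume bc: "bs \<in> X" "cs \<in> X"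
    have ne: "bs \<noteq> []" "cs \<noteq> []" using bc k by (auto simp: X_def)
    show "tl bs = tl cs \<longleftrightarrow> bs = cs"
    proof
      assume eq: "tl bs = tl cs"
      have "hd bs \<in> B \<and> (t - sum_list (tl bs)) - hd bs \<in> A"
        using bc ne by (cases bs) (auto simp: X_def algebra_simps)
      moreover have "hd cs \<in> B \<and> (t - sum_list (tl bs)) - hd cs \<in> A"
        using bc ne unfolding eq by (cases cs) (auto simp: X_def algebra_simps)
      ultimately have "hd bs = hd cs" using tiles by blast
      then show "bs = cs" using eq ne by (metis list.collapse)
    qed auto
  next
    fix bs assume "bs \<in> X"
    then show "tl bs \<in> Y" by (cases bs) (auto simp: X_def Y_def)
  next
    fix bs assume bs: "bs \<in> Y"
    obtain b where "b \<in> B" "(t - sum_list bs) - b \<in> A" using tiles by blast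
    then have "b # bs \<in> X" using bs k by (auto simp: X_def Y_def algebra_simps)
    then show "\<exists>cs\<in>X. bs = tl cs" by force
  qed
  then have "card X = card B ^ (k - 1)"
    by (simp add: bij_betw_same_card Y_def card_lists_length_eq \<open>finite B\<close>)
  then have one: "[card X = 1] (mod k)"
    using fermat_theorem[OF \<open>prime k\<close> \<open>\<not> k dvd card B\<close>] by simp
  have "[card X = card {bs \<in> X. rotate1 bs = bs}] (mod k)"
  proof (rule card_cong_fixed_points[OF \<open>finite X\<close> _ \<open>prime k\<close>])
    have "sum_list (rotate1 bs) = sum_list bs" for bs :: "'a list"
      by (cases bs) (auto simp: add.commute)
    then show "rotate1 \<in> X \<rightarrow> X" by (auto simp: X_def)
    show "(rotate1 ^^ k) bs = bs" if "bs \<in> X" for bs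
      using that by (auto simp: X_def funpow_rotate1)
  qed
  then have "{bs \<in> X. rotate1 bs = bs} \<noteq> {}"
    using one \<open>prime k\<close> by (metis card.empty cong_0_1_nat cong_sym cong_trans not_prime_1)
  then obtain bs where bs: "bs \<in> X" "rotate1 bs = bs" by blast
  then have "bs = replicate k (hd bs)"
    using rotate1_fixed_replicate[of bs k] k by (auto simp: X_def)
  moreover have "hd bs \<in> B" using bs k by (cases bs) (auto simp: X_def)
  ultimately show ?thesis using bs by (metis (mono_tags, lifting) X_def mem_Collect_eq)
qed

text \<open>
  \<open>A \<oplus> B\<close> is the product of the cyclic groups of orders \<open>m\<close> and \<open>n\<close>. The elements of \<open>A\<close> and \<open>B\<close>
  are arbitrary integer representatives, so that a subset need not be reduced again after it has been
  multiplied by an integer or divided by \<open>p\<close>.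
\<close>
definition tiling :: "int \<Rightarrow> int \<Rightarrow> (int \<times> int) set \<Rightarrow> (int \<times> int) set \<Rightarrow> bool" where
  "tiling m n A B \<longleftrightarrow>
    bij_betw (\<lambda>(a, b). ((fst a + fst b) mod m, (snd a + snd b) mod n)) (A \<times> B) ({0..<m} \<times> {0..<n})"

lemma tiling_card:
  assumes "tiling m n A B" and "m > 0" and "n > 0"
  shows "card A * card B = nat m * nat n"
  using bij_betw_same_card[OF assms(1)[unfolded tiling_def]] by (simp add: card_cartesian_product)

lemma tiling_finite:
  assumes "tiling m n A B" and "m > 0" and "n > 0"
  shows "finite A" and "finite B"
proof -
  have "card A * card B > 0" using tiling_card[OF assms] assms(2,3) by simp
  then show "finite A" and "finite B" by (auto intro: card_ge_0_finite)
qed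

lemma tiling_cover:
  assumes "tiling m n A B" and "m > 0" and "n > 0"
  obtains a b where "a \<in> A" and "b \<in> B"
    and "[fst a + fst b = x] (mod m)" and "[snd a + snd b = y] (mod n)"
proof -
  have "(x mod m, y mod n) \<in> (\<lambda>(a, b). ((fst a + fst b) mod m, (snd a + snd b) mod n)) ` (A \<times> B)"
    using assms by (simp add: tiling_def bij_betw_def)
  then show thesis using that by (force simp: cong_def)
qed

lemma tiling_unique:
  assumes "tiling m n A B" and "a \<in> A" "a' \<in> A" "b \<in> B" "b' \<in> B"
    and "[fst a + fst b = fst a' + fst b'] (mod m)" and "[snd a + snd b = snd a' + snd b'] (mod n)"
  shows "a = a' \<and> b = b'"
proof -
  have "inj_on (\<lambda>(a, b). ((fst a + fst b) mod m, (snd a + snd b) mod n)) (A \<times> B)"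
    using assms(1) by (simp add: tiling_def bij_betw_def)
  from inj_onD[OF this, of "(a, b)" "(a', b')"] assms(2-) show ?thesis by (simp add: cong_def)
qed

lemma sums_cover_imp_image:
  fixes m n :: int
  assumes "m > 0" and "n > 0"
    and cover: "\<And>x y. \<exists>a\<in>A. \<exists>b\<in>B. [fst a + fst b = x] (mod m) \<and> [snd a + snd b = y] (mod n)"
  shows "(\<lambda>(a, b). ((fst a + fst b) mod m, (snd a + snd b) mod n)) ` (A \<times> B) = {0..<m} \<times> {0..<n}"
    (is "?s ` _ = _")
proof
  show "?s ` (A \<times> B) \<subseteq> {0..<m} \<times> {0..<n}" using assms(1,2) by auto
  show "{0..<m} \<times> {0..<n} \<subseteq> ?s ` (A \<times> B)"
  proof
    fix u assume u: "u \<in> {0..<m} \<times> {0..<n}"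
    obtain a b where "a \<in> A" "b \<in> B"
      "[fst a + fst b = fst u] (mod m)" "[snd a + snd b = snd u] (mod n)"
      using cover[of "fst u" "snd u"] by blast
    then show "u \<in> ?s ` (A \<times> B)"
      using u by (intro image_eqI[of _ _ "(a, b)"]) (auto simp: cong_def)
  qed
qed

lemma tilingI:
  fixes m n :: int
  assumes "m > 0" and "n > 0"
    and cover: "\<And>x y. \<exists>a\<in>A. \<exists>b\<in>B. [fst a + fst b = x] (mod m) \<and> [snd a + snd b = y] (mod n)"
    and unique: "\<And>a a' b b'. a \<in> A \<Longrightarrow> a' \<in> A \<Longrightarrow> b \<in> B \<Longrightarrow> b' \<in> B \<Longrightarrow>
      [fst a + fst b = fst a' + fst b'] (mod m) \<Longrightarrow> [snd a + snd b = snd a' + snd b'] (mod n) \<Longrightarrow>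
      a = a' \<and> b = b'"
  shows "tiling m n A B"
  unfolding tiling_def bij_betw_def
proof (intro conjI sums_cover_imp_image inj_onI assms)
  fix u v
  assume uv: "u \<in> A \<times> B" "v \<in> A \<times> B"
    "(case u of (a, b) \<Rightarrow> ((fst a + fst b) mod m, (snd a + snd b) mod n)) =
      (case v of (a, b) \<Rightarrow> ((fst a + fst b) mod m, (snd a + snd b) mod n))"
  then show "u = v"
    using unique[of "fst u" "fst v" "snd u" "snd v"]
    by (simp add: cong_def mem_Times_iff split_beta prod_eq_iff)
qed

text \<open>
  By pigeonhole, a covering with at most \<open>mn\<close> pairs cannot hit any element twice.
\<close>
lemma tilingI_cover:
  fixes m n :: int
  assumes "finite A" and "finite B" and "m > 0" and "n > 0"
    and "card A * card B \<le> nat m * nat n"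
    and cover: "\<And>x y. \<exists>a\<in>A. \<exists>b\<in>B. [fst a + fst b = x] (mod m) \<and> [snd a + snd b = y] (mod n)"
  shows "tiling m n A B"
proof -
  note img = sums_cover_imp_image[OF assms(3,4) cover]
  have fin: "finite (A \<times> B)" using assms(1,2) by simp
  have "card (A \<times> B) \<le> card ((\<lambda>(a, b). ((fst a + fst b) mod m, (snd a + snd b) mod n)) ` (A \<times> B))"
    unfolding img using assms(5) by (simp add: card_cartesian_product)
  then have "inj_on (\<lambda>(a, b). ((fst a + fst b) mod m, (snd a + snd b) mod n)) (A \<times> B)"
    using card_image_le[OF fin] by (intro eq_card_imp_inj_on[OF fin] antisym)
  then show ?thesis unfolding tiling_def bij_betw_def using img by blast
qed

lemma tiling_commute:
  assumes "tiling m n A B" and "m > 0" and "n > 0"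
  shows "tiling m n B A"
proof (rule tilingI_cover)
  show "card B * card A \<le> nat m * nat n" using tiling_card[OF assms] by (simp add: mult.commute)
  show "\<exists>b\<in>B. \<exists>a\<in>A. [fst b + fst a = x] (mod m) \<and> [snd b + snd a = y] (mod n)" for x y
    by (rule tiling_cover[OF assms, of x y]) (metis add.commute)
qed (use assms tiling_finite[OF assms] in auto)

lemma tiling_swap:
  assumes "tiling m n A B" and "m > 0" and "n > 0"
  shows "tiling n m (prod.swap ` A) (prod.swap ` B)"
proof (rule tilingI_cover)
  show "card (prod.swap ` A) * card (prod.swap ` B) \<le> nat n * nat m"
    using tiling_card[OF assms] by (simp add: card_image mult.commute)
  show "\<exists>a\<in>prod.swap ` A. \<exists>b\<in>prod.swap ` B. [fst a + fst b = x] (mod n) \<and> [snd a + snd b = y] (mod m)" for x y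
    by (rule tiling_cover[OF assms, of y x]) auto
qed (use assms tiling_finite[OF assms] in auto)

lemma cong_diff_eq_iff_cong_add: "[t - b = a] (mod m) \<longleftrightarrow> [a + b = t] (mod m)" for t :: int
proof -
  have "a + b - t = - (t - b - a)" by simp
  then show ?thesis unfolding cong_iff_dvd_diff by (metis dvd_minus_iff)
qed

definition multiple :: "nat \<Rightarrow> int \<times> int \<Rightarrow> int \<times> int" where
  "multiple k u = (int k * fst u, int k * snd u)"

lemma sum_list_replicate_eq_multiple: "sum_list (replicate k u) = multiple k u"
  by (induction k) (auto simp: multiple_def algebra_simps zero_prod_def prod_eq_iff)

lemma inj_multiple: "k > 0 \<Longrightarrow> inj_on (multiple k) B"
  by (auto simp: inj_on_def multiple_def prod_eq_iff)

text \<open>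
  The periodic set \<open>P\<close> of all integer points congruent to a point of \<open>A\<close> and the finite set \<open>B\<close> factorize
  the whole lattice, so the counting argument applies there. It yields existence only; uniqueness
  follows from the cardinalities.
\<close>
lemma tiling_multiple_prime:
  assumes "tiling m n A B" and "m > 0" and "n > 0" and "prime k" and "\<not> k dvd card B"
  shows "tiling m n A (multiple k ` B)"
proof (rule tilingI_cover)
  have k: "k > 0" using \<open>prime k\<close> prime_gt_0_nat by blast
  show "card A * card (multiple k ` B) \<le> nat m * nat n"
    using tiling_card[OF assms(1-3)] by (simp add: card_image inj_multiple k)
  show "\<exists>a\<in>A. \<exists>b\<in>multiple k ` B. [fst a + fst b = x] (mod m) \<and> [snd a + snd b = y] (mod n)" for x y
  proof -
    define P where "P = {u. \<exists>a\<in>A. [fst u = fst a] (mod m) \<and> [snd u = snd a] (mod n)}"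
    have "\<exists>b\<in>B. (x, y) - sum_list (replicate k b) \<in> P"
    proof (rule tiling_prime_multiple_covers)
      fix t :: "int \<times> int"
      show "\<exists>!b. b \<in> B \<and> t - b \<in> P"
      proof (rule ex_ex1I)
        obtain a b where "a \<in> A" "b \<in> B"
          "[fst a + fst b = fst t] (mod m)" "[snd a + snd b = snd t] (mod n)"
          using tiling_cover[OF assms(1-3)] by blast
        then show "\<exists>b. b \<in> B \<and> t - b \<in> P"
          by (intro exI[of _ b]) (auto simp: P_def cong_diff_eq_iff_cong_add)
      next
        fix b b' assume "b \<in> B \<and> t - b \<in> P" "b' \<in> B \<and> t - b' \<in> P"
        then obtain a a' where "a \<in> A" "a' \<in> A" "b \<in> B" "b' \<in> B"
          and "[fst a + fst b = fst t] (mod m)" "[snd a + snd b = snd t] (mod n)"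
          and "[fst a' + fst b' = fst t] (mod m)" "[snd a' + snd b' = snd t] (mod n)"
          by (auto simp: P_def cong_diff_eq_iff_cong_add)
        then show "b = b'"
          using tiling_unique[OF assms(1)] by (meson cong_sym cong_trans)
      qed
    qed (use assms tiling_finite[OF assms(1-3)] in auto)
    then obtain a b where "a \<in> A" "b \<in> B"
      "[fst a + int k * fst b = x] (mod m)" "[snd a + int k * snd b = y] (mod n)"
      by (auto simp: P_def sum_list_replicate_eq_multiple multiple_def cong_diff_eq_iff_cong_add)
    then have "a \<in> A \<and> multiple k b \<in> multiple k ` B \<and>
        [fst a + fst (multiple k b) = x] (mod m) \<and> [snd a + snd (multiple k b) = y] (mod n)"
      by (auto simp: multiple_def)
    then show ?thesis by blast
  qed
qed (use assms tiling_finite[OF assms(1-3)] in auto)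

text \<open>
  The replacement principle of Sands and Tijdeman, one prime factor of \<open>k\<close> at a time.
\<close>
lemma tiling_multiple:
  assumes "tiling m n A B" and "m > 0" and "n > 0" and "coprime k (card B)" and "k > 0"
  shows "tiling m n A (multiple k ` B)"
  using assms(4,5)
proof (induction k rule: prime_divisors_induct)
  case (unit k)
  moreover have "multiple 1 = id" by (auto simp: multiple_def)
  ultimately show ?case using assms by simp
next
  case (factor r k)
  have k: "coprime k (card B)" "k > 0" and r: "coprime r (card B)"
    using factor.prems by (auto simp: coprime_mult_left_iff)
  have "\<not> r dvd card (multiple k ` B)"
    using r \<open>prime r\<close> by (auto simp: card_image inj_multiple k coprime_absorb_left)
  then have "tiling m n A (multiple r ` multiple k ` B)"
    using tiling_multiple_prime factor k assms by blast
  moreover have "multiple r ` multiple k ` B = multiple (r * k) ` B"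
    by (auto simp: multiple_def image_image algebra_simps)
  ultimately show ?case by simp
qed auto

text \<open>
  If \<open>a - a' = k(b - b')\<close> then \<open>a + kb' = a' + kb\<close> are two representations in \<open>A \<oplus> kB\<close>.
\<close>
lemma tiling_no_common_difference:
  assumes "tiling m n A B" and "m > 0" and "n > 0" and "coprime k (card B)" and "k > 0"
    and "a \<in> A" "a' \<in> A" "b \<in> B" "b' \<in> B"
    and "[fst a - fst a' = int k * (fst b - fst b')] (mod m)"
    and "[snd a - snd a' = int k * (snd b - snd b')] (mod n)"
  shows "a = a' \<and> b = b'"
proof -
  have "a = a' \<and> multiple k b' = multiple k b"
  proof (rule tiling_unique[OF tiling_multiple[OF assms(1-5)]])
    show "[fst a + fst (multiple k b') = fst a' + fst (multiple k b)] (mod m)"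
      and "[snd a + snd (multiple k b') = snd a' + snd (multiple k b)] (mod n)"
      using assms(10,11) by (simp_all add: cong_iff_dvd_diff multiple_def algebra_simps)
  qed (use assms in auto)
  then show ?thesis using inj_multiple[OF \<open>k > 0\<close>, of UNIV] by (auto dest: injD)
qed

section \<open>Valuations of differences\<close>

text \<open>
  The valuations of \<open>u\<close> and \<open>v\<close> at \<open>r\<close> agree as far as they can be seen modulo \<open>r\<^sup>2\<close>.
\<close>
definition same_val :: "int \<Rightarrow> int \<Rightarrow> int \<Rightarrow> bool" where
  "same_val r u v \<longleftrightarrow> (r dvd u \<longleftrightarrow> r dvd v) \<and> (r\<^sup>2 dvd u \<longleftrightarrow> r\<^sup>2 dvd v)"

lemma unit_quotient_mod_square:
  fixes r :: nat and u v :: int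
  assumes "prime r" and "\<not> int r dvd u" "\<not> int r dvd v"
  shows "\<exists>k. coprime k r \<and> [u = int k * v] (mod (int r)\<^sup>2)"
proof -
  have pr: "prime (int r)" using assms by simp
  have r0: "(int r)\<^sup>2 > 0" using prime_gt_0_nat[OF assms(1)] by simp
  have "coprime v ((int r)\<^sup>2)"
    using prime_imp_coprime[OF pr assms(3)] by (simp add: coprime_commute)
  then obtain x where x: "[v * x = 1] (mod (int r)\<^sup>2)" using cong_solve_coprime_int by blast
  define k where "k = nat ((x * u) mod (int r)\<^sup>2)"
  have "[int k = x * u] (mod (int r)\<^sup>2)" using r0 by (simp add: k_def cong_def)
  then have "[int k * v = x * u * v] (mod (int r)\<^sup>2)" by (rule cong_scalar_right)
  also have "x * u * v = u * (v * x)" by (simp add: algebra_simps)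
  also have "[u * (v * x) = u * 1] (mod (int r)\<^sup>2)" using x by (rule cong_scalar_left)
  finally have c: "[u = int k * v] (mod (int r)\<^sup>2)" by (simp add: cong_sym)
  then have "[u = int k * v] (mod int r)" by (rule cong_dvd_modulus) simp
  then have "\<not> int r dvd int k" using assms(2) by (auto simp: cong_dvd_iff)
  then have "coprime k r" using prime_imp_coprime[OF assms(1)] by (simp add: coprime_commute)
  then show ?thesis using c by blast
qed

text \<open>
  The units modulo \<open>r\<^sup>2\<close> act transitively on the residues of a given valuation.
\<close>
lemma same_val_imp_cong_multiple:
  fixes r :: nat
  assumes "prime r" and "same_val (int r) u v"
  shows "\<exists>k. coprime k r \<and> [u = int k * v] (mod (int r)\<^sup>2)"
proof -
  have r0: "r > 0" using prime_gt_0_nat[OF assms(1)] .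
  consider "(int r)\<^sup>2 dvd u" "(int r)\<^sup>2 dvd v" | "\<not> int r dvd u" "\<not> int r dvd v"
    | "int r dvd u" "int r dvd v" "\<not> (int r)\<^sup>2 dvd u" "\<not> (int r)\<^sup>2 dvd v"
    using assms(2) by (auto simp: same_val_def)
  then show ?thesis
  proof cases
    case 1
    then show ?thesis by (intro exI[of _ 1]) (auto simp: cong_def)
  next
    case 2
    then show ?thesis using unit_quotient_mod_square assms by blast
  next
    case 3
    then obtain u' v' where uv: "u = int r * u'" "v = int r * v'" by (auto elim!: dvdE)
    have "\<not> int r dvd u'" "\<not> int r dvd v'"
      using 3 r0 by (auto simp: uv power2_eq_square)
    then obtain k where k: "coprime k r" "[u' = int k * v'] (mod (int r)\<^sup>2)"
      using unit_quotient_mod_square assms by blast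
    then have "[u = int k * v] (mod (int r)\<^sup>2)"
      unfolding uv using cong_scalar_left[OF k(2), of "int r"] by (simp add: ac_simps)
    then show ?thesis using k by blast
  qed
qed

section \<open>Digits\<close>

text \<open>
  The two base-\<open>r\<close> digits of \<open>x \<in> {0..<r\<^sup>2}\<close>.
\<close>
definition lo :: "nat \<Rightarrow> int \<Rightarrow> nat" where "lo r x = nat (x mod int r)"
definition hi :: "nat \<Rightarrow> int \<Rightarrow> nat" where "hi r x = nat (x div int r)"

lemma lo_less: "r > 0 \<Longrightarrow> lo r x < r"
  by (simp add: lo_def nat_less_iff)

lemma hi_less:
  assumes "0 \<le> x" and "x < (int r)\<^sup>2"
  shows "hi r x < r"
proof -
  have r: "r > 0" using assms by (cases "r = 0") auto
  have "x div int r * int r \<le> x" using pos_mod_sign[of "int r" x] r by (simp add: minus_mod_eq_div_mult [symmetric])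
  then have "x div int r * int r < int r * int r" using assms(2) by (simp add: power2_eq_square)
  then have "x div int r < int r" using r by simp
  then show ?thesis using r by (simp add: hi_def nat_less_iff)
qed

lemma lo_hi: "r > 0 \<Longrightarrow> 0 \<le> x \<Longrightarrow> int (lo r x) + int (hi r x) * int r = x"
  by (simp add: lo_def hi_def pos_imp_zdiv_nonneg_iff)

lemma lo_eq_iff: "r > 0 \<Longrightarrow> lo r x = lo r y \<longleftrightarrow> [x = y] (mod int r)"
  by (simp add: lo_def cong_def nat_eq_iff)

lemma lo_eq_iff_dvd: "r > 0 \<Longrightarrow> lo r x = lo r y \<longleftrightarrow> int r dvd x - y"
  by (simp add: lo_eq_iff cong_iff_dvd_diff)

lemma lo_0 [simp]: "lo r 0 = 0" and hi_0 [simp]: "hi r 0 = 0"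
  by (simp_all add: lo_def hi_def)

text \<open>
  A quantity that is determined by another one on \<open>A\<close> is a function of it. This is how the parameter
  families of the theorem arise.
\<close>
lemma function_of:
  assumes "\<And>a b. a \<in> A \<Longrightarrow> b \<in> A \<Longrightarrow> f a = f b \<Longrightarrow> g a = g b"
  shows "\<exists>h. \<forall>a\<in>A. h (f a) = g a"
proof (intro exI ballI)
  show "g (SOME b. b \<in> A \<and> f b = f a) = g a" if "a \<in> A" for a
    by (rule someI2[of _ a]) (use that assms in blast)+
qed

lemma function_of2:
  assumes "\<And>a b. a \<in> A \<Longrightarrow> b \<in> A \<Longrightarrow> f a = f b \<Longrightarrow> f' a = f' b \<Longrightarrow> g a = g b"
  shows "\<exists>h. \<forall>a\<in>A. h (f a) (f' a) = g a"
proof -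
  have "\<exists>h. \<forall>a\<in>A. h (f a, f' a) = g a" by (rule function_of) (use assms in blast)
  then obtain h where "\<forall>a\<in>A. h (f a, f' a) = g a" ..
  then show ?thesis by (intro exI[of _ "\<lambda>i j. h (i, j)"]) simp
qed

lemma card_grid2:
  fixes f :: "nat \<Rightarrow> nat \<Rightarrow> 'b"
  shows "finite {f i j |i j. i \<in> {..<l} \<and> j \<in> {..<m}}" and "card {f i j |i j. i \<in> {..<l} \<and> j \<in> {..<m}} \<le> l * m"
proof -
  have *: "{f i j |i j. i \<in> {..<l} \<and> j \<in> {..<m}} = (\<lambda>(i, j). f i j) ` ({..<l} \<times> {..<m})" by auto
  show "finite {f i j |i j. i \<in> {..<l} \<and> j \<in> {..<m}}" unfolding * by simp
  show "card {f i j |i j. i \<in> {..<l} \<and> j \<in> {..<m}} \<le> l * m"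
    unfolding * using card_image_le[of "{..<l} \<times> {..<m}" "\<lambda>(i, j). f i j"] by simp
qed

lemma card_grid3:
  fixes f :: "nat \<Rightarrow> nat \<Rightarrow> nat \<Rightarrow> 'b"
  shows "finite {f i j k |i j k. i \<in> {..<l} \<and> j \<in> {..<m} \<and> k \<in> {..<n}}"
    and "card {f i j k |i j k. i \<in> {..<l} \<and> j \<in> {..<m} \<and> k \<in> {..<n}} \<le> l * m * n"
proof -
  have *: "{f i j k |i j k. i \<in> {..<l} \<and> j \<in> {..<m} \<and> k \<in> {..<n}} = (\<lambda>(i, j, k). f i j k) ` ({..<l} \<times> {..<m} \<times> {..<n})"
    by (auto simp: image_def)
  show "finite {f i j k |i j k. i \<in> {..<l} \<and> j \<in> {..<m} \<and> k \<in> {..<n}}" unfolding * by simp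
  show "card {f i j k |i j k. i \<in> {..<l} \<and> j \<in> {..<m} \<and> k \<in> {..<n}} \<le> l * m * n"
    unfolding * using card_image_le[of "{..<l} \<times> {..<m} \<times> {..<n}" "\<lambda>(i, j, k). f i j k"] by (simp add: mult.assoc)
qed

lemma card_grid1:
  fixes f :: "nat \<Rightarrow> 'b"
  shows "finite {f i |i. i \<in> {..<l}}" and "card {f i |i. i \<in> {..<l}} \<le> l"
proof -
  have *: "{f i |i. i \<in> {..<l}} = f ` {..<l}" by auto
  show "finite {f i |i. i \<in> {..<l}}" unfolding * by simp
  show "card {f i |i. i \<in> {..<l}} \<le> l" unfolding * using card_image_le[of "{..<l}" f] by simp
qed

text \<open>
  A subset of a parametrised family that has at least as many elements as there are index tuples is all
  of the family; so for the classification only inclusions have to be shown. The families have one, two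
  or three indices.
\<close>
lemmas eq_grid1 = card_seteq[OF card_grid1(1) _ order.trans[OF card_grid1(2)]]
lemmas eq_grid2 = card_seteq[OF card_grid2(1) _ order.trans[OF card_grid2(2)]]
lemmas eq_grid3 = card_seteq[OF card_grid3(1) _ order.trans[OF card_grid3(2)]]

lemma cong_mult_square: "[z = w] (mod int p) \<Longrightarrow> [z * int p = w * int p] (mod (int p)\<^sup>2)"
  unfolding power2_eq_square cong_iff_dvd_diff left_diff_distrib [symmetric] by (rule mult_dvd_mono) auto

text \<open>
  In some families one parameter prescribes a digit at \<open>p\<close> and a digit at \<open>q\<close> simultaneously; it is a
  solution of the two congruences. The solution 0 is chosen where possible because the parameters
  have to vanish at index 0. The moduli are squares since the parameter may also occur as a
  summand that is not multiplied by \<open>q\<close>.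
\<close>
definition crt :: "nat \<Rightarrow> nat \<Rightarrow> nat \<Rightarrow> nat \<Rightarrow> int" where
  "crt p q u v =
    int (if u = 0 \<and> v = 0 then 0 else SOME z. [z = u] (mod p\<^sup>2) \<and> [z = v] (mod q\<^sup>2))"

lemma crt:
  assumes "coprime p q"
  shows "[crt p q u v = int u] (mod (int p)\<^sup>2)" and "[crt p q u v = int v] (mod (int q)\<^sup>2)"
proof -
  have "coprime (p\<^sup>2) (q\<^sup>2)" using assms by simp
  then have "\<exists>z. [z = u] (mod p\<^sup>2) \<and> [z = v] (mod q\<^sup>2)"
    using binary_chinese_remainder_nat by blast
  from someI_ex[OF this] have "[crt p q u v = int u] (mod int (p\<^sup>2))" "[crt p q u v = int v] (mod int (q\<^sup>2))"
    by (auto simp: crt_def cong_int_iff simp del: of_nat_power)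
  then show "[crt p q u v = int u] (mod (int p)\<^sup>2)" "[crt p q u v = int v] (mod (int q)\<^sup>2)" by simp_all
qed

lemma crt_0 [simp]: "crt p q 0 0 = 0"
  by (simp add: crt_def)

section \<open>The families of factorizations\<close>

text \<open>
  The alternatives of the theorem, in the order in which it lists them. \<open>A\<close> stands for \<open>S\<^sub>0\<close> and \<open>B\<close>
  for \<open>C\<close>. In 1, 3, 6, 7, 9, 10, 11, 13, 14, 15, 17 and 19 the set \<open>B\<close> lies in \<open>pG\<close>; the others are
  obtained from these by exchanging the coordinates.
\<close>
definition form_1 :: "nat \<Rightarrow> nat \<Rightarrow> (int \<times> int) set \<Rightarrow> (int \<times> int) set \<Rightarrow> bool" where
  "form_1 p q A B \<longleftrightarrow>
    (\<exists>(\<alpha> :: nat \<Rightarrow> int) (\<beta> :: nat \<Rightarrow> int).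
      \<alpha> 0 = 0 \<and> \<beta> 0 = 0 \<and>
      A = {elt p q (i + \<alpha> i * int p) (\<beta> i) |(i::nat). i \<in> {..<p}} \<and>
      B = {elt p q (i * int p) j |(i::nat) (j::nat). i \<in> {..<p} \<and> j \<in> {..<q\<^sup>2}})"

definition form_2 :: "nat \<Rightarrow> nat \<Rightarrow> (int \<times> int) set \<Rightarrow> (int \<times> int) set \<Rightarrow> bool" where
  "form_2 p q A B \<longleftrightarrow>
    (\<exists>(\<alpha> :: nat \<Rightarrow> int) (\<beta> :: nat \<Rightarrow> int).
      \<alpha> 0 = 0 \<and> \<beta> 0 = 0 \<and>
      A = {elt p q (\<alpha> i) (i + \<beta> i * int q) |(i::nat). i \<in> {..<q}} \<and>
      B = {elt p q i (j * int q) |(i::nat) (j::nat). i \<in> {..<p\<^sup>2} \<and> j \<in> {..<q}})"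

definition form_3 :: "nat \<Rightarrow> nat \<Rightarrow> (int \<times> int) set \<Rightarrow> (int \<times> int) set \<Rightarrow> bool" where
  "form_3 p q A B \<longleftrightarrow>
    (\<exists>(\<alpha> :: nat \<Rightarrow> int) (\<kappa> :: nat \<Rightarrow> nat \<Rightarrow> int).
      \<alpha> 0 = 0 \<and> \<kappa> 0 0 = 0 \<and>
      A = {elt p q (i + \<alpha> i * int p) (\<alpha> i + j * int q) |(i::nat) (j::nat). i \<in> {..<p} \<and> j \<in> {..<q}} \<and>
      B = {elt p q (i * int p) (j + \<kappa> i j * int q) |(i::nat) (j::nat). i \<in> {..<p} \<and> j \<in> {..<q}})"

definition form_4 :: "nat \<Rightarrow> nat \<Rightarrow> (int \<times> int) set \<Rightarrow> (int \<times> int) set \<Rightarrow> bool" where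
  "form_4 p q A B \<longleftrightarrow>
    (\<exists>(\<alpha> :: nat \<Rightarrow> int) (\<kappa> :: nat \<Rightarrow> nat \<Rightarrow> int).
      \<alpha> 0 = 0 \<and> \<kappa> 0 0 = 0 \<and>
      A = {elt p q (\<alpha> i + j * int p) (i + \<alpha> i * int q) |(i::nat) (j::nat). i \<in> {..<q} \<and> j \<in> {..<p}} \<and>
      B = {elt p q (i + \<kappa> i j * int p) (j * int q) |(i::nat) (j::nat). i \<in> {..<p} \<and> j \<in> {..<q}})"

definition form_5 :: "nat \<Rightarrow> nat \<Rightarrow> (int \<times> int) set \<Rightarrow> (int \<times> int) set \<Rightarrow> bool" where
  "form_5 p q A B \<longleftrightarrow>
    (\<exists>(\<alpha>' :: nat \<Rightarrow> nat \<Rightarrow> int) (\<alpha> :: nat \<Rightarrow> int) (\<kappa> :: nat \<Rightarrow> int).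
      \<alpha>' 0 0 = 0 \<and> \<alpha> 0 = 0 \<and> \<kappa> 0 = 0 \<and>
      A = {elt p q (j + \<alpha>' i j * int p) (i + \<alpha> i * int q) |(i::nat) (j::nat). i \<in> {..<q} \<and> j \<in> {..<p}} \<and>
      B = {elt p q (\<kappa> i + j * int p) (i * int q) |(i::nat) (j::nat). i \<in> {..<q} \<and> j \<in> {..<p}})"

definition form_6 :: "nat \<Rightarrow> nat \<Rightarrow> (int \<times> int) set \<Rightarrow> (int \<times> int) set \<Rightarrow> bool" where
  "form_6 p q A B \<longleftrightarrow>
    (\<exists>(\<alpha>' :: nat \<Rightarrow> nat \<Rightarrow> int) (\<alpha> :: nat \<Rightarrow> int) (\<kappa> :: nat \<Rightarrow> int).
      \<alpha>' 0 0 = 0 \<and> \<alpha> 0 = 0 \<and> \<kappa> 0 = 0 \<and>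
      A = {elt p q (i + \<alpha>' i j * int p) (\<alpha> i + j * int q) |(i::nat) (j::nat). i \<in> {..<p} \<and> j \<in> {..<q}} \<and>
      B = {elt p q (j * int p) (i + \<kappa> i * int q) |(i::nat) (j::nat). i \<in> {..<q} \<and> j \<in> {..<p}})"

definition form_7 :: "nat \<Rightarrow> nat \<Rightarrow> (int \<times> int) set \<Rightarrow> (int \<times> int) set \<Rightarrow> bool" where
  "form_7 p q A B \<longleftrightarrow>
    (\<exists>(\<alpha> :: nat \<Rightarrow> int) (\<alpha>' :: nat \<Rightarrow> nat \<Rightarrow> int) (\<kappa> :: nat \<Rightarrow> int).
      \<alpha> 0 = 0 \<and> \<alpha>' 0 0 = 0 \<and> \<kappa> 0 = 0 \<and>
      A = {elt p q (i + \<alpha> i * int p) (j + \<alpha>' i j * int q) |(i::nat) (j::nat). i \<in> {..<p} \<and> j \<in> {..<q}} \<and>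
      B = {elt p q (i * int p) (\<kappa> i + j * int q) |(i::nat) (j::nat). i \<in> {..<p} \<and> j \<in> {..<q}})"

definition form_8 :: "nat \<Rightarrow> nat \<Rightarrow> (int \<times> int) set \<Rightarrow> (int \<times> int) set \<Rightarrow> bool" where
  "form_8 p q A B \<longleftrightarrow>
    (\<exists>(\<alpha> :: nat \<Rightarrow> int) (\<alpha>' :: nat \<Rightarrow> nat \<Rightarrow> int) (\<kappa> :: nat \<Rightarrow> int).
      \<alpha> 0 = 0 \<and> \<alpha>' 0 0 = 0 \<and> \<kappa> 0 = 0 \<and>
      A = {elt p q (\<alpha> i + j * int p) (i + \<alpha>' i j * int q) |(i::nat) (j::nat). i \<in> {..<q} \<and> j \<in> {..<p}} \<and>
      B = {elt p q (i + \<kappa> i * int p) (j * int q) |(i::nat) (j::nat). i \<in> {..<p} \<and> j \<in> {..<q}})"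

definition form_9 :: "nat \<Rightarrow> nat \<Rightarrow> (int \<times> int) set \<Rightarrow> (int \<times> int) set \<Rightarrow> bool" where
  "form_9 p q A B \<longleftrightarrow>
    (\<exists>\<alpha> :: nat \<Rightarrow> nat \<Rightarrow> int.
      \<alpha> 0 0 = 0 \<and>
      A = {elt p q (i + \<alpha> i j * int p) (j + \<alpha> i j * int q) |(i::nat) (j::nat). i \<in> {..<p} \<and> j \<in> {..<q}} \<and>
      B = {elt p q (i * int p) (j * int q) |(i::nat) (j::nat). i \<in> {..<p} \<and> j \<in> {..<q}})"

definition form_10 :: "nat \<Rightarrow> nat \<Rightarrow> (int \<times> int) set \<Rightarrow> (int \<times> int) set \<Rightarrow> bool" where
  "form_10 p q A B \<longleftrightarrow>
    (\<exists>(\<alpha> :: nat \<Rightarrow> nat \<Rightarrow> int) (\<kappa> :: nat \<Rightarrow> int).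
      \<alpha> 0 0 = 0 \<and> \<kappa> 0 = 0 \<and>
      A = {elt p q (j + k * int p) (i + \<alpha> i j * int q) |(i::nat) (j::nat) (k::nat). i \<in> {..<q} \<and> j \<in> {..<p} \<and> k \<in> {..<p}} \<and>
      B = {elt p q (int p * \<kappa> i) (i * int q) |(i::nat). i \<in> {..<q}})"

definition form_11 :: "nat \<Rightarrow> nat \<Rightarrow> (int \<times> int) set \<Rightarrow> (int \<times> int) set \<Rightarrow> bool" where
  "form_11 p q A B \<longleftrightarrow>
    (\<exists>(\<alpha> :: nat \<Rightarrow> int) (\<kappa> :: nat \<Rightarrow> int).
      \<alpha> 0 = 0 \<and> \<kappa> 0 = 0 \<and>
      A = {elt p q i (\<alpha> i + j * int q) |(i::nat) (j::nat). i \<in> {..<p\<^sup>2} \<and> j \<in> {..<q}} \<and>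
      B = {elt p q 0 (i + \<kappa> i * int q) |(i::nat). i \<in> {..<q}})"

definition form_12 :: "nat \<Rightarrow> nat \<Rightarrow> (int \<times> int) set \<Rightarrow> (int \<times> int) set \<Rightarrow> bool" where
  "form_12 p q A B \<longleftrightarrow>
    (\<exists>(\<alpha> :: nat \<Rightarrow> int) (\<kappa> :: nat \<Rightarrow> int).
      \<alpha> 0 = 0 \<and> \<kappa> 0 = 0 \<and>
      A = {elt p q j (i + \<alpha> i * int q) |(i::nat) (j::nat). i \<in> {..<q} \<and> j \<in> {..<p\<^sup>2}} \<and>
      B = {elt p q (\<kappa> i) (i * int q) |(i::nat). i \<in> {..<q}})"

definition form_13 :: "nat \<Rightarrow> nat \<Rightarrow> (int \<times> int) set \<Rightarrow> (int \<times> int) set \<Rightarrow> bool" where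
  "form_13 p q A B \<longleftrightarrow>
    (\<exists>(\<alpha> :: nat \<Rightarrow> int) (\<kappa> :: nat \<Rightarrow> int).
      \<alpha> 0 = 0 \<and> \<kappa> 0 = 0 \<and>
      A = {elt p q (i + j * int p) (\<alpha> i + k * int q) |(i::nat) (j::nat) (k::nat). i \<in> {..<p} \<and> j \<in> {..<p} \<and> k \<in> {..<q}} \<and>
      B = {elt p q (int p * \<kappa> i) (i + int q * \<kappa> i) |(i::nat). i \<in> {..<q}})"

definition form_14 :: "nat \<Rightarrow> nat \<Rightarrow> (int \<times> int) set \<Rightarrow> (int \<times> int) set \<Rightarrow> bool" where
  "form_14 p q A B \<longleftrightarrow>
    (\<exists>\<alpha> :: nat \<Rightarrow> nat \<Rightarrow> int.
      \<alpha> 0 0 = 0 \<and>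
      A = {elt p q i (j + \<alpha> i j * int q) |(i::nat) (j::nat). i \<in> {..<p\<^sup>2} \<and> j \<in> {..<q}} \<and>
      B = {elt p q 0 (i * int q) |(i::nat). i \<in> {..<q}})"

definition form_15 :: "nat \<Rightarrow> nat \<Rightarrow> (int \<times> int) set \<Rightarrow> (int \<times> int) set \<Rightarrow> bool" where
  "form_15 p q A B \<longleftrightarrow>
    (\<exists>(\<alpha> :: nat \<Rightarrow> nat \<Rightarrow> int) (\<kappa> :: nat \<Rightarrow> int).
      \<alpha> 0 0 = 0 \<and> \<kappa> 0 = 0 \<and>
      A = {elt p q (i + \<alpha> i j * int p) (j + k * int q) |(i::nat) (j::nat) (k::nat). i \<in> {..<p} \<and> j \<in> {..<q} \<and> k \<in> {..<q}} \<and>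
      B = {elt p q (i * int p) (\<kappa> i * int q) |(i::nat). i \<in> {..<p}})"

definition form_16 :: "nat \<Rightarrow> nat \<Rightarrow> (int \<times> int) set \<Rightarrow> (int \<times> int) set \<Rightarrow> bool" where
  "form_16 p q A B \<longleftrightarrow>
    (\<exists>(\<alpha> :: nat \<Rightarrow> int) (\<kappa> :: nat \<Rightarrow> int).
      \<alpha> 0 = 0 \<and> \<kappa> 0 = 0 \<and>
      A = {elt p q (\<alpha> i + j * int p) i |(i::nat) (j::nat). i \<in> {..<q\<^sup>2} \<and> j \<in> {..<p}} \<and>
      B = {elt p q (i + \<kappa> i * int p) 0 |(i::nat). i \<in> {..<p}})"

definition form_17 :: "nat \<Rightarrow> nat \<Rightarrow> (int \<times> int) set \<Rightarrow> (int \<times> int) set \<Rightarrow> bool" where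
  "form_17 p q A B \<longleftrightarrow>
    (\<exists>(\<alpha> :: nat \<Rightarrow> int) (\<kappa> :: nat \<Rightarrow> int).
      \<alpha> 0 = 0 \<and> \<kappa> 0 = 0 \<and>
      A = {elt p q (i + \<alpha> i * int p) j |(i::nat) (j::nat). i \<in> {..<p} \<and> j \<in> {..<q\<^sup>2}} \<and>
      B = {elt p q (i * int p) (\<kappa> i) |(i::nat). i \<in> {..<p}})"

definition form_18 :: "nat \<Rightarrow> nat \<Rightarrow> (int \<times> int) set \<Rightarrow> (int \<times> int) set \<Rightarrow> bool" where
  "form_18 p q A B \<longleftrightarrow>
    (\<exists>(\<alpha> :: nat \<Rightarrow> int) (\<kappa> :: nat \<Rightarrow> int).
      \<alpha> 0 = 0 \<and> \<kappa> 0 = 0 \<and>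
      A = {elt p q (\<alpha> i + j * int p) (i + k * int q) |(i::nat) (k::nat) (j::nat). i \<in> {..<q} \<and> k \<in> {..<q} \<and> j \<in> {..<p}} \<and>
      B = {elt p q (i + int p * \<kappa> i) (int q * \<kappa> i) |(i::nat). i \<in> {..<p}})"

definition form_19 :: "nat \<Rightarrow> nat \<Rightarrow> (int \<times> int) set \<Rightarrow> (int \<times> int) set \<Rightarrow> bool" where
  "form_19 p q A B \<longleftrightarrow>
    (\<exists>\<alpha> :: nat \<Rightarrow> nat \<Rightarrow> int.
      \<alpha> 0 0 = 0 \<and>
      A = {elt p q (i + \<alpha> i j * int p) j |(i::nat) (j::nat). i \<in> {..<p} \<and> j \<in> {..<q\<^sup>2}} \<and>
      B = {elt p q (i * int p) 0 |(i::nat). i \<in> {..<p}})"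

locale factor_pair =
  fixes p q :: nat and A B :: "(int \<times> int) set"
  assumes prime_p: "prime p" and prime_q: "prime q" and p_neq_q: "p \<noteq> q"
    and A_sub: "A \<subseteq> {0..<(int p)\<^sup>2} \<times> {0..<(int q)\<^sup>2}"
    and B_sub: "B \<subseteq> {0..<(int p)\<^sup>2} \<times> {0..<(int q)\<^sup>2}"
    and zero_A: "(0, 0) \<in> A" and zero_B: "(0, 0) \<in> B"
    and tiling: "tiling ((int p)\<^sup>2) ((int q)\<^sup>2) A B"
begin

abbreviation "x0 u \<equiv> lo p (fst u)"
abbreviation "x1 u \<equiv> hi p (fst u)"
abbreviation "y0 u \<equiv> lo q (snd u)"
abbreviation "y1 u \<equiv> hi q (snd u)"

lemma p_pos [simp]: "p > 0" and q_pos [simp]: "q > 0"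
  using prime_p prime_q prime_gt_0_nat by blast+

lemma p_nonzero [simp]: "p \<noteq> 0" and q_nonzero [simp]: "q \<noteq> 0"
  using p_pos q_pos by linarith+

lemma coprime_pq: "coprime p q"
  using prime_p prime_q p_neq_q primes_coprime by blast

lemma elt_cong:
  assumes "u \<in> A \<union> B" and "[x = fst u] (mod (int p)\<^sup>2)" and "[y = snd u] (mod (int q)\<^sup>2)"
  shows "u = elt p q x y"
  using assms A_sub B_sub by (cases u) (auto simp: elt_def cong_def)

lemma digits:
  assumes "u \<in> A \<union> B"
  shows "fst u = int (x0 u) + int (x1 u) * int p"
    and "snd u = int (y0 u) + int (y1 u) * int q"
proof -
  have u: "0 \<le> fst u" "0 \<le> snd u" using assms A_sub B_sub by (auto simp: mem_Times_iff)
  then show "fst u = int (x0 u) + int (x1 u) * int p"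
    and "snd u = int (y0 u) + int (y1 u) * int q" by (simp_all add: lo_hi)
qed

lemma elt_eqI_digits:
  assumes "u \<in> A \<union> B" and "[x = int (x0 u) + int (x1 u) * int p] (mod (int p)\<^sup>2)"
    and "[y = int (y0 u) + int (y1 u) * int q] (mod (int q)\<^sup>2)"
  shows "elt p q x y = u"
  using elt_cong[OF assms(1)] assms(2,3) digits[OF assms(1)] by metis

lemma elt_eqI_fst_digits:
  assumes "u \<in> A \<union> B" and "[x = int (x0 u) + int (x1 u) * int p] (mod (int p)\<^sup>2)"
    and "[y = snd u] (mod (int q)\<^sup>2)"
  shows "elt p q x y = u"
  using elt_cong[OF assms(1)] assms(2,3) digits[OF assms(1)] by metis

lemma elt_eqI_snd_digits:
  assumes "u \<in> A \<union> B" and "[x = fst u] (mod (int p)\<^sup>2)"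
    and "[y = int (y0 u) + int (y1 u) * int q] (mod (int q)\<^sup>2)"
  shows "elt p q x y = u"
  using elt_cong[OF assms(1)] assms(2,3) digits[OF assms(1)] by metis

lemma digit_bounds:
  assumes "u \<in> A \<union> B"
  shows "x1 u < p" and "y1 u < q" and "x0 u < p" and "y0 u < q"
    and "nat (fst u) < p\<^sup>2" and "nat (snd u) < q\<^sup>2"
    and "int (nat (fst u)) = fst u" and "int (nat (snd u)) = snd u"
proof -
  have u: "0 \<le> fst u" "fst u < (int p)\<^sup>2" "0 \<le> snd u" "snd u < (int q)\<^sup>2"
    using assms A_sub B_sub by (auto simp: mem_Times_iff)
  show "x1 u < p" "y1 u < q" using u hi_less by auto
  show "x0 u < p" "y0 u < q" by (simp_all add: lo_less)
  show "nat (fst u) < p\<^sup>2" "nat (snd u) < q\<^sup>2" "int (nat (fst u)) = fst u" "int (nat (snd u)) = snd u"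
    using u by (simp_all add: nat_less_iff)
qed

end

section \<open>Families from dependencies between digits\<close>

context factor_pair begin
lemma crt_congs:
  "[crt p q u v = int u] (mod (int p)\<^sup>2)" "[crt p q u v = int v] (mod (int q)\<^sup>2)"
  "[i + int p * crt p q u v = i + int p * int u] (mod (int p)\<^sup>2)"
  "[i + int q * crt p q u v = i + int q * int v] (mod (int q)\<^sup>2)"
  "[i + crt p q u v = i + int v] (mod (int q)\<^sup>2)"
  "[int p * crt p q u v = int p * int u] (mod (int p)\<^sup>2)"
  "[j + crt p q u v = int v + j] (mod (int q)\<^sup>2)"
proof -
  have "[crt p q u v + j = int v + j] (mod (int q)\<^sup>2)" by (intro cong_add cong_refl crt coprime_pq)
  then show "[j + crt p q u v = int v + j] (mod (int q)\<^sup>2)" by (simp only: add.commute[of j])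
qed (intro cong_add cong_mult cong_refl crt coprime_pq)+

text \<open>
  In each of the following lemmas the hypotheses say which digits of the elements of \<open>A\<close> and \<open>B\<close> depend
  on which others. The dependent digits become the parameters. The parameters vanish at index 0 because
  0 lies in both sets.
\<close>
lemma form_1I:
  assumes card_A: "card A = p" and card_B: "card B = p * q\<^sup>2"
    and A: "\<And>a a'. a \<in> A \<Longrightarrow> a' \<in> A \<Longrightarrow> x0 a = x0 a' \<Longrightarrow> a = a'"
    and B: "\<And>b. b \<in> B \<Longrightarrow> x0 b = 0"
  shows "form_1 p q A B"
proof -
  have "\<exists>\<alpha>. \<forall>a\<in>A. \<alpha> (x0 a) = int (x1 a)"
    by (rule function_of) (metis A)
  then obtain \<alpha> where \<alpha>: "\<And>a. a \<in> A \<Longrightarrow> \<alpha> (x0 a) = int (x1 a)" by blast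
  have "\<exists>\<beta>. \<forall>a\<in>A. \<beta> (x0 a) = snd a"
    by (rule function_of) (metis A)
  then obtain \<beta> where \<beta>: "\<And>a. a \<in> A \<Longrightarrow> \<beta> (x0 a) = snd a" by blast
  let ?A = "{elt p q (i + \<alpha> i * int p) (\<beta> i) |(i::nat). i \<in> {..<p}}"
  have A_eq: "A = ?A"
  proof (rule eq_grid1)
    show "A \<subseteq> ?A"
    proof
      fix a assume a: "a \<in> A"
      let ?u = "elt p q (x0 a + \<alpha> (x0 a) * int p) (\<beta> (x0 a))"
      have "?u = a"
        by (rule elt_eqI_fst_digits) (use a digit_bounds(7,8)[of a] \<alpha>[OF a] \<beta>[OF a] in \<open>auto simp: crt_congs algebra_simps\<close>)
      moreover have "?u \<in> ?A"
        by (intro CollectI exI conjI, rule refl) (use digit_bounds[of a] a in auto)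
      ultimately show "a \<in> ?A" by (simp only:)
    qed
  qed (simp add: card_A mult.assoc power2_eq_square)
  let ?B = "{elt p q (i * int p) j |(i::nat) (j::nat). i \<in> {..<p} \<and> j \<in> {..<q\<^sup>2}}"
  have B_eq: "B = ?B"
  proof (rule eq_grid2)
    show "B \<subseteq> ?B"
    proof
      fix b assume b: "b \<in> B"
      let ?u = "elt p q (x1 b * int p) (nat (snd b))"
      have "?u = b"
        by (rule elt_eqI_fst_digits) (use b digit_bounds(7,8)[of b] B(1)[OF b] in \<open>auto simp: crt_congs algebra_simps\<close>)
      moreover have "?u \<in> ?B"
        by (intro CollectI exI conjI, rule refl) (use digit_bounds[of b] b in auto)
      ultimately show "b \<in> ?B" by (simp only:)
    qed
  qed (simp add: card_B mult.assoc power2_eq_square)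
  have alpha_0: "\<alpha> 0 = 0" using \<alpha>[OF zero_A] by simp
  have beta_0: "\<beta> 0 = 0" using \<beta>[OF zero_A] by simp
  show ?thesis unfolding form_1_def
    by (rule exI[of _ \<alpha>], rule exI[of _ \<beta>]) (intro conjI A_eq B_eq alpha_0 beta_0)
qed

lemma form_3I:
  assumes card_A: "card A = p * q" and card_B: "card B = p * q"
    and A: "\<And>a a'. a \<in> A \<Longrightarrow> a' \<in> A \<Longrightarrow> x0 a = x0 a' \<Longrightarrow> fst a = fst a'"
      "\<And>a a'. a \<in> A \<Longrightarrow> a' \<in> A \<Longrightarrow> x0 a = x0 a' \<Longrightarrow> y0 a = y0 a'"
    and B: "\<And>b. b \<in> B \<Longrightarrow> x0 b = 0"
      "\<And>b b'. b \<in> B \<Longrightarrow> b' \<in> B \<Longrightarrow> fst b = fst b' \<Longrightarrow> y0 b = y0 b' \<Longrightarrow> b = b'"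
  shows "form_3 p q A B"
proof -
  have "\<exists>\<alpha>. \<forall>a\<in>A. \<alpha> (x0 a) = crt p q (x1 a) (y0 a)"
    by (rule function_of) (metis A)
  then obtain \<alpha> where \<alpha>: "\<And>a. a \<in> A \<Longrightarrow> \<alpha> (x0 a) = crt p q (x1 a) (y0 a)" by blast
  have "\<exists>\<kappa>. \<forall>b\<in>B. \<kappa> (x1 b) (y0 b) = int (y1 b)"
    by (rule function_of2) (metis B digits UnI1 UnI2)
  then obtain \<kappa> where \<kappa>: "\<And>b. b \<in> B \<Longrightarrow> \<kappa> (x1 b) (y0 b) = int (y1 b)" by blast
  let ?A = "{elt p q (i + \<alpha> i * int p) (\<alpha> i + j * int q) |(i::nat) (j::nat). i \<in> {..<p} \<and> j \<in> {..<q}}"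
  have A_eq: "A = ?A"
  proof (rule eq_grid2)
    show "A \<subseteq> ?A"
    proof
      fix a assume a: "a \<in> A"
      let ?u = "elt p q (x0 a + \<alpha> (x0 a) * int p) (\<alpha> (x0 a) + y1 a * int q)"
      have "?u = a"
        by (rule elt_eqI_digits) (use a \<alpha>[OF a] in \<open>auto simp: crt_congs algebra_simps\<close>)
      moreover have "?u \<in> ?A"
        by (intro CollectI exI conjI, rule refl) (use digit_bounds[of a] a in auto)
      ultimately show "a \<in> ?A" by (simp only:)
    qed
  qed (simp add: card_A mult.assoc power2_eq_square)
  let ?B = "{elt p q (i * int p) (j + \<kappa> i j * int q) |(i::nat) (j::nat). i \<in> {..<p} \<and> j \<in> {..<q}}"
  have B_eq: "B = ?B"
  proof (rule eq_grid2)
    show "B \<subseteq> ?B"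
    proof
      fix b assume b: "b \<in> B"
      let ?u = "elt p q (x1 b * int p) (y0 b + \<kappa> (x1 b) (y0 b) * int q)"
      have "?u = b"
        by (rule elt_eqI_digits) (use b \<kappa>[OF b] B(1)[OF b] in \<open>auto simp: crt_congs algebra_simps\<close>)
      moreover have "?u \<in> ?B"
        by (intro CollectI exI conjI, rule refl) (use digit_bounds[of b] b in auto)
      ultimately show "b \<in> ?B" by (simp only:)
    qed
  qed (simp add: card_B mult.assoc power2_eq_square)
  have alpha_0: "\<alpha> 0 = 0" using \<alpha>[OF zero_A] by simp
  have kappa_0: "\<kappa> 0 0 = 0" using \<kappa>[OF zero_B] by simp
  show ?thesis unfolding form_3_def
    by (rule exI[of _ \<alpha>], rule exI[of _ \<kappa>]) (intro conjI A_eq B_eq alpha_0 kappa_0)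
qed

lemma form_6I:
  assumes card_A: "card A = p * q" and card_B: "card B = p * q"
    and A: "\<And>a a'. a \<in> A \<Longrightarrow> a' \<in> A \<Longrightarrow> x0 a = x0 a' \<Longrightarrow> y0 a = y0 a'"
      "\<And>a a'. a \<in> A \<Longrightarrow> a' \<in> A \<Longrightarrow> x0 a = x0 a' \<Longrightarrow> snd a = snd a' \<Longrightarrow> fst a = fst a'"
    and B: "\<And>b. b \<in> B \<Longrightarrow> x0 b = 0"
      "\<And>b b'. b \<in> B \<Longrightarrow> b' \<in> B \<Longrightarrow> y0 b = y0 b' \<Longrightarrow> snd b = snd b'"
  shows "form_6 p q A B"
proof -
  have "\<exists>\<alpha>'. \<forall>a\<in>A. \<alpha>' (x0 a) (y1 a) = int (x1 a)"
    by (rule function_of2) (metis A digits UnI1 UnI2)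
  then obtain \<alpha>' where \<alpha>': "\<And>a. a \<in> A \<Longrightarrow> \<alpha>' (x0 a) (y1 a) = int (x1 a)" by blast
  have "\<exists>\<alpha>. \<forall>a\<in>A. \<alpha> (x0 a) = int (y0 a)"
    by (rule function_of) (metis A)
  then obtain \<alpha> where \<alpha>: "\<And>a. a \<in> A \<Longrightarrow> \<alpha> (x0 a) = int (y0 a)" by blast
  have "\<exists>\<kappa>. \<forall>b\<in>B. \<kappa> (y0 b) = int (y1 b)"
    by (rule function_of) (metis B)
  then obtain \<kappa> where \<kappa>: "\<And>b. b \<in> B \<Longrightarrow> \<kappa> (y0 b) = int (y1 b)" by blast
  let ?A = "{elt p q (i + \<alpha>' i j * int p) (\<alpha> i + j * int q) |(i::nat) (j::nat). i \<in> {..<p} \<and> j \<in> {..<q}}"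
  have A_eq: "A = ?A"
  proof (rule eq_grid2)
    show "A \<subseteq> ?A"
    proof
      fix a assume a: "a \<in> A"
      let ?u = "elt p q (x0 a + \<alpha>' (x0 a) (y1 a) * int p) (\<alpha> (x0 a) + y1 a * int q)"
      have "?u = a"
        by (rule elt_eqI_digits) (use a \<alpha>'[OF a] \<alpha>[OF a] in \<open>auto simp: crt_congs algebra_simps\<close>)
      moreover have "?u \<in> ?A"
        by (intro CollectI exI conjI, rule refl) (use digit_bounds[of a] a in auto)
      ultimately show "a \<in> ?A" by (simp only:)
    qed
  qed (simp add: card_A mult.assoc power2_eq_square)
  let ?B = "{elt p q (j * int p) (i + \<kappa> i * int q) |(i::nat) (j::nat). i \<in> {..<q} \<and> j \<in> {..<p}}"
  have B_eq: "B = ?B"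
  proof (rule eq_grid2)
    show "B \<subseteq> ?B"
    proof
      fix b assume b: "b \<in> B"
      let ?u = "elt p q (x1 b * int p) (y0 b + \<kappa> (y0 b) * int q)"
      have "?u = b"
        by (rule elt_eqI_digits) (use b \<kappa>[OF b] B(1)[OF b] in \<open>auto simp: crt_congs algebra_simps\<close>)
      moreover have "?u \<in> ?B"
        by (intro CollectI exI conjI, rule refl) (use digit_bounds[of b] b in auto)
      ultimately show "b \<in> ?B" by (simp only:)
    qed
  qed (simp add: card_B mult.assoc power2_eq_square)
  have alpha2_0: "\<alpha>' 0 0 = 0" using \<alpha>'[OF zero_A] by simp
  have alpha_0: "\<alpha> 0 = 0" using \<alpha>[OF zero_A] by simp
  have kappa_0: "\<kappa> 0 = 0" using \<kappa>[OF zero_B] by simp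
  show ?thesis unfolding form_6_def
    by (rule exI[of _ \<alpha>'], rule exI[of _ \<alpha>], rule exI[of _ \<kappa>]) (intro conjI A_eq B_eq alpha_0 kappa_0 alpha2_0)
qed

lemma form_7I:
  assumes card_A: "card A = p * q" and card_B: "card B = p * q"
    and A: "\<And>a a'. a \<in> A \<Longrightarrow> a' \<in> A \<Longrightarrow> x0 a = x0 a' \<Longrightarrow> fst a = fst a'"
      "\<And>a a'. a \<in> A \<Longrightarrow> a' \<in> A \<Longrightarrow> x0 a = x0 a' \<Longrightarrow> y0 a = y0 a' \<Longrightarrow> snd a = snd a'"
    and B: "\<And>b. b \<in> B \<Longrightarrow> x0 b = 0"
      "\<And>b b'. b \<in> B \<Longrightarrow> b' \<in> B \<Longrightarrow> fst b = fst b' \<Longrightarrow> y0 b = y0 b'"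
  shows "form_7 p q A B"
proof -
  have "\<exists>\<alpha>. \<forall>a\<in>A. \<alpha> (x0 a) = int (x1 a)"
    by (rule function_of) (metis A)
  then obtain \<alpha> where \<alpha>: "\<And>a. a \<in> A \<Longrightarrow> \<alpha> (x0 a) = int (x1 a)" by blast
  have "\<exists>\<alpha>'. \<forall>a\<in>A. \<alpha>' (x0 a) (y0 a) = int (y1 a)"
    by (rule function_of2) (metis A)
  then obtain \<alpha>' where \<alpha>': "\<And>a. a \<in> A \<Longrightarrow> \<alpha>' (x0 a) (y0 a) = int (y1 a)" by blast
  have "\<exists>\<kappa>. \<forall>b\<in>B. \<kappa> (x1 b) = int (y0 b)"
    by (rule function_of) (metis B digits UnI1 UnI2)
  then obtain \<kappa> where \<kappa>: "\<And>b. b \<in> B \<Longrightarrow> \<kappa> (x1 b) = int (y0 b)" by blast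
  let ?A = "{elt p q (i + \<alpha> i * int p) (j + \<alpha>' i j * int q) |(i::nat) (j::nat). i \<in> {..<p} \<and> j \<in> {..<q}}"
  have A_eq: "A = ?A"
  proof (rule eq_grid2)
    show "A \<subseteq> ?A"
    proof
      fix a assume a: "a \<in> A"
      let ?u = "elt p q (x0 a + \<alpha> (x0 a) * int p) (y0 a + \<alpha>' (x0 a) (y0 a) * int q)"
      have "?u = a"
        by (rule elt_eqI_digits) (use a \<alpha>[OF a] \<alpha>'[OF a] in \<open>auto simp: crt_congs algebra_simps\<close>)
      moreover have "?u \<in> ?A"
        by (intro CollectI exI conjI, rule refl) (use digit_bounds[of a] a in auto)
      ultimately show "a \<in> ?A" by (simp only:)
    qed
  qed (simp add: card_A mult.assoc power2_eq_square)
  let ?B = "{elt p q (i * int p) (\<kappa> i + j * int q) |(i::nat) (j::nat). i \<in> {..<p} \<and> j \<in> {..<q}}"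
  have B_eq: "B = ?B"
  proof (rule eq_grid2)
    show "B \<subseteq> ?B"
    proof
      fix b assume b: "b \<in> B"
      let ?u = "elt p q (x1 b * int p) (\<kappa> (x1 b) + y1 b * int q)"
      have "?u = b"
        by (rule elt_eqI_digits) (use b \<kappa>[OF b] B(1)[OF b] in \<open>auto simp: crt_congs algebra_simps\<close>)
      moreover have "?u \<in> ?B"
        by (intro CollectI exI conjI, rule refl) (use digit_bounds[of b] b in auto)
      ultimately show "b \<in> ?B" by (simp only:)
    qed
  qed (simp add: card_B mult.assoc power2_eq_square)
  have alpha_0: "\<alpha> 0 = 0" using \<alpha>[OF zero_A] by simp
  have alpha2_0: "\<alpha>' 0 0 = 0" using \<alpha>'[OF zero_A] by simp
  have kappa_0: "\<kappa> 0 = 0" using \<kappa>[OF zero_B] by simp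
  show ?thesis unfolding form_7_def
    by (rule exI[of _ \<alpha>], rule exI[of _ \<alpha>'], rule exI[of _ \<kappa>]) (intro conjI A_eq B_eq alpha_0 kappa_0 alpha2_0)
qed

lemma form_9I:
  assumes card_A: "card A = p * q" and card_B: "card B = p * q"
    and A: "\<And>a a'. a \<in> A \<Longrightarrow> a' \<in> A \<Longrightarrow> x0 a = x0 a' \<Longrightarrow> y0 a = y0 a' \<Longrightarrow> a = a'"
    and B: "\<And>b. b \<in> B \<Longrightarrow> x0 b = 0"
      "\<And>b. b \<in> B \<Longrightarrow> y0 b = 0"
  shows "form_9 p q A B"
proof -
  have "\<exists>\<alpha>. \<forall>a\<in>A. \<alpha> (x0 a) (y0 a) = crt p q (x1 a) (y1 a)"
    by (rule function_of2) (metis A)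
  then obtain \<alpha> where \<alpha>: "\<And>a. a \<in> A \<Longrightarrow> \<alpha> (x0 a) (y0 a) = crt p q (x1 a) (y1 a)" by blast
  let ?A = "{elt p q (i + \<alpha> i j * int p) (j + \<alpha> i j * int q) |(i::nat) (j::nat). i \<in> {..<p} \<and> j \<in> {..<q}}"
  have A_eq: "A = ?A"
  proof (rule eq_grid2)
    show "A \<subseteq> ?A"
    proof
      fix a assume a: "a \<in> A"
      let ?u = "elt p q (x0 a + \<alpha> (x0 a) (y0 a) * int p) (y0 a + \<alpha> (x0 a) (y0 a) * int q)"
      have "?u = a"
        by (rule elt_eqI_digits) (use a \<alpha>[OF a] in \<open>auto simp: crt_congs algebra_simps\<close>)
      moreover have "?u \<in> ?A"
        by (intro CollectI exI conjI, rule refl) (use digit_bounds[of a] a in auto)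
      ultimately show "a \<in> ?A" by (simp only:)
    qed
  qed (simp add: card_A mult.assoc power2_eq_square)
  let ?B = "{elt p q (i * int p) (j * int q) |(i::nat) (j::nat). i \<in> {..<p} \<and> j \<in> {..<q}}"
  have B_eq: "B = ?B"
  proof (rule eq_grid2)
    show "B \<subseteq> ?B"
    proof
      fix b assume b: "b \<in> B"
      let ?u = "elt p q (x1 b * int p) (y1 b * int q)"
      have "?u = b"
        by (rule elt_eqI_digits) (use b B(1)[OF b] B(2)[OF b] in \<open>auto simp: crt_congs algebra_simps\<close>)
      moreover have "?u \<in> ?B"
        by (intro CollectI exI conjI, rule refl) (use digit_bounds[of b] b in auto)
      ultimately show "b \<in> ?B" by (simp only:)
    qed
  qed (simp add: card_B mult.assoc power2_eq_square)
  have alpha_0: "\<alpha> 0 0 = 0" using \<alpha>[OF zero_A] by simp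
  show ?thesis unfolding form_9_def
    by (rule exI[of _ \<alpha>]) (intro conjI A_eq B_eq alpha_0)
qed

lemma form_10I:
  assumes card_A: "card A = p\<^sup>2 * q" and card_B: "card B = q"
    and A: "\<And>a a'. a \<in> A \<Longrightarrow> a' \<in> A \<Longrightarrow> x0 a = x0 a' \<Longrightarrow> y0 a = y0 a' \<Longrightarrow> snd a = snd a'"
    and B: "\<And>b. b \<in> B \<Longrightarrow> x0 b = 0"
      "\<And>b. b \<in> B \<Longrightarrow> y0 b = 0"
      "\<And>b b'. b \<in> B \<Longrightarrow> b' \<in> B \<Longrightarrow> snd b = snd b' \<Longrightarrow> fst b = fst b'"
  shows "form_10 p q A B"
proof -
  have "\<exists>\<alpha>. \<forall>a\<in>A. \<alpha> (y0 a) (x0 a) = int (y1 a)"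
    by (rule function_of2) (metis A)
  then obtain \<alpha> where \<alpha>: "\<And>a. a \<in> A \<Longrightarrow> \<alpha> (y0 a) (x0 a) = int (y1 a)" by blast
  have "\<exists>\<kappa>. \<forall>b\<in>B. \<kappa> (y1 b) = int (x1 b)"
    by (rule function_of) (metis B digits UnI1 UnI2)
  then obtain \<kappa> where \<kappa>: "\<And>b. b \<in> B \<Longrightarrow> \<kappa> (y1 b) = int (x1 b)" by blast
  let ?A = "{elt p q (j + k * int p) (i + \<alpha> i j * int q) |(i::nat) (j::nat) (k::nat). i \<in> {..<q} \<and> j \<in> {..<p} \<and> k \<in> {..<p}}"
  have A_eq: "A = ?A"
  proof (rule eq_grid3)
    show "A \<subseteq> ?A"
    proof
      fix a assume a: "a \<in> A"
      let ?u = "elt p q (x0 a + x1 a * int p) (y0 a + \<alpha> (y0 a) (x0 a) * int q)"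
      have "?u = a"
        by (rule elt_eqI_digits) (use a \<alpha>[OF a] in \<open>auto simp: crt_congs algebra_simps\<close>)
      moreover have "?u \<in> ?A"
        by (intro CollectI exI conjI, rule refl) (use digit_bounds[of a] a in auto)
      ultimately show "a \<in> ?A" by (simp only:)
    qed
  qed (simp add: card_A mult.assoc power2_eq_square)
  let ?B = "{elt p q (int p * \<kappa> i) (i * int q) |(i::nat). i \<in> {..<q}}"
  have B_eq: "B = ?B"
  proof (rule eq_grid1)
    show "B \<subseteq> ?B"
    proof
      fix b assume b: "b \<in> B"
      let ?u = "elt p q (int p * \<kappa> (y1 b)) (y1 b * int q)"
      have "?u = b"
        by (rule elt_eqI_digits) (use b \<kappa>[OF b] B(1)[OF b] B(2)[OF b] in \<open>auto simp: crt_congs algebra_simps\<close>)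
      moreover have "?u \<in> ?B"
        by (intro CollectI exI conjI, rule refl) (use digit_bounds[of b] b in auto)
      ultimately show "b \<in> ?B" by (simp only:)
    qed
  qed (simp add: card_B mult.assoc power2_eq_square)
  have alpha_0: "\<alpha> 0 0 = 0" using \<alpha>[OF zero_A] by simp
  have kappa_0: "\<kappa> 0 = 0" using \<kappa>[OF zero_B] by simp
  show ?thesis unfolding form_10_def
    by (rule exI[of _ \<alpha>], rule exI[of _ \<kappa>]) (intro conjI A_eq B_eq alpha_0 kappa_0)
qed

lemma form_11I:
  assumes card_A: "card A = p\<^sup>2 * q" and card_B: "card B = q"
    and A: "\<And>a a'. a \<in> A \<Longrightarrow> a' \<in> A \<Longrightarrow> fst a = fst a' \<Longrightarrow> y0 a = y0 a'"
    and B: "\<And>b. b \<in> B \<Longrightarrow> fst b = 0"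
      "\<And>b b'. b \<in> B \<Longrightarrow> b' \<in> B \<Longrightarrow> y0 b = y0 b' \<Longrightarrow> snd b = snd b'"
  shows "form_11 p q A B"
proof -
  have "\<exists>\<alpha>. \<forall>a\<in>A. \<alpha> (nat (fst a)) = int (y0 a)"
    by (rule function_of) (metis A digit_bounds(7,8) UnI1 UnI2)
  then obtain \<alpha> where \<alpha>: "\<And>a. a \<in> A \<Longrightarrow> \<alpha> (nat (fst a)) = int (y0 a)" by blast
  have "\<exists>\<kappa>. \<forall>b\<in>B. \<kappa> (y0 b) = int (y1 b)"
    by (rule function_of) (metis B)
  then obtain \<kappa> where \<kappa>: "\<And>b. b \<in> B \<Longrightarrow> \<kappa> (y0 b) = int (y1 b)" by blast
  let ?A = "{elt p q i (\<alpha> i + j * int q) |(i::nat) (j::nat). i \<in> {..<p\<^sup>2} \<and> j \<in> {..<q}}"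
  have A_eq: "A = ?A"
  proof (rule eq_grid2)
    show "A \<subseteq> ?A"
    proof
      fix a assume a: "a \<in> A"
      let ?u = "elt p q (nat (fst a)) (\<alpha> (nat (fst a)) + y1 a * int q)"
      have "?u = a"
        by (rule elt_eqI_snd_digits) (use a digit_bounds(7,8)[of a] \<alpha>[OF a] in \<open>auto simp: crt_congs algebra_simps\<close>)
      moreover have "?u \<in> ?A"
        by (intro CollectI exI conjI, rule refl) (use digit_bounds[of a] a in auto)
      ultimately show "a \<in> ?A" by (simp only:)
    qed
  qed (simp add: card_A mult.assoc power2_eq_square)
  let ?B = "{elt p q 0 (i + \<kappa> i * int q) |(i::nat). i \<in> {..<q}}"
  have B_eq: "B = ?B"
  proof (rule eq_grid1)
    show "B \<subseteq> ?B"
    proof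
      fix b assume b: "b \<in> B"
      let ?u = "elt p q 0 (y0 b + \<kappa> (y0 b) * int q)"
      have "?u = b"
        by (rule elt_eqI_snd_digits) (use b digit_bounds(7,8)[of b] \<kappa>[OF b] B(1)[OF b] in \<open>auto simp: crt_congs algebra_simps\<close>)
      moreover have "?u \<in> ?B"
        by (intro CollectI exI conjI, rule refl) (use digit_bounds[of b] b in auto)
      ultimately show "b \<in> ?B" by (simp only:)
    qed
  qed (simp add: card_B mult.assoc power2_eq_square)
  have alpha_0: "\<alpha> 0 = 0" using \<alpha>[OF zero_A] by simp
  have kappa_0: "\<kappa> 0 = 0" using \<kappa>[OF zero_B] by simp
  show ?thesis unfolding form_11_def
    by (rule exI[of _ \<alpha>], rule exI[of _ \<kappa>]) (intro conjI A_eq B_eq alpha_0 kappa_0)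
qed

lemma form_13I:
  assumes card_A: "card A = p\<^sup>2 * q" and card_B: "card B = q"
    and A: "\<And>a a'. a \<in> A \<Longrightarrow> a' \<in> A \<Longrightarrow> x0 a = x0 a' \<Longrightarrow> y0 a = y0 a'"
    and B: "\<And>b. b \<in> B \<Longrightarrow> x0 b = 0"
      "\<And>b b'. b \<in> B \<Longrightarrow> b' \<in> B \<Longrightarrow> y0 b = y0 b' \<Longrightarrow> b = b'"
  shows "form_13 p q A B"
proof -
  have "\<exists>\<alpha>. \<forall>a\<in>A. \<alpha> (x0 a) = int (y0 a)"
    by (rule function_of) (metis A)
  then obtain \<alpha> where \<alpha>: "\<And>a. a \<in> A \<Longrightarrow> \<alpha> (x0 a) = int (y0 a)" by blast
  have "\<exists>\<kappa>. \<forall>b\<in>B. \<kappa> (y0 b) = crt p q (x1 b) (y1 b)"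
    by (rule function_of) (metis B)
  then obtain \<kappa> where \<kappa>: "\<And>b. b \<in> B \<Longrightarrow> \<kappa> (y0 b) = crt p q (x1 b) (y1 b)" by blast
  let ?A = "{elt p q (i + j * int p) (\<alpha> i + k * int q) |(i::nat) (j::nat) (k::nat). i \<in> {..<p} \<and> j \<in> {..<p} \<and> k \<in> {..<q}}"
  have A_eq: "A = ?A"
  proof (rule eq_grid3)
    show "A \<subseteq> ?A"
    proof
      fix a assume a: "a \<in> A"
      let ?u = "elt p q (x0 a + x1 a * int p) (\<alpha> (x0 a) + y1 a * int q)"
      have "?u = a"
        by (rule elt_eqI_digits) (use a \<alpha>[OF a] in \<open>auto simp: crt_congs algebra_simps\<close>)
      moreover have "?u \<in> ?A"
        by (intro CollectI exI conjI, rule refl) (use digit_bounds[of a] a in auto)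
      ultimately show "a \<in> ?A" by (simp only:)
    qed
  qed (simp add: card_A mult.assoc power2_eq_square)
  let ?B = "{elt p q (int p * \<kappa> i) (i + int q * \<kappa> i) |(i::nat). i \<in> {..<q}}"
  have B_eq: "B = ?B"
  proof (rule eq_grid1)
    show "B \<subseteq> ?B"
    proof
      fix b assume b: "b \<in> B"
      let ?u = "elt p q (int p * \<kappa> (y0 b)) (y0 b + int q * \<kappa> (y0 b))"
      have "?u = b"
        by (rule elt_eqI_digits) (use b \<kappa>[OF b] B(1)[OF b] in \<open>auto simp: crt_congs algebra_simps\<close>)
      moreover have "?u \<in> ?B"
        by (intro CollectI exI conjI, rule refl) (use digit_bounds[of b] b in auto)
      ultimately show "b \<in> ?B" by (simp only:)
    qed
  qed (simp add: card_B mult.assoc power2_eq_square)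
  have alpha_0: "\<alpha> 0 = 0" using \<alpha>[OF zero_A] by simp
  have kappa_0: "\<kappa> 0 = 0" using \<kappa>[OF zero_B] by simp
  show ?thesis unfolding form_13_def
    by (rule exI[of _ \<alpha>], rule exI[of _ \<kappa>]) (intro conjI A_eq B_eq alpha_0 kappa_0)
qed

lemma form_14I:
  assumes card_A: "card A = p\<^sup>2 * q" and card_B: "card B = q"
    and A: "\<And>a a'. a \<in> A \<Longrightarrow> a' \<in> A \<Longrightarrow> fst a = fst a' \<Longrightarrow> y0 a = y0 a' \<Longrightarrow> snd a = snd a'"
    and B: "\<And>b. b \<in> B \<Longrightarrow> fst b = 0"
      "\<And>b. b \<in> B \<Longrightarrow> y0 b = 0"
  shows "form_14 p q A B"
proof -
  have "\<exists>\<alpha>. \<forall>a\<in>A. \<alpha> (nat (fst a)) (y0 a) = int (y1 a)"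
    by (rule function_of2) (metis A digit_bounds(7,8) UnI1 UnI2)
  then obtain \<alpha> where \<alpha>: "\<And>a. a \<in> A \<Longrightarrow> \<alpha> (nat (fst a)) (y0 a) = int (y1 a)" by blast
  let ?A = "{elt p q i (j + \<alpha> i j * int q) |(i::nat) (j::nat). i \<in> {..<p\<^sup>2} \<and> j \<in> {..<q}}"
  have A_eq: "A = ?A"
  proof (rule eq_grid2)
    show "A \<subseteq> ?A"
    proof
      fix a assume a: "a \<in> A"
      let ?u = "elt p q (nat (fst a)) (y0 a + \<alpha> (nat (fst a)) (y0 a) * int q)"
      have "?u = a"
        by (rule elt_eqI_snd_digits) (use a digit_bounds(7,8)[of a] \<alpha>[OF a] in \<open>auto simp: crt_congs algebra_simps\<close>)
      moreover have "?u \<in> ?A"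
        by (intro CollectI exI conjI, rule refl) (use digit_bounds[of a] a in auto)
      ultimately show "a \<in> ?A" by (simp only:)
    qed
  qed (simp add: card_A mult.assoc power2_eq_square)
  let ?B = "{elt p q 0 (i * int q) |(i::nat). i \<in> {..<q}}"
  have B_eq: "B = ?B"
  proof (rule eq_grid1)
    show "B \<subseteq> ?B"
    proof
      fix b assume b: "b \<in> B"
      let ?u = "elt p q 0 (y1 b * int q)"
      have "?u = b"
        by (rule elt_eqI_snd_digits) (use b digit_bounds(7,8)[of b] B(1)[OF b] B(2)[OF b] in \<open>auto simp: crt_congs algebra_simps\<close>)
      moreover have "?u \<in> ?B"
        by (intro CollectI exI conjI, rule refl) (use digit_bounds[of b] b in auto)
      ultimately show "b \<in> ?B" by (simp only:)
    qed
  qed (simp add: card_B mult.assoc power2_eq_square)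
  have alpha_0: "\<alpha> 0 0 = 0" using \<alpha>[OF zero_A] by simp
  show ?thesis unfolding form_14_def
    by (rule exI[of _ \<alpha>]) (intro conjI A_eq B_eq alpha_0)
qed

lemma form_15I:
  assumes card_A: "card A = p * q\<^sup>2" and card_B: "card B = p"
    and A: "\<And>a a'. a \<in> A \<Longrightarrow> a' \<in> A \<Longrightarrow> x0 a = x0 a' \<Longrightarrow> y0 a = y0 a' \<Longrightarrow> fst a = fst a'"
    and B: "\<And>b. b \<in> B \<Longrightarrow> x0 b = 0"
      "\<And>b. b \<in> B \<Longrightarrow> y0 b = 0"
      "\<And>b b'. b \<in> B \<Longrightarrow> b' \<in> B \<Longrightarrow> fst b = fst b' \<Longrightarrow> snd b = snd b'"
  shows "form_15 p q A B"
proof -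
  have "\<exists>\<alpha>. \<forall>a\<in>A. \<alpha> (x0 a) (y0 a) = int (x1 a)"
    by (rule function_of2) (metis A)
  then obtain \<alpha> where \<alpha>: "\<And>a. a \<in> A \<Longrightarrow> \<alpha> (x0 a) (y0 a) = int (x1 a)" by blast
  have "\<exists>\<kappa>. \<forall>b\<in>B. \<kappa> (x1 b) = int (y1 b)"
    by (rule function_of) (metis B digits UnI1 UnI2)
  then obtain \<kappa> where \<kappa>: "\<And>b. b \<in> B \<Longrightarrow> \<kappa> (x1 b) = int (y1 b)" by blast
  let ?A = "{elt p q (i + \<alpha> i j * int p) (j + k * int q) |(i::nat) (j::nat) (k::nat). i \<in> {..<p} \<and> j \<in> {..<q} \<and> k \<in> {..<q}}"
  have A_eq: "A = ?A"
  proof (rule eq_grid3)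
    show "A \<subseteq> ?A"
    proof
      fix a assume a: "a \<in> A"
      let ?u = "elt p q (x0 a + \<alpha> (x0 a) (y0 a) * int p) (y0 a + y1 a * int q)"
      have "?u = a"
        by (rule elt_eqI_digits) (use a \<alpha>[OF a] in \<open>auto simp: crt_congs algebra_simps\<close>)
      moreover have "?u \<in> ?A"
        by (intro CollectI exI conjI, rule refl) (use digit_bounds[of a] a in auto)
      ultimately show "a \<in> ?A" by (simp only:)
    qed
  qed (simp add: card_A mult.assoc power2_eq_square)
  let ?B = "{elt p q (i * int p) (\<kappa> i * int q) |(i::nat). i \<in> {..<p}}"
  have B_eq: "B = ?B"
  proof (rule eq_grid1)
    show "B \<subseteq> ?B"
    proof
      fix b assume b: "b \<in> B"
      let ?u = "elt p q (x1 b * int p) (\<kappa> (x1 b) * int q)"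
      have "?u = b"
        by (rule elt_eqI_digits) (use b \<kappa>[OF b] B(1)[OF b] B(2)[OF b] in \<open>auto simp: crt_congs algebra_simps\<close>)
      moreover have "?u \<in> ?B"
        by (intro CollectI exI conjI, rule refl) (use digit_bounds[of b] b in auto)
      ultimately show "b \<in> ?B" by (simp only:)
    qed
  qed (simp add: card_B mult.assoc power2_eq_square)
  have alpha_0: "\<alpha> 0 0 = 0" using \<alpha>[OF zero_A] by simp
  have kappa_0: "\<kappa> 0 = 0" using \<kappa>[OF zero_B] by simp
  show ?thesis unfolding form_15_def
    by (rule exI[of _ \<alpha>], rule exI[of _ \<kappa>]) (intro conjI A_eq B_eq alpha_0 kappa_0)
qed

lemma form_17I:
  assumes card_A: "card A = p * q\<^sup>2" and card_B: "card B = p"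
    and A: "\<And>a a'. a \<in> A \<Longrightarrow> a' \<in> A \<Longrightarrow> x0 a = x0 a' \<Longrightarrow> fst a = fst a'"
    and B: "\<And>b. b \<in> B \<Longrightarrow> x0 b = 0"
      "\<And>b b'. b \<in> B \<Longrightarrow> b' \<in> B \<Longrightarrow> fst b = fst b' \<Longrightarrow> snd b = snd b'"
  shows "form_17 p q A B"
proof -
  have "\<exists>\<alpha>. \<forall>a\<in>A. \<alpha> (x0 a) = int (x1 a)"
    by (rule function_of) (metis A)
  then obtain \<alpha> where \<alpha>: "\<And>a. a \<in> A \<Longrightarrow> \<alpha> (x0 a) = int (x1 a)" by blast
  have "\<exists>\<kappa>. \<forall>b\<in>B. \<kappa> (x1 b) = snd b"
    by (rule function_of) (metis B digits UnI1 UnI2)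
  then obtain \<kappa> where \<kappa>: "\<And>b. b \<in> B \<Longrightarrow> \<kappa> (x1 b) = snd b" by blast
  let ?A = "{elt p q (i + \<alpha> i * int p) j |(i::nat) (j::nat). i \<in> {..<p} \<and> j \<in> {..<q\<^sup>2}}"
  have A_eq: "A = ?A"
  proof (rule eq_grid2)
    show "A \<subseteq> ?A"
    proof
      fix a assume a: "a \<in> A"
      let ?u = "elt p q (x0 a + \<alpha> (x0 a) * int p) (nat (snd a))"
      have "?u = a"
        by (rule elt_eqI_fst_digits) (use a digit_bounds(7,8)[of a] \<alpha>[OF a] in \<open>auto simp: crt_congs algebra_simps\<close>)
      moreover have "?u \<in> ?A"
        by (intro CollectI exI conjI, rule refl) (use digit_bounds[of a] a in auto)
      ultimately show "a \<in> ?A" by (simp only:)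
    qed
  qed (simp add: card_A mult.assoc power2_eq_square)
  let ?B = "{elt p q (i * int p) (\<kappa> i) |(i::nat). i \<in> {..<p}}"
  have B_eq: "B = ?B"
  proof (rule eq_grid1)
    show "B \<subseteq> ?B"
    proof
      fix b assume b: "b \<in> B"
      let ?u = "elt p q (x1 b * int p) (\<kappa> (x1 b))"
      have "?u = b"
        by (rule elt_eqI_fst_digits) (use b digit_bounds(7,8)[of b] \<kappa>[OF b] B(1)[OF b] in \<open>auto simp: crt_congs algebra_simps\<close>)
      moreover have "?u \<in> ?B"
        by (intro CollectI exI conjI, rule refl) (use digit_bounds[of b] b in auto)
      ultimately show "b \<in> ?B" by (simp only:)
    qed
  qed (simp add: card_B mult.assoc power2_eq_square)
  have alpha_0: "\<alpha> 0 = 0" using \<alpha>[OF zero_A] by simp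
  have kappa_0: "\<kappa> 0 = 0" using \<kappa>[OF zero_B] by simp
  show ?thesis unfolding form_17_def
    by (rule exI[of _ \<alpha>], rule exI[of _ \<kappa>]) (intro conjI A_eq B_eq alpha_0 kappa_0)
qed

lemma form_19I:
  assumes card_A: "card A = p * q\<^sup>2" and card_B: "card B = p"
    and A: "\<And>a a'. a \<in> A \<Longrightarrow> a' \<in> A \<Longrightarrow> x0 a = x0 a' \<Longrightarrow> snd a = snd a' \<Longrightarrow> fst a = fst a'"
    and B: "\<And>b. b \<in> B \<Longrightarrow> x0 b = 0"
      "\<And>b. b \<in> B \<Longrightarrow> snd b = 0"
  shows "form_19 p q A B"
proof -
  have "\<exists>\<alpha>. \<forall>a\<in>A. \<alpha> (x0 a) (nat (snd a)) = int (x1 a)"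
    by (rule function_of2) (metis A digit_bounds(7,8) UnI1 UnI2)
  then obtain \<alpha> where \<alpha>: "\<And>a. a \<in> A \<Longrightarrow> \<alpha> (x0 a) (nat (snd a)) = int (x1 a)" by blast
  let ?A = "{elt p q (i + \<alpha> i j * int p) j |(i::nat) (j::nat). i \<in> {..<p} \<and> j \<in> {..<q\<^sup>2}}"
  have A_eq: "A = ?A"
  proof (rule eq_grid2)
    show "A \<subseteq> ?A"
    proof
      fix a assume a: "a \<in> A"
      let ?u = "elt p q (x0 a + \<alpha> (x0 a) (nat (snd a)) * int p) (nat (snd a))"
      have "?u = a"
        by (rule elt_eqI_fst_digits) (use a digit_bounds(7,8)[of a] \<alpha>[OF a] in \<open>auto simp: crt_congs algebra_simps\<close>)
      moreover have "?u \<in> ?A"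
        by (intro CollectI exI conjI, rule refl) (use digit_bounds[of a] a in auto)
      ultimately show "a \<in> ?A" by (simp only:)
    qed
  qed (simp add: card_A mult.assoc power2_eq_square)
  let ?B = "{elt p q (i * int p) 0 |(i::nat). i \<in> {..<p}}"
  have B_eq: "B = ?B"
  proof (rule eq_grid1)
    show "B \<subseteq> ?B"
    proof
      fix b assume b: "b \<in> B"
      let ?u = "elt p q (x1 b * int p) 0"
      have "?u = b"
        by (rule elt_eqI_fst_digits) (use b digit_bounds(7,8)[of b] B(1)[OF b] B(2)[OF b] in \<open>auto simp: crt_congs algebra_simps\<close>)
      moreover have "?u \<in> ?B"
        by (intro CollectI exI conjI, rule refl) (use digit_bounds[of b] b in auto)
      ultimately show "b \<in> ?B" by (simp only:)
    qed
  qed (simp add: card_B mult.assoc power2_eq_square)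
  have alpha_0: "\<alpha> 0 0 = 0" using \<alpha>[OF zero_A] by simp
  show ?thesis unfolding form_19_def
    by (rule exI[of _ \<alpha>]) (intro conjI A_eq B_eq alpha_0)
qed
end

section \<open>Types of differences in a factorization\<close>

text \<open>
  The replacement principle with a multiplier that vanishes modulo \<open>m\<close>, which is allowed since \<open>m\<close> is
  coprime to \<open>|B| = r\<close>. It wipes out the first coordinates of \<open>B\<close>: two points of \<open>A\<close> with the same first
  coordinate cannot differ by the same valuation as any two points of \<open>B\<close>, whatever the first
  coordinates of the latter are.
\<close>
lemma tiling_no_common_val_snd:
  fixes r :: nat
  assumes "tiling m ((int r)\<^sup>2) A B" and "m > 0" and "prime r" and "coprime m (int r)" and "card B = r"
    and "a \<in> A" "a' \<in> A" "b \<in> B" "b' \<in> B"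
    and "m dvd fst a - fst a'" and "same_val (int r) (snd a - snd a') (snd b - snd b')"
  shows "a = a' \<and> b = b'"
proof -
  obtain k0 where k0: "coprime k0 r" "[snd a - snd a' = int k0 * (snd b - snd b')] (mod (int r)\<^sup>2)"
    using same_val_imp_cong_multiple[OF assms(3,11)] by blast
  have "coprime (nat m) (r\<^sup>2)"
    using assms(2,4) by (simp flip: coprime_int_iff)
  then obtain k where k: "[k = 0] (mod nat m)" "[k = k0] (mod r\<^sup>2)"
    using binary_chinese_remainder_nat by blast
  have "[k = k0] (mod r)" using k(2) by (rule cong_dvd_modulus_nat) simp
  then have "coprime k r" using k0(1) by (metis cong_imp_coprime cong_sym)
  then have "coprime k (card B)" "k > 0"
    using assms(3,5) by (auto intro: ccontr simp: not_prime_1)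
  moreover have "m dvd int k"
    using k(1) assms(2) by (simp add: cong_0_iff flip: int_dvd_int_iff)
  then have "[fst a - fst a' = int k * (fst b - fst b')] (mod m)"
    using assms(10) by (auto simp: cong_iff_dvd_diff intro: dvd_diff)
  moreover have "[int k = int k0] (mod (int r)\<^sup>2)" using k(2) by (simp flip: cong_int_iff)
  then have "[snd a - snd a' = int k * (snd b - snd b')] (mod (int r)\<^sup>2)"
    using k0(2) by (meson cong_scalar_right cong_sym cong_trans)
  ultimately show ?thesis
    using tiling_no_common_difference[OF assms(1,2)] assms(3,6-9) prime_gt_0_nat by simp
qed

text \<open>
  If \<open>B\<close> lies in the subgroup of index \<open>p\<close>, then the part of \<open>A\<close> in each coset of this subgroup is a
  complement of \<open>B\<close> in it. Dividing the first coordinate by \<open>p\<close> identifies the subgroup with a product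
  of two cyclic groups again.
\<close>
lemma tiling_fibre:
  fixes p :: nat
  assumes "tiling (int p * m) n A B" and "p > 0" and "m > 0" and "n > 0"
    and B: "\<And>b. b \<in> B \<Longrightarrow> int p dvd fst b"
  shows "tiling m n {(t, y). (i + int p * t, y) \<in> A} {(t, y). (int p * t, y) \<in> B}"
    (is "tiling m n ?A ?B")
proof (rule tilingI)
  have pm: "int p * m > 0" using assms by simp
  show "\<exists>a\<in>?A. \<exists>b\<in>?B. [fst a + fst b = x] (mod m) \<and> [snd a + snd b = y] (mod n)" for x y
  proof -
    obtain a b where ab: "a \<in> A" "b \<in> B" "[fst a + fst b = i + int p * x] (mod (int p * m))"
      "[snd a + snd b = y] (mod n)"
      using tiling_cover[OF assms(1) pm assms(4)] by blast
    obtain s where s: "fst b = int p * s" using B[OF ab(2)] by (auto elim: dvdE)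
    have "int p dvd fst a + fst b - (i + int p * x)"
      using ab(3) by (auto simp: cong_iff_dvd_diff dest: dvd_mult_left)
    moreover have "int p dvd int p * s - int p * x" by simp
    ultimately have "int p dvd fst a + fst b - (i + int p * x) - (int p * s - int p * x)"
      by (rule dvd_diff)
    then have "int p dvd fst a - i" by (simp add: s)
    then obtain t where "fst a - i = int p * t" by (rule dvdE)
    then have t: "fst a = i + int p * t" by simp
    have "[int p * (t + s) = int p * x] (mod (int p * m))"
      using ab(3) by (simp add: s t cong_iff_dvd_diff algebra_simps)
    then have "[t + s = x] (mod m)"
      using assms(2) by (simp add: cong_iff_dvd_diff flip: right_diff_distrib)
    moreover have "(t, snd a) \<in> ?A" "(s, snd b) \<in> ?B"
      using ab(1,2) by (simp_all flip: s t)
    ultimately show ?thesis using ab(4) by force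
  qed
  show "a = a' \<and> b = b'"
    if ab: "a \<in> ?A" "a' \<in> ?A" "b \<in> ?B" "b' \<in> ?B"
      "[fst a + fst b = fst a' + fst b'] (mod m)" "[snd a + snd b = snd a' + snd b'] (mod n)" for a a' b b'
  proof -
    let ?f = "\<lambda>u. (i + int p * fst u, snd u)" and ?g = "\<lambda>u. (int p * fst u, snd u)"
    have "?f a = ?f a' \<and> ?g b = ?g b'"
    proof (rule tiling_unique[OF assms(1)])
      show "?f a \<in> A" "?f a' \<in> A" "?g b \<in> B" "?g b' \<in> B" using ab(1-4) by auto
      have "int p * m dvd int p * (fst a + fst b - (fst a' + fst b'))"
        using ab(5) assms(2) by (simp add: cong_iff_dvd_diff)
      then show "[fst (?f a) + fst (?g b) = fst (?f a') + fst (?g b')] (mod (int p * m))"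
        by (simp add: cong_iff_dvd_diff algebra_simps)
      show "[snd (?f a) + snd (?g b) = snd (?f a') + snd (?g b')] (mod n)" using ab(6) by simp
    qed
    then show ?thesis using assms(2) by (auto simp: prod_eq_iff)
  qed
qed (use assms in auto)

lemma same_valI:
  assumes "r dvd u \<longleftrightarrow> r dvd v" and "r\<^sup>2 dvd u \<longleftrightarrow> r\<^sup>2 dvd v"
  shows "same_val r u v"
  using assms by (simp add: same_val_def)

context factor_pair
begin

lemma fst_eq_iff: "u \<in> A \<union> B \<Longrightarrow> v \<in> A \<union> B \<Longrightarrow> fst u = fst v \<longleftrightarrow> (int p)\<^sup>2 dvd fst u - fst v"
  and snd_eq_iff: "u \<in> A \<union> B \<Longrightarrow> v \<in> A \<union> B \<Longrightarrow> snd u = snd v \<longleftrightarrow> (int q)\<^sup>2 dvd snd u - snd v"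
proof -
  assume "u \<in> A \<union> B" "v \<in> A \<union> B"
  then have "u \<in> {0..<(int p)\<^sup>2} \<times> {0..<(int q)\<^sup>2}" "v \<in> {0..<(int p)\<^sup>2} \<times> {0..<(int q)\<^sup>2}"
    using A_sub B_sub by auto
  then show "fst u = fst v \<longleftrightarrow> (int p)\<^sup>2 dvd fst u - fst v" "snd u = snd v \<longleftrightarrow> (int q)\<^sup>2 dvd snd u - snd v"
    by (auto simp: mem_Times_iff simp flip: mod_eq_dvd_iff)
qed

lemma same_val_fst:
  assumes "u \<in> A \<union> B" "v \<in> A \<union> B" "u' \<in> A \<union> B" "v' \<in> A \<union> B"
    and "x0 u = x0 v \<longleftrightarrow> x0 u' = x0 v'" and "fst u = fst v \<longleftrightarrow> fst u' = fst v'"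
  shows "same_val (int p) (fst u - fst v) (fst u' - fst v')"
  using assms by (intro same_valI) (simp_all add: lo_eq_iff_dvd fst_eq_iff)

lemma same_val_snd:
  assumes "u \<in> A \<union> B" "v \<in> A \<union> B" "u' \<in> A \<union> B" "v' \<in> A \<union> B"
    and "y0 u = y0 v \<longleftrightarrow> y0 u' = y0 v'" and "snd u = snd v \<longleftrightarrow> snd u' = snd v'"
  shows "same_val (int q) (snd u - snd v) (snd u' - snd v')"
  using assms by (intro same_valI) (simp_all add: lo_eq_iff_dvd snd_eq_iff)

lemma card_mult: "card A * card B = p\<^sup>2 * q\<^sup>2"
  using tiling_card[OF tiling] by (simp add: nat_power_eq)

text \<open>
  The type of a difference is described by four comparisons: whether the low digits agree and whether the
  entire coordinates agree, for each coordinate. For equal types there are suitable multipliers modulo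
  \<open>p\<^sup>2\<close> and modulo \<open>q\<^sup>2\<close>, and the Chinese remainder theorem combines them to one that is coprime to
  \<open>|G|\<close>.
\<close>
lemma no_common_type:
  assumes "a \<in> A" "a' \<in> A" "b \<in> B" "b' \<in> B"
    and "x0 a = x0 a' \<longleftrightarrow> x0 b = x0 b'" and "fst a = fst a' \<longleftrightarrow> fst b = fst b'"
    and "y0 a = y0 a' \<longleftrightarrow> y0 b = y0 b'" and "snd a = snd a' \<longleftrightarrow> snd b = snd b'"
  shows "a = a' \<and> b = b'"
proof -
  have "same_val (int p) (fst a - fst a') (fst b - fst b')" "same_val (int q) (snd a - snd a') (snd b - snd b')"
    using assms by (intro same_val_fst same_val_snd; simp)+
  then obtain k l where kl: "coprime k p" "[fst a - fst a' = int k * (fst b - fst b')] (mod (int p)\<^sup>2)"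
    "coprime l q" "[snd a - snd a' = int l * (snd b - snd b')] (mod (int q)\<^sup>2)"
    using same_val_imp_cong_multiple prime_p prime_q by blast
  have "coprime (p\<^sup>2) (q\<^sup>2)" using coprime_pq by simp
  then obtain j where j: "[j = k] (mod p\<^sup>2)" "[j = l] (mod q\<^sup>2)"
    using binary_chinese_remainder_nat by blast
  have "[j = k] (mod p)" "[j = l] (mod q)"
    using cong_dvd_modulus_nat[OF j(1), of p] cong_dvd_modulus_nat[OF j(2), of q] by simp_all
  then have co: "coprime j p" "coprime j q" using kl by (metis cong_imp_coprime cong_sym)+
  have "coprime j (card A * card B)" unfolding card_mult using co by simp
  then have "coprime j (card B)" by simp
  moreover have "j > 0" using co(1) prime_p by (auto intro: ccontr simp: not_prime_1)
  moreover have "[int j = int k] (mod (int p)\<^sup>2)" "[int j = int l] (mod (int q)\<^sup>2)"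
    using j by (simp_all flip: cong_int_iff)
  then have "[fst a - fst a' = int j * (fst b - fst b')] (mod (int p)\<^sup>2)"
    "[snd a - snd a' = int j * (snd b - snd b')] (mod (int q)\<^sup>2)"
    using kl by (meson cong_scalar_right cong_sym cong_trans)+
  ultimately show ?thesis using tiling_no_common_difference[OF tiling] assms by simp
qed

lemma no_common_snd_type:
  assumes "card B = q" and "a \<in> A" "a' \<in> A" "b \<in> B" "b' \<in> B" and "fst a = fst a'"
    and "y0 a = y0 a' \<longleftrightarrow> y0 b = y0 b'" and "snd a = snd a' \<longleftrightarrow> snd b = snd b'"
  shows "a = a' \<and> b = b'"
  using assms coprime_pq same_val_snd[of a a' b b']
  by (intro tiling_no_common_val_snd[OF tiling _ prime_q]) simp_all

lemma no_common_fst_type: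
  assumes "card B = p" and "a \<in> A" "a' \<in> A" "b \<in> B" "b' \<in> B" and "snd a = snd a'"
    and "x0 a = x0 a' \<longleftrightarrow> x0 b = x0 b'" and "fst a = fst a' \<longleftrightarrow> fst b = fst b'"
  shows "a = a' \<and> b = b'"
proof -
  have "prod.swap a = prod.swap a' \<and> prod.swap b = prod.swap b'"
    using assms coprime_pq same_val_fst[of a a' b b']
    by (intro tiling_no_common_val_snd[OF tiling_swap[OF tiling] _ prime_p])
      (simp_all add: card_image coprime_commute)
  then show ?thesis by (auto simp: prod.swap_def prod_eq_iff)
qed

end

locale factor_pair_p = factor_pair +
  assumes p_dvd_B: "b \<in> B \<Longrightarrow> int p dvd fst b"
begin

lemma x0_B: "b \<in> B \<Longrightarrow> x0 b = 0"
  using p_dvd_B[of b] lo_eq_iff_dvd[of p "fst b" 0] by simp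

text \<open>
  The complement \<open>F\<close> of \<open>B\<close> cut out of \<open>A\<close> by the coset of \<open>a\<close>, translated by the first coordinate of
  \<open>a\<close> and divided by \<open>p\<close>.
\<close>
lemma fibre:
  obtains F B' where "tiling (int p) ((int q)\<^sup>2) F B'" and "card F * card B = p * q\<^sup>2"
    and "\<And>a'. a' \<in> A \<Longrightarrow> x0 a' = x0 a \<Longrightarrow> ((fst a' - fst a) div int p, snd a') \<in> F"
    and "\<And>b. b \<in> B \<Longrightarrow> (fst b div int p, snd b) \<in> B'"
proof
  let ?F = "{(t, y). (fst a + int p * t, y) \<in> A}" and ?B = "{(t, y). (int p * t, y) \<in> B}"
  show til: "tiling (int p) ((int q)\<^sup>2) ?F ?B"
    using tiling p_dvd_B by (intro tiling_fibre) (simp_all add: power2_eq_square)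
  show mem: "(fst b div int p, snd b) \<in> ?B" if "b \<in> B" for b
    using p_dvd_B[OF that] that by simp
  show "((fst a' - fst a) div int p, snd a') \<in> ?F" if "a' \<in> A" "x0 a' = x0 a" for a'
    using that by (simp add: lo_eq_iff_dvd)
  have img: "(\<lambda>u. (int p * fst u, snd u)) ` ?B = B"
  proof
    show "B \<subseteq> (\<lambda>u. (int p * fst u, snd u)) ` ?B"
    proof
      fix b assume b: "b \<in> B"
      show "b \<in> (\<lambda>u. (int p * fst u, snd u)) ` ?B"
        using p_dvd_B[OF b] by (intro image_eqI[OF _ mem[OF b]]) simp
    qed
  qed auto
  have inj: "inj_on (\<lambda>u. (int p * fst u, snd u)) ?B"
    by (auto simp: inj_on_def)
  have card: "card ?B = card B" using card_image[OF inj] unfolding img by simp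
  show "card ?F * card B = p * q\<^sup>2" using tiling_card[OF til] card by (simp add: nat_power_eq)
qed

lemma card_B_dvd: "card B dvd p * q\<^sup>2"
proof (rule fibre[of "(0, 0)"])
  fix F :: "(int \<times> int) set" assume "card F * card B = p * q\<^sup>2"
  then show ?thesis by (metis dvd_triv_right)
qed

text \<open>
  \<open>|B|\<close> divides the order \<open>pq\<^sup>2\<close> of \<open>pG\<close>; of the six divisors, 1 and \<open>q\<^sup>2\<close> make the cardinalities
  coprime.
\<close>
lemma card_cases:
  assumes "\<not> coprime (card A) (card B)"
  shows "card A = p \<and> card B = p * q\<^sup>2 \<or> card A = p * q \<and> card B = p * q \<or>
    card A = p\<^sup>2 * q \<and> card B = q \<or> card A = p * q\<^sup>2 \<and> card B = p"
proof -
  obtain d e where de: "card B = d * e" "d dvd p" "e dvd q\<^sup>2"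
    using division_decomp[OF card_B_dvd] by blast
  have "d = 1 \<or> d = p" using de(2) prime_p by (auto simp: prime_nat_iff)
  moreover obtain j where "j \<le> 2" "e = q ^ j" using de(3) prime_q divides_primepow_nat by blast
  then have "e = 1 \<or> e = q \<or> e = q\<^sup>2" by (auto simp: le_Suc_eq numeral_2_eq_2)
  ultimately consider "card B = 1" | "card B = q" | "card B = q\<^sup>2" | "card B = p" | "card B = p * q" | "card B = p * q\<^sup>2"
    unfolding de(1) by (elim disjE) simp_all
  then show ?thesis
  proof cases
    case 3
    then have "card A = p\<^sup>2" using card_mult by simp
    then show ?thesis using 3 assms coprime_pq by simp
  qed (use card_mult assms in \<open>auto simp: power2_eq_square\<close>)
qed

text \<open>
  Within a coset \<open>A\<close> has \<open>q\<close> elements, so there it is \<open>A\<close> whose elements may be multiplied by multiples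
  of \<open>p\<close>. This removes their high digits at \<open>p\<close> and leaves only the types at \<open>q\<close> to compare.
\<close>
lemma no_common_fibre_type:
  assumes "card A = p * q" and "a \<in> A" "a' \<in> A" "b \<in> B" "b' \<in> B" and "x0 a = x0 a'" and "fst b = fst b'"
    and "y0 a = y0 a' \<longleftrightarrow> y0 b = y0 b'" and "snd a = snd a' \<longleftrightarrow> snd b = snd b'"
  shows "a = a' \<and> b = b'"
proof -
  obtain F B' where FB: "tiling (int p) ((int q)\<^sup>2) F B'" "card F * card B = p * q\<^sup>2"
    and F: "\<And>a'. a' \<in> A \<Longrightarrow> x0 a' = x0 a \<Longrightarrow> ((fst a' - fst a) div int p, snd a') \<in> F"
    and B': "\<And>b. b \<in> B \<Longrightarrow> (fst b div int p, snd b) \<in> B'"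
    by (rule fibre[of a], rule that)
  have "card B = p * q" using card_mult assms(1) by (simp add: power2_eq_square)
  then have "card F = q" using FB(2) by (simp add: power2_eq_square)
  then have "(fst b div int p, snd b) = (fst b' div int p, snd b') \<and>
      ((fst a - fst a) div int p, snd a) = ((fst a' - fst a) div int p, snd a')"
    using F[of a] F[of a'] B'[of b] B'[of b'] assms(2-9) coprime_pq same_val_snd[of b b' a a']
    by (intro tiling_no_common_val_snd[OF tiling_commute[OF FB(1)] _ prime_q]) simp_all
  moreover have "int p dvd fst a' - fst a" using assms(6) by (metis lo_eq_iff_dvd p_pos)
  ultimately show ?thesis using assms(7) by (auto simp: prod_eq_iff dvd_div_eq_0_iff)
qed

end

section \<open>Classification of the factorizations with second factor in pG\<close>

context factor_pair_p
begin

abbreviation origin :: "int \<times> int" where "origin \<equiv> (0, 0)"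

lemma x1_B: "b \<in> B \<Longrightarrow> fst b = int (x1 b) * int p"
  using digits(1)[of b] x0_B[of b] by simp

text \<open>
  Every coset of \<open>pG\<close> contains just one element of \<open>A\<close>.
\<close>
lemma form_if_card_p:
  assumes card: "card A = p" "card B = p * q\<^sup>2"
  shows "form_1 p q A B"
proof (rule form_1I)
  fix a a' assume a: "a \<in> A" "a' \<in> A" "x0 a = x0 a'"
  obtain F B' where FB: "card F * card B = p * q\<^sup>2"
    "\<And>a'. a' \<in> A \<Longrightarrow> x0 a' = x0 a \<Longrightarrow> ((fst a' - fst a) div int p, snd a') \<in> F"
    by (rule fibre[of a], rule that)
  have "card F = 1" using FB(1) card by simp
  then have "((fst a - fst a) div int p, snd a) = ((fst a' - fst a) div int p, snd a')"
    using FB(2)[of a] FB(2)[of a'] a by (metis card_1_singletonE singletonD)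
  moreover have "int p dvd fst a' - fst a" using a(3) by (metis lo_eq_iff_dvd p_pos)
  ultimately show "a = a'" by (auto simp: prod_eq_iff dvd_div_eq_0_iff)
qed (use card x0_B in auto)

text \<open>
  In each coset of \<open>pG\<close> the second coordinates of \<open>A\<close>, and over each first coordinate those of \<open>B\<close>, form
  \<open>q\<close>-element sets. On one side their low digits at \<open>q\<close> coincide, on the other side these are distinct; the
  first case distinction decides which. The second one asks whether a further type occurs in one factor,
  which excludes it from the other.
\<close>
lemma forms_if_card_pq:
  assumes card: "card A = p * q" "card B = p * q"
  shows "form_3 p q A B \<or> form_6 p q A B \<or> form_7 p q A B \<or> form_9 p q A B"
proof -
  have q1: "p < p * q" using prime_gt_1_nat[OF prime_q] by simp
  have A_inj: "a = a'" if "a \<in> A" "a' \<in> A" "x0 a = x0 a'" "snd a = snd a'" for a a'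
    using no_common_fibre_type[OF card(1) that(1,2) zero_B zero_B] that by simp
  show ?thesis
  proof (cases "\<exists>a\<in>A. \<exists>a'\<in>A. x0 a = x0 a' \<and> y0 a = y0 a' \<and> snd a \<noteq> snd a'")
    case True
    then obtain c c' where c: "c \<in> A" "c' \<in> A" "x0 c = x0 c'" "y0 c = y0 c'" "snd c \<noteq> snd c'" by blast
    \<comment> \<open>valuation 1 at \<open>q\<close> occurs in a coset part of \<open>A\<close>, hence over no first coordinate in \<open>B\<close>\<close>
    have B_inj: "b = b'" if "b \<in> B" "b' \<in> B" "fst b = fst b'" "y0 b = y0 b'" for b b'
      using no_common_fibre_type[OF card(1) c(1,2) that(1,2)] that c by (cases "snd b = snd b'") (auto simp: prod_eq_iff)
    \<comment> \<open>\<open>B\<close> has more elements than first coordinates, so it must have valuation 0 instead\<close>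
    have "\<exists>b\<in>B. \<exists>b'\<in>B. fst b = fst b' \<and> y0 b \<noteq> y0 b'"
    proof (rule ccontr)
      assume *: "\<not> ?thesis"
      have "inj_on x1 B"
        using B_inj * by (intro inj_onI) (metis x1_B)
      moreover have "x1 ` B \<subseteq> {..<p}" using digit_bounds(1) by auto
      ultimately have "card B \<le> p" using card_inj_on_le[of _ B "{..<p}"] by simp
      then show False using card q1 by simp
    qed
    then obtain d d' where d: "d \<in> B" "d' \<in> B" "fst d = fst d'" "y0 d \<noteq> y0 d'" by blast
    have A0: "y0 a = y0 a'" if "a \<in> A" "a' \<in> A" "x0 a = x0 a'" for a a'
      using no_common_fibre_type[OF card(1) that(1,2) d(1,2)] that d by metis
    show ?thesis
    proof (cases "\<forall>a\<in>A. \<forall>a'\<in>A. x0 a = x0 a' \<longrightarrow> fst a = fst a'")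
      case True
      have "form_3 p q A B" using True A0 B_inj x0_B by (intro form_3I card) blast+
      then show ?thesis by simp
    next
      case False
      then obtain e e' where e: "e \<in> A" "e' \<in> A" "x0 e = x0 e'" "fst e \<noteq> fst e'" by blast
      \<comment> \<open>a difference of type (1, 1) in \<open>A\<close>, so \<open>B\<close> has none\<close>
      have e2: "y0 e = y0 e'" "snd e \<noteq> snd e'" using e A0 A_inj by blast+
      have "snd b = snd b'" if "b \<in> B" "b' \<in> B" "y0 b = y0 b'" for b b'
        using no_common_type[OF e(1,2) that(1,2)] e e2 that B_inj[OF that(1,2)] x0_B by metis
      then have "form_6 p q A B" using A0 A_inj x0_B by (intro form_6I card) blast+
      then show ?thesis by simp
    qed
  next
    case False
    then have A0: "a = a'" if "a \<in> A" "a' \<in> A" "x0 a = x0 a'" "y0 a = y0 a'" for a a'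
      using A_inj that by blast
    \<comment> \<open>\<open>A\<close> has more elements than low digits at \<open>p\<close>, so valuation 0 at \<open>q\<close> occurs in a coset part\<close>
    have "\<exists>a\<in>A. \<exists>a'\<in>A. x0 a = x0 a' \<and> y0 a \<noteq> y0 a'"
    proof (rule ccontr)
      assume *: "\<not> ?thesis"
      have "inj_on x0 A" using A0 * by (intro inj_onI) blast
      moreover have "x0 ` A \<subseteq> {..<p}" using lo_less by auto
      ultimately have "card A \<le> p" using card_inj_on_le[of _ A "{..<p}"] by simp
      then show False using card q1 by simp
    qed
    then obtain c c' where c: "c \<in> A" "c' \<in> A" "x0 c = x0 c'" "y0 c \<noteq> y0 c'" by blast
    have B0: "y0 b = y0 b'" if "b \<in> B" "b' \<in> B" "fst b = fst b'" for b b'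
      using no_common_fibre_type[OF card(1) c(1,2) that(1,2)] that c by metis
    show ?thesis
    proof (cases "\<forall>b\<in>B. y0 b = 0")
      case True
      then have "form_9 p q A B" using A0 x0_B by (intro form_9I card) blast+
      then show ?thesis by simp
    next
      case False
      then obtain b where b: "b \<in> B" "y0 b \<noteq> y0 origin" by auto
      \<comment> \<open>a difference of type (1, 0) in \<open>B\<close>, so \<open>A\<close> has none\<close>
      have b2: "fst b \<noteq> fst origin" "snd b \<noteq> snd origin" using b B0[OF b(1) zero_B] by auto
      have "fst a = fst a'" if "a \<in> A" "a' \<in> A" "x0 a = x0 a'" for a a'
        using no_common_type[OF that(1,2) b(1) zero_B] that b b2 A0[OF that] x0_B[OF b(1)] x0_B[OF zero_B] by metis
      then have "form_7 p q A B" using A0 B0 x0_B by (intro form_7I card) blast+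
      then show ?thesis by simp
    qed
  qed
qed

text \<open>
  \<open>B\<close> has pairwise distinct second coordinates, and either all of their differences have valuation 1
  or none has. Over each first coordinate, the differences in \<open>A\<close> have the complementary valuation. The
  second case distinction is whether \<open>B\<close> has two different first coordinates.
\<close>
lemma forms_if_card_p2q:
  assumes card: "card A = p\<^sup>2 * q" "card B = q"
  shows "form_10 p q A B \<or> form_11 p q A B \<or> form_13 p q A B \<or> form_14 p q A B"
proof -
  have q1: "q > 1" using prime_gt_1_nat[OF prime_q] .
  have B_inj: "b = b'" if "b \<in> B" "b' \<in> B" "snd b = snd b'" for b b'
    using no_common_snd_type[OF card(2) zero_A zero_A that(1,2)] that by simp
  show ?thesis
  proof (cases "\<exists>b\<in>B. \<exists>b'\<in>B. y0 b = y0 b' \<and> snd b \<noteq> snd b'")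
    case True
    then obtain c c' where c: "c \<in> B" "c' \<in> B" "y0 c = y0 c'" "snd c \<noteq> snd c'" by blast
    \<comment> \<open>valuation 1 occurs in \<open>B\<close>, hence in \<open>A\<close> over no first coordinate\<close>
    have A1: "snd a = snd a'" if "a \<in> A" "a' \<in> A" "fst a = fst a'" "y0 a = y0 a'" for a a'
      using no_common_snd_type[OF card(2) that(1,2) c(1,2)] that c by metis
    \<comment> \<open>\<open>A\<close> has more elements than first coordinates, so valuation 0 occurs in \<open>A\<close>, hence not in \<open>B\<close>\<close>
    have "\<exists>a\<in>A. \<exists>a'\<in>A. fst a = fst a' \<and> y0 a \<noteq> y0 a'"
    proof (rule ccontr)
      assume *: "\<not> ?thesis"
      have "inj_on fst A" using A1 * by (intro inj_onI) (metis prod_eq_iff)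
      moreover have "fst ` A \<subseteq> {0..<(int p)\<^sup>2}" using A_sub by auto
      ultimately have "card A \<le> p\<^sup>2" using card_inj_on_le[of fst A "{0..<(int p)\<^sup>2}"] by (simp add: nat_power_eq)
      then show False using card q1 by simp
    qed
    then obtain d d' where d: "d \<in> A" "d' \<in> A" "fst d = fst d'" "y0 d \<noteq> y0 d'" by blast
    have B0: "y0 b = 0" if b: "b \<in> B" for b
    proof (rule ccontr)
      assume "y0 b \<noteq> 0"
      then have "y0 b \<noteq> y0 origin" by simp
      then show False using no_common_snd_type[OF card(2) d(1,2) b zero_B] d by metis
    qed
    show ?thesis
    proof (cases "\<forall>b\<in>B. fst b = 0")
      case True
      then have "form_14 p q A B" using A1 B0 by (intro form_14I card) blast+
      then show ?thesis by simp
    next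
      case False
      then obtain b where b: "b \<in> B" "fst b \<noteq> fst origin" by auto
      \<comment> \<open>a difference of type (1, 1) in \<open>B\<close>, so \<open>A\<close> has none\<close>
      have b2: "snd b \<noteq> snd origin" "y0 b = y0 origin" "x0 b = x0 origin"
        using b B_inj[OF b(1) zero_B] B0 x0_B by auto
      have "snd a = snd a'" if "a \<in> A" "a' \<in> A" "x0 a = x0 a'" "y0 a = y0 a'" for a a'
        using no_common_type[OF that(1,2) b(1) zero_B] that b b2 A1[OF that(1,2)] by metis
      then have "form_10 p q A B" using B_inj B0 x0_B by (intro form_10I card) blast+
      then show ?thesis by simp
    qed
  next
    case False
    then have B1: "b = b'" if "b \<in> B" "b' \<in> B" "y0 b = y0 b'" for b b'
      using B_inj that by blast
    have "\<exists>b\<in>B. b \<noteq> origin"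
    proof (rule ccontr)
      assume "\<not> ?thesis"
      then have "card B \<le> card {origin}" by (intro card_mono) auto
      then show False using card q1 by simp
    qed
    then obtain d where d: "d \<in> B" "y0 d \<noteq> y0 origin" using B1 zero_B by blast
    have A0: "y0 a = y0 a'" if "a \<in> A" "a' \<in> A" "fst a = fst a'" for a a'
      using no_common_snd_type[OF card(2) that(1,2) d(1) zero_B] that d by metis
    show ?thesis
    proof (cases "\<forall>b\<in>B. fst b = 0")
      case True
      then have "form_11 p q A B" using A0 B1 by (intro form_11I card) blast+
      then show ?thesis by simp
    next
      case False
      then obtain b where b: "b \<in> B" "fst b \<noteq> fst origin" by auto
      \<comment> \<open>a difference of type (1, 0) in \<open>B\<close>, so \<open>A\<close> has none\<close>
      have "b \<noteq> origin" using b by auto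
      then have b2: "y0 b \<noteq> y0 origin" "x0 b = x0 origin"
        using B1[OF b(1) zero_B] x0_B[OF b(1)] by auto
      have "y0 a = y0 a'" if "a \<in> A" "a' \<in> A" "x0 a = x0 a'" for a a'
        using no_common_type[OF that(1,2) b(1) zero_B] that b b2 A0[OF that(1,2)] by metis
      then have "form_13 p q A B" using B1 x0_B by (intro form_13I card) blast+
      then show ?thesis by simp
    qed
  qed
qed

text \<open>
  \<open>B\<close> has pairwise distinct first coordinates, and \<open>A\<close> contains exactly one point for every low digit at
  \<open>p\<close> and every second coordinate. How much the high digit at \<open>p\<close> of that point may depend on the second
  coordinate is governed by the smallest valuation at \<open>q\<close> of a difference in \<open>B\<close>.
\<close>
lemma forms_if_card_pq2:
  assumes card: "card A = p * q\<^sup>2" "card B = p"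
  shows "form_15 p q A B \<or> form_17 p q A B \<or> form_19 p q A B"
proof -
  have B_inj: "b = b'" if "b \<in> B" "b' \<in> B" "fst b = fst b'" for b b'
    using no_common_fst_type[OF card(2) zero_A zero_A that(1,2)] that by simp
  have "\<exists>b\<in>B. b \<noteq> origin"
  proof (rule ccontr)
    assume "\<not> ?thesis"
    then have "card B \<le> card {origin}" by (intro card_mono) auto
    then show False using card prime_gt_1_nat[OF prime_p] by simp
  qed
  then obtain d where "d \<in> B" "d \<noteq> origin" by blast
  then have d: "d \<in> B" "fst d \<noteq> fst origin" "x0 d = x0 origin"
    using B_inj[OF \<open>d \<in> B\<close> zero_B] x0_B[OF \<open>d \<in> B\<close>] by (blast, blast, simp)
  have A_inj: "fst a = fst a'" if "a \<in> A" "a' \<in> A" "x0 a = x0 a'" "snd a = snd a'" for a a'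
    using no_common_fst_type[OF card(2) that(1,2) d(1) zero_B] that d by metis
  have inj: "inj_on (\<lambda>a. (x0 a, snd a)) A" using A_inj by (intro inj_onI) (auto simp: prod_eq_iff)
  have surj: "(\<lambda>a. (x0 a, snd a)) ` A = {..<p} \<times> {0..<(int q)\<^sup>2}"
  proof (rule card_seteq)
    show "(\<lambda>a. (x0 a, snd a)) ` A \<subseteq> {..<p} \<times> {0..<(int q)\<^sup>2}"
      using A_sub lo_less by (auto simp: mem_Times_iff)
    show "card ({..<p} \<times> {0..<(int q)\<^sup>2}) \<le> card ((\<lambda>a. (x0 a, snd a)) ` A)"
      using card by (simp add: card_image[OF inj] nat_power_eq)
  qed auto
  show ?thesis
  proof (cases "\<exists>b\<in>B. \<exists>b'\<in>B. y0 b \<noteq> y0 b'")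
    case True
    then obtain c c' where c: "c \<in> B" "c' \<in> B" "y0 c \<noteq> y0 c'" by blast
    \<comment> \<open>a difference of type (1, 0) in \<open>B\<close>, so \<open>A\<close> has none\<close>
    have c2: "fst c \<noteq> fst c'" "x0 c = x0 c'" using c B_inj[OF c(1,2)] x0_B by auto
    have A0: "fst a = fst a'" if "a \<in> A" "a' \<in> A" "x0 a = x0 a'" "y0 a \<noteq> y0 a'" for a a'
      using no_common_type[OF that(1,2) c(1,2)] that c c2 by metis
    have "fst a = fst a'" if a: "a \<in> A" "a' \<in> A" "x0 a = x0 a'" for a a'
    proof (cases "y0 a = y0 a'")
      case True
      have q1: "1 < int q" using prime_gt_1_nat[OF prime_q] by simp
      then have q2: "1 < (int q)\<^sup>2" by (simp add: one_less_power)
      \<comment> \<open>compare both points with a third one whose low digit at \<open>q\<close> is different\<close>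
      define y :: int where "y = (if y0 a = 0 then 1 else 0)"
      have "(x0 a, y) \<in> {..<p} \<times> {0..<(int q)\<^sup>2}" using q2 lo_less by (simp add: y_def)
      then have "(x0 a, y) \<in> (\<lambda>a. (x0 a, snd a)) ` A" unfolding surj .
      then obtain e where e: "e \<in> A" "x0 e = x0 a" "snd e = y" by auto
      have "y0 e \<noteq> y0 a" using q1 by (simp add: e y_def lo_def)
      then show ?thesis using A0[OF a(1) e(1)] A0[OF a(2) e(1)] e a True by metis
    qed (use A0 a in blast)
    then have "form_17 p q A B" using B_inj x0_B by (intro form_17I card) blast+
    then show ?thesis by simp
  next
    case False
    then have "y0 b = y0 origin" if "b \<in> B" for b using that zero_B by blast
    then have B0: "y0 b = 0" if "b \<in> B" for b using that by simp
    show ?thesis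
    proof (cases "\<forall>b\<in>B. snd b = 0")
      case True
      then have "form_19 p q A B" using A_inj x0_B by (intro form_19I card) blast+
      then show ?thesis by simp
    next
      case False
      then obtain c where c: "c \<in> B" "snd c \<noteq> snd origin" by auto
      \<comment> \<open>a difference of type (1, 1) in \<open>B\<close>, so \<open>A\<close> has none\<close>
      have c2: "fst c \<noteq> fst origin" "x0 c = x0 origin" "y0 c = y0 origin"
        using c B_inj[OF c(1) zero_B] x0_B B0 by auto
      have "fst a = fst a'" if "a \<in> A" "a' \<in> A" "x0 a = x0 a'" "y0 a = y0 a'" for a a'
        using no_common_type[OF that(1,2) c(1) zero_B] that c c2 A_inj[OF that(1-3)] by metis
      then have "form_15 p q A B" using B_inj B0 x0_B by (intro form_15I card) blast+
      then show ?thesis by simp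
    qed
  qed
qed

end

section \<open>The families are factorizations\<close>

lemma low_digit:
  assumes "r > 0"
  obtains i where "i \<in> {..<r}" and "[z + int i = x] (mod int r)"
proof
  show "nat ((x - z) mod int r) \<in> {..<r}" using assms by (simp add: nat_less_iff)
  show "[z + int (nat ((x - z) mod int r)) = x] (mod int r)" using assms by (simp add: cong_def mod_add_right_eq)
qed

lemma both_digits:
  assumes "r > 0"
  obtains i where "i \<in> {..<r\<^sup>2}" and "[z + int i = x] (mod (int r)\<^sup>2)"
  using low_digit[of "r\<^sup>2" z x] assms by auto

lemma high_digit:
  assumes "r > 0" and "[z = x] (mod int r)"
  obtains i where "i \<in> {..<r}" and "[z + c * int r + int i * int r = x] (mod (int r)\<^sup>2)"
proof -
  obtain t where t: "x - z = int r * t" using assms(2) by (metis cong_iff_dvd_diff cong_sym dvdE)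
  obtain i where i: "i \<in> {..<r}" "[c + int i = t] (mod int r)" by (rule low_digit[OF assms(1)])
  have "[(c + int i) * int r = t * int r] (mod (int r)\<^sup>2)" using i(2) by (rule cong_mult_square)
  then have "[z + (c + int i) * int r = z + t * int r] (mod (int r)\<^sup>2)" by (simp add: cong_add_lcancel)
  moreover have "z + t * int r = x" using t by (simp add: algebra_simps)
  ultimately show thesis using that i(1) by (simp add: algebra_simps)
qed

lemma elt_cover:
  assumes "elt p q u v \<in> A" and "elt p q u' v' \<in> B"
    and "[u + u' = x] (mod (int p)\<^sup>2)" and "[v + v' = y] (mod (int q)\<^sup>2)"
  shows "\<exists>a\<in>A. \<exists>b\<in>B. [fst a + fst b = x] (mod (int p)\<^sup>2) \<and> [snd a + snd b = y] (mod (int q)\<^sup>2)"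
  using assms by (intro bexI[of _ "elt p q u v"] bexI[of _ "elt p q u' v'"])
    (simp_all add: elt_def cong_def mod_add_eq)

lemma tilingI_grid:
  assumes "p > 0" and "q > 0" and "finite A" and "card A \<le> l" and "finite B" and "card B \<le> m"
    and "l * m = p\<^sup>2 * q\<^sup>2"
    and "\<And>x y. \<exists>a\<in>A. \<exists>b\<in>B. [fst a + fst b = x] (mod (int p)\<^sup>2) \<and> [snd a + snd b = y] (mod (int q)\<^sup>2)"
  shows "tiling ((int p)\<^sup>2) ((int q)\<^sup>2) A B"
proof (rule tilingI_cover)
  show "card A * card B \<le> nat ((int p)\<^sup>2) * nat ((int q)\<^sup>2)"
    using mult_le_mono[OF assms(4,6)] assms(7) by (simp add: nat_power_eq)
qed (use assms in auto)

text \<open>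
  In each of the following lemmas the digits of a given sum \<open>(x, y)\<close> are realised one after another. Each
  step chooses the index that controls one digit, after all indices which influence this digit through
  parameters or carries have been fixed.
\<close>
lemma form_1_tiling:
  assumes "p > 0" and "q > 0" and "form_1 p q A B"
  shows "tiling ((int p)\<^sup>2) ((int q)\<^sup>2) A B"
proof -
  obtain \<alpha> \<beta> where
    A: "A = {elt p q (i + \<alpha> i * int p) (\<beta> i) |(i::nat). i \<in> {..<p}}" and
    B: "B = {elt p q (i * int p) j |(i::nat) (j::nat). i \<in> {..<p} \<and> j \<in> {..<q\<^sup>2}}"
    using assms(3) unfolding form_1_def by (elim exE conjE) (rule that)
  show ?thesis
  proof (rule tilingI_grid[OF assms(1,2)])
    show "finite A" "card A \<le> p" unfolding A by (rule card_grid1)+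
    show "finite B" "card B \<le> p * q\<^sup>2" unfolding B by (rule card_grid2)+
    show "(p) * (p * q\<^sup>2) = p\<^sup>2 * q\<^sup>2" by (simp add: power2_eq_square)
    fix x y :: int
    obtain i where i: "i \<in> {..<p}" "[0 + int i = x] (mod int p)" by (rule low_digit[OF assms(1)])
    have "[int i = x] (mod int p)" using i(2) by simp
    then obtain i' where i': "i' \<in> {..<p}" "[int i + \<alpha> i * int p + int i' * int p = x] (mod (int p)\<^sup>2)"
      by (rule high_digit[OF assms(1)])
    obtain j' where j': "j' \<in> {..<q\<^sup>2}" "[\<beta> i + int j' = y] (mod (int q)\<^sup>2)" by (rule both_digits[OF assms(2)])
    have "elt p q (i + \<alpha> i * int p) (\<beta> i) \<in> A" unfolding A
      by (intro CollectI exI conjI, rule refl) (rule i(1) i'(1) j'(1))+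
    moreover have "elt p q (i' * int p) j' \<in> B" unfolding B
      by (intro CollectI exI conjI, rule refl) (rule i(1) i'(1) j'(1))+
    ultimately show "\<exists>a\<in>A. \<exists>b\<in>B. [fst a + fst b = x] (mod (int p)\<^sup>2) \<and> [snd a + snd b = y] (mod (int q)\<^sup>2)"
      by (rule elt_cover) (use i'(2) j'(2) in \<open>simp_all add: algebra_simps\<close>)
  qed
qed

lemma form_3_tiling:
  assumes "p > 0" and "q > 0" and "form_3 p q A B"
  shows "tiling ((int p)\<^sup>2) ((int q)\<^sup>2) A B"
proof -
  obtain \<alpha> \<kappa> where
    A: "A = {elt p q (i + \<alpha> i * int p) (\<alpha> i + j * int q) |(i::nat) (j::nat). i \<in> {..<p} \<and> j \<in> {..<q}}" and
    B: "B = {elt p q (i * int p) (j + \<kappa> i j * int q) |(i::nat) (j::nat). i \<in> {..<p} \<and> j \<in> {..<q}}"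
    using assms(3) unfolding form_3_def by (elim exE conjE) (rule that)
  show ?thesis
  proof (rule tilingI_grid[OF assms(1,2)])
    show "finite A" "card A \<le> p * q" unfolding A by (rule card_grid2)+
    show "finite B" "card B \<le> p * q" unfolding B by (rule card_grid2)+
    show "(p * q) * (p * q) = p\<^sup>2 * q\<^sup>2" by (simp add: power2_eq_square)
    fix x y :: int
    obtain i where i: "i \<in> {..<p}" "[0 + int i = x] (mod int p)" by (rule low_digit[OF assms(1)])
    have "[int i = x] (mod int p)" using i(2) by simp
    then obtain i' where i': "i' \<in> {..<p}" "[int i + \<alpha> i * int p + int i' * int p = x] (mod (int p)\<^sup>2)"
      by (rule high_digit[OF assms(1)])
    obtain j' where j': "j' \<in> {..<q}" "[\<alpha> i + int j' = y] (mod int q)" by (rule low_digit[OF assms(2)])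
    have "[\<alpha> i + int j' = y] (mod int q)" using j'(2) by simp
    then obtain j where j: "j \<in> {..<q}" "[\<alpha> i + int j' + \<kappa> i' j' * int q + int j * int q = y] (mod (int q)\<^sup>2)"
      by (rule high_digit[OF assms(2)])
    have "elt p q (i + \<alpha> i * int p) (\<alpha> i + j * int q) \<in> A" unfolding A
      by (intro CollectI exI conjI, rule refl) (rule i(1) i'(1) j'(1) j(1))+
    moreover have "elt p q (i' * int p) (j' + \<kappa> i' j' * int q) \<in> B" unfolding B
      by (intro CollectI exI conjI, rule refl) (rule i(1) i'(1) j'(1) j(1))+
    ultimately show "\<exists>a\<in>A. \<exists>b\<in>B. [fst a + fst b = x] (mod (int p)\<^sup>2) \<and> [snd a + snd b = y] (mod (int q)\<^sup>2)"
      by (rule elt_cover) (use i'(2) j(2) in \<open>simp_all add: algebra_simps\<close>)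
  qed
qed

lemma form_6_tiling:
  assumes "p > 0" and "q > 0" and "form_6 p q A B"
  shows "tiling ((int p)\<^sup>2) ((int q)\<^sup>2) A B"
proof -
  obtain \<alpha>' \<alpha> \<kappa> where
    A: "A = {elt p q (i + \<alpha>' i j * int p) (\<alpha> i + j * int q) |(i::nat) (j::nat). i \<in> {..<p} \<and> j \<in> {..<q}}" and
    B: "B = {elt p q (j * int p) (i + \<kappa> i * int q) |(i::nat) (j::nat). i \<in> {..<q} \<and> j \<in> {..<p}}"
    using assms(3) unfolding form_6_def by (elim exE conjE) (rule that)
  show ?thesis
  proof (rule tilingI_grid[OF assms(1,2)])
    show "finite A" "card A \<le> p * q" unfolding A by (rule card_grid2)+
    show "finite B" "card B \<le> q * p" unfolding B by (rule card_grid2)+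
    show "(p * q) * (q * p) = p\<^sup>2 * q\<^sup>2" by (simp add: power2_eq_square)
    fix x y :: int
    obtain i where i: "i \<in> {..<p}" "[0 + int i = x] (mod int p)" by (rule low_digit[OF assms(1)])
    obtain i' where i': "i' \<in> {..<q}" "[\<alpha> i + int i' = y] (mod int q)" by (rule low_digit[OF assms(2)])
    have "[\<alpha> i + int i' = y] (mod int q)" using i'(2) by simp
    then obtain j where j: "j \<in> {..<q}" "[\<alpha> i + int i' + \<kappa> i' * int q + int j * int q = y] (mod (int q)\<^sup>2)"
      by (rule high_digit[OF assms(2)])
    have "[int i = x] (mod int p)" using i(2) by simp
    then obtain j' where j': "j' \<in> {..<p}" "[int i + \<alpha>' i j * int p + int j' * int p = x] (mod (int p)\<^sup>2)"
      by (rule high_digit[OF assms(1)])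
    have "elt p q (i + \<alpha>' i j * int p) (\<alpha> i + j * int q) \<in> A" unfolding A
      by (intro CollectI exI conjI, rule refl) (rule i(1) i'(1) j(1) j'(1))+
    moreover have "elt p q (j' * int p) (i' + \<kappa> i' * int q) \<in> B" unfolding B
      by (intro CollectI exI conjI, rule refl) (rule i(1) i'(1) j(1) j'(1))+
    ultimately show "\<exists>a\<in>A. \<exists>b\<in>B. [fst a + fst b = x] (mod (int p)\<^sup>2) \<and> [snd a + snd b = y] (mod (int q)\<^sup>2)"
      by (rule elt_cover) (use j'(2) j(2) in \<open>simp_all add: algebra_simps\<close>)
  qed
qed

lemma form_7_tiling:
  assumes "p > 0" and "q > 0" and "form_7 p q A B"
  shows "tiling ((int p)\<^sup>2) ((int q)\<^sup>2) A B"
proof -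
  obtain \<alpha> \<alpha>' \<kappa> where
    A: "A = {elt p q (i + \<alpha> i * int p) (j + \<alpha>' i j * int q) |(i::nat) (j::nat). i \<in> {..<p} \<and> j \<in> {..<q}}" and
    B: "B = {elt p q (i * int p) (\<kappa> i + j * int q) |(i::nat) (j::nat). i \<in> {..<p} \<and> j \<in> {..<q}}"
    using assms(3) unfolding form_7_def by (elim exE conjE) (rule that)
  show ?thesis
  proof (rule tilingI_grid[OF assms(1,2)])
    show "finite A" "card A \<le> p * q" unfolding A by (rule card_grid2)+
    show "finite B" "card B \<le> p * q" unfolding B by (rule card_grid2)+
    show "(p * q) * (p * q) = p\<^sup>2 * q\<^sup>2" by (simp add: power2_eq_square)
    fix x y :: int
    obtain i where i: "i \<in> {..<p}" "[0 + int i = x] (mod int p)" by (rule low_digit[OF assms(1)])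
    have "[int i = x] (mod int p)" using i(2) by simp
    then obtain i' where i': "i' \<in> {..<p}" "[int i + \<alpha> i * int p + int i' * int p = x] (mod (int p)\<^sup>2)"
      by (rule high_digit[OF assms(1)])
    obtain j where j: "j \<in> {..<q}" "[\<kappa> i' + int j = y] (mod int q)" by (rule low_digit[OF assms(2)])
    have "[\<kappa> i' + int j = y] (mod int q)" using j(2) by simp
    then obtain j' where j': "j' \<in> {..<q}" "[\<kappa> i' + int j + \<alpha>' i j * int q + int j' * int q = y] (mod (int q)\<^sup>2)"
      by (rule high_digit[OF assms(2)])
    have "elt p q (i + \<alpha> i * int p) (j + \<alpha>' i j * int q) \<in> A" unfolding A
      by (intro CollectI exI conjI, rule refl) (rule i(1) i'(1) j(1) j'(1))+
    moreover have "elt p q (i' * int p) (\<kappa> i' + j' * int q) \<in> B" unfolding B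
      by (intro CollectI exI conjI, rule refl) (rule i(1) i'(1) j(1) j'(1))+
    ultimately show "\<exists>a\<in>A. \<exists>b\<in>B. [fst a + fst b = x] (mod (int p)\<^sup>2) \<and> [snd a + snd b = y] (mod (int q)\<^sup>2)"
      by (rule elt_cover) (use i'(2) j'(2) in \<open>simp_all add: algebra_simps\<close>)
  qed
qed

lemma form_9_tiling:
  assumes "p > 0" and "q > 0" and "form_9 p q A B"
  shows "tiling ((int p)\<^sup>2) ((int q)\<^sup>2) A B"
proof -
  obtain \<alpha> where
    A: "A = {elt p q (i + \<alpha> i j * int p) (j + \<alpha> i j * int q) |(i::nat) (j::nat). i \<in> {..<p} \<and> j \<in> {..<q}}" and
    B: "B = {elt p q (i * int p) (j * int q) |(i::nat) (j::nat). i \<in> {..<p} \<and> j \<in> {..<q}}"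
    using assms(3) unfolding form_9_def by (elim exE conjE) (rule that)
  show ?thesis
  proof (rule tilingI_grid[OF assms(1,2)])
    show "finite A" "card A \<le> p * q" unfolding A by (rule card_grid2)+
    show "finite B" "card B \<le> p * q" unfolding B by (rule card_grid2)+
    show "(p * q) * (p * q) = p\<^sup>2 * q\<^sup>2" by (simp add: power2_eq_square)
    fix x y :: int
    obtain i where i: "i \<in> {..<p}" "[0 + int i = x] (mod int p)" by (rule low_digit[OF assms(1)])
    obtain j where j: "j \<in> {..<q}" "[0 + int j = y] (mod int q)" by (rule low_digit[OF assms(2)])
    have "[int i = x] (mod int p)" using i(2) by simp
    then obtain i' where i': "i' \<in> {..<p}" "[int i + \<alpha> i j * int p + int i' * int p = x] (mod (int p)\<^sup>2)"
      by (rule high_digit[OF assms(1)])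
    have "[int j = y] (mod int q)" using j(2) by simp
    then obtain j' where j': "j' \<in> {..<q}" "[int j + \<alpha> i j * int q + int j' * int q = y] (mod (int q)\<^sup>2)"
      by (rule high_digit[OF assms(2)])
    have "elt p q (i + \<alpha> i j * int p) (j + \<alpha> i j * int q) \<in> A" unfolding A
      by (intro CollectI exI conjI, rule refl) (rule i(1) j(1) i'(1) j'(1))+
    moreover have "elt p q (i' * int p) (j' * int q) \<in> B" unfolding B
      by (intro CollectI exI conjI, rule refl) (rule i(1) j(1) i'(1) j'(1))+
    ultimately show "\<exists>a\<in>A. \<exists>b\<in>B. [fst a + fst b = x] (mod (int p)\<^sup>2) \<and> [snd a + snd b = y] (mod (int q)\<^sup>2)"
      by (rule elt_cover) (use i'(2) j'(2) in \<open>simp_all add: algebra_simps\<close>)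
  qed
qed

lemma form_10_tiling:
  assumes "p > 0" and "q > 0" and "form_10 p q A B"
  shows "tiling ((int p)\<^sup>2) ((int q)\<^sup>2) A B"
proof -
  obtain \<alpha> \<kappa> where
    A: "A = {elt p q (j + k * int p) (i + \<alpha> i j * int q) |(i::nat) (j::nat) (k::nat). i \<in> {..<q} \<and> j \<in> {..<p} \<and> k \<in> {..<p}}" and
    B: "B = {elt p q (int p * \<kappa> i) (i * int q) |(i::nat). i \<in> {..<q}}"
    using assms(3) unfolding form_10_def by (elim exE conjE) (rule that)
  show ?thesis
  proof (rule tilingI_grid[OF assms(1,2)])
    show "finite A" "card A \<le> q * p * p" unfolding A by (rule card_grid3)+
    show "finite B" "card B \<le> q" unfolding B by (rule card_grid1)+
    show "(q * p * p) * (q) = p\<^sup>2 * q\<^sup>2" by (simp add: power2_eq_square)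
    fix x y :: int
    obtain j where j: "j \<in> {..<p}" "[0 + int j = x] (mod int p)" by (rule low_digit[OF assms(1)])
    obtain i where i: "i \<in> {..<q}" "[0 + int i = y] (mod int q)" by (rule low_digit[OF assms(2)])
    have "[int i = y] (mod int q)" using i(2) by simp
    then obtain i' where i': "i' \<in> {..<q}" "[int i + \<alpha> i j * int q + int i' * int q = y] (mod (int q)\<^sup>2)"
      by (rule high_digit[OF assms(2)])
    have "[int j = x] (mod int p)" using j(2) by simp
    then obtain k where k: "k \<in> {..<p}" "[int j + \<kappa> i' * int p + int k * int p = x] (mod (int p)\<^sup>2)"
      by (rule high_digit[OF assms(1)])
    have "elt p q (j + k * int p) (i + \<alpha> i j * int q) \<in> A" unfolding A
      by (intro CollectI exI conjI, rule refl) (rule j(1) i(1) i'(1) k(1))+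
    moreover have "elt p q (int p * \<kappa> i') (i' * int q) \<in> B" unfolding B
      by (intro CollectI exI conjI, rule refl) (rule j(1) i(1) i'(1) k(1))+
    ultimately show "\<exists>a\<in>A. \<exists>b\<in>B. [fst a + fst b = x] (mod (int p)\<^sup>2) \<and> [snd a + snd b = y] (mod (int q)\<^sup>2)"
      by (rule elt_cover) (use k(2) i'(2) in \<open>simp_all add: algebra_simps\<close>)
  qed
qed

lemma form_11_tiling:
  assumes "p > 0" and "q > 0" and "form_11 p q A B"
  shows "tiling ((int p)\<^sup>2) ((int q)\<^sup>2) A B"
proof -
  obtain \<alpha> \<kappa> where
    A: "A = {elt p q i (\<alpha> i + j * int q) |(i::nat) (j::nat). i \<in> {..<p\<^sup>2} \<and> j \<in> {..<q}}" and
    B: "B = {elt p q 0 (i + \<kappa> i * int q) |(i::nat). i \<in> {..<q}}"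
    using assms(3) unfolding form_11_def by (elim exE conjE) (rule that)
  show ?thesis
  proof (rule tilingI_grid[OF assms(1,2)])
    show "finite A" "card A \<le> p\<^sup>2 * q" unfolding A by (rule card_grid2)+
    show "finite B" "card B \<le> q" unfolding B by (rule card_grid1)+
    show "(p\<^sup>2 * q) * (q) = p\<^sup>2 * q\<^sup>2" by (simp add: power2_eq_square)
    fix x y :: int
    obtain i where i: "i \<in> {..<p\<^sup>2}" "[0 + int i = x] (mod (int p)\<^sup>2)" by (rule both_digits[OF assms(1)])
    obtain i' where i': "i' \<in> {..<q}" "[\<alpha> i + int i' = y] (mod int q)" by (rule low_digit[OF assms(2)])
    have "[\<alpha> i + int i' = y] (mod int q)" using i'(2) by simp
    then obtain j where j: "j \<in> {..<q}" "[\<alpha> i + int i' + \<kappa> i' * int q + int j * int q = y] (mod (int q)\<^sup>2)"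
      by (rule high_digit[OF assms(2)])
    have "elt p q i (\<alpha> i + j * int q) \<in> A" unfolding A
      by (intro CollectI exI conjI, rule refl) (rule i(1) i'(1) j(1))+
    moreover have "elt p q 0 (i' + \<kappa> i' * int q) \<in> B" unfolding B
      by (intro CollectI exI conjI, rule refl) (rule i(1) i'(1) j(1))+
    ultimately show "\<exists>a\<in>A. \<exists>b\<in>B. [fst a + fst b = x] (mod (int p)\<^sup>2) \<and> [snd a + snd b = y] (mod (int q)\<^sup>2)"
      by (rule elt_cover) (use i(2) j(2) in \<open>simp_all add: algebra_simps\<close>)
  qed
qed

lemma form_13_tiling:
  assumes "p > 0" and "q > 0" and "form_13 p q A B"
  shows "tiling ((int p)\<^sup>2) ((int q)\<^sup>2) A B"
proof -
  obtain \<alpha> \<kappa> where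
    A: "A = {elt p q (i + j * int p) (\<alpha> i + k * int q) |(i::nat) (j::nat) (k::nat). i \<in> {..<p} \<and> j \<in> {..<p} \<and> k \<in> {..<q}}" and
    B: "B = {elt p q (int p * \<kappa> i) (i + int q * \<kappa> i) |(i::nat). i \<in> {..<q}}"
    using assms(3) unfolding form_13_def by (elim exE conjE) (rule that)
  show ?thesis
  proof (rule tilingI_grid[OF assms(1,2)])
    show "finite A" "card A \<le> p * p * q" unfolding A by (rule card_grid3)+
    show "finite B" "card B \<le> q" unfolding B by (rule card_grid1)+
    show "(p * p * q) * (q) = p\<^sup>2 * q\<^sup>2" by (simp add: power2_eq_square)
    fix x y :: int
    obtain i where i: "i \<in> {..<p}" "[0 + int i = x] (mod int p)" by (rule low_digit[OF assms(1)])
    obtain i' where i': "i' \<in> {..<q}" "[\<alpha> i + int i' = y] (mod int q)" by (rule low_digit[OF assms(2)])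
    have "[\<alpha> i + int i' = y] (mod int q)" using i'(2) by simp
    then obtain k where k: "k \<in> {..<q}" "[\<alpha> i + int i' + \<kappa> i' * int q + int k * int q = y] (mod (int q)\<^sup>2)"
      by (rule high_digit[OF assms(2)])
    have "[int i = x] (mod int p)" using i(2) by simp
    then obtain j where j: "j \<in> {..<p}" "[int i + \<kappa> i' * int p + int j * int p = x] (mod (int p)\<^sup>2)"
      by (rule high_digit[OF assms(1)])
    have "elt p q (i + j * int p) (\<alpha> i + k * int q) \<in> A" unfolding A
      by (intro CollectI exI conjI, rule refl) (rule i(1) i'(1) k(1) j(1))+
    moreover have "elt p q (int p * \<kappa> i') (i' + int q * \<kappa> i') \<in> B" unfolding B
      by (intro CollectI exI conjI, rule refl) (rule i(1) i'(1) k(1) j(1))+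
    ultimately show "\<exists>a\<in>A. \<exists>b\<in>B. [fst a + fst b = x] (mod (int p)\<^sup>2) \<and> [snd a + snd b = y] (mod (int q)\<^sup>2)"
      by (rule elt_cover) (use j(2) k(2) in \<open>simp_all add: algebra_simps\<close>)
  qed
qed

lemma form_14_tiling:
  assumes "p > 0" and "q > 0" and "form_14 p q A B"
  shows "tiling ((int p)\<^sup>2) ((int q)\<^sup>2) A B"
proof -
  obtain \<alpha> where
    A: "A = {elt p q i (j + \<alpha> i j * int q) |(i::nat) (j::nat). i \<in> {..<p\<^sup>2} \<and> j \<in> {..<q}}" and
    B: "B = {elt p q 0 (i * int q) |(i::nat). i \<in> {..<q}}"
    using assms(3) unfolding form_14_def by (elim exE conjE) (rule that)
  show ?thesis
  proof (rule tilingI_grid[OF assms(1,2)])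
    show "finite A" "card A \<le> p\<^sup>2 * q" unfolding A by (rule card_grid2)+
    show "finite B" "card B \<le> q" unfolding B by (rule card_grid1)+
    show "(p\<^sup>2 * q) * (q) = p\<^sup>2 * q\<^sup>2" by (simp add: power2_eq_square)
    fix x y :: int
    obtain i where i: "i \<in> {..<p\<^sup>2}" "[0 + int i = x] (mod (int p)\<^sup>2)" by (rule both_digits[OF assms(1)])
    obtain j where j: "j \<in> {..<q}" "[0 + int j = y] (mod int q)" by (rule low_digit[OF assms(2)])
    have "[int j = y] (mod int q)" using j(2) by simp
    then obtain i' where i': "i' \<in> {..<q}" "[int j + \<alpha> i j * int q + int i' * int q = y] (mod (int q)\<^sup>2)"
      by (rule high_digit[OF assms(2)])
    have "elt p q i (j + \<alpha> i j * int q) \<in> A" unfolding A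
      by (intro CollectI exI conjI, rule refl) (rule i(1) j(1) i'(1))+
    moreover have "elt p q 0 (i' * int q) \<in> B" unfolding B
      by (intro CollectI exI conjI, rule refl) (rule i(1) j(1) i'(1))+
    ultimately show "\<exists>a\<in>A. \<exists>b\<in>B. [fst a + fst b = x] (mod (int p)\<^sup>2) \<and> [snd a + snd b = y] (mod (int q)\<^sup>2)"
      by (rule elt_cover) (use i(2) i'(2) in \<open>simp_all add: algebra_simps\<close>)
  qed
qed

lemma form_15_tiling:
  assumes "p > 0" and "q > 0" and "form_15 p q A B"
  shows "tiling ((int p)\<^sup>2) ((int q)\<^sup>2) A B"
proof -
  obtain \<alpha> \<kappa> where
    A: "A = {elt p q (i + \<alpha> i j * int p) (j + k * int q) |(i::nat) (j::nat) (k::nat). i \<in> {..<p} \<and> j \<in> {..<q} \<and> k \<in> {..<q}}" and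
    B: "B = {elt p q (i * int p) (\<kappa> i * int q) |(i::nat). i \<in> {..<p}}"
    using assms(3) unfolding form_15_def by (elim exE conjE) (rule that)
  show ?thesis
  proof (rule tilingI_grid[OF assms(1,2)])
    show "finite A" "card A \<le> p * q * q" unfolding A by (rule card_grid3)+
    show "finite B" "card B \<le> p" unfolding B by (rule card_grid1)+
    show "(p * q * q) * (p) = p\<^sup>2 * q\<^sup>2" by (simp add: power2_eq_square)
    fix x y :: int
    obtain i where i: "i \<in> {..<p}" "[0 + int i = x] (mod int p)" by (rule low_digit[OF assms(1)])
    obtain j where j: "j \<in> {..<q}" "[0 + int j = y] (mod int q)" by (rule low_digit[OF assms(2)])
    have "[int i = x] (mod int p)" using i(2) by simp
    then obtain i' where i': "i' \<in> {..<p}" "[int i + \<alpha> i j * int p + int i' * int p = x] (mod (int p)\<^sup>2)"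
      by (rule high_digit[OF assms(1)])
    have "[int j = y] (mod int q)" using j(2) by simp
    then obtain k where k: "k \<in> {..<q}" "[int j + \<kappa> i' * int q + int k * int q = y] (mod (int q)\<^sup>2)"
      by (rule high_digit[OF assms(2)])
    have "elt p q (i + \<alpha> i j * int p) (j + k * int q) \<in> A" unfolding A
      by (intro CollectI exI conjI, rule refl) (rule i(1) j(1) i'(1) k(1))+
    moreover have "elt p q (i' * int p) (\<kappa> i' * int q) \<in> B" unfolding B
      by (intro CollectI exI conjI, rule refl) (rule i(1) j(1) i'(1) k(1))+
    ultimately show "\<exists>a\<in>A. \<exists>b\<in>B. [fst a + fst b = x] (mod (int p)\<^sup>2) \<and> [snd a + snd b = y] (mod (int q)\<^sup>2)"
      by (rule elt_cover) (use i'(2) k(2) in \<open>simp_all add: algebra_simps\<close>)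
  qed
qed

lemma form_17_tiling:
  assumes "p > 0" and "q > 0" and "form_17 p q A B"
  shows "tiling ((int p)\<^sup>2) ((int q)\<^sup>2) A B"
proof -
  obtain \<alpha> \<kappa> where
    A: "A = {elt p q (i + \<alpha> i * int p) j |(i::nat) (j::nat). i \<in> {..<p} \<and> j \<in> {..<q\<^sup>2}}" and
    B: "B = {elt p q (i * int p) (\<kappa> i) |(i::nat). i \<in> {..<p}}"
    using assms(3) unfolding form_17_def by (elim exE conjE) (rule that)
  show ?thesis
  proof (rule tilingI_grid[OF assms(1,2)])
    show "finite A" "card A \<le> p * q\<^sup>2" unfolding A by (rule card_grid2)+
    show "finite B" "card B \<le> p" unfolding B by (rule card_grid1)+
    show "(p * q\<^sup>2) * (p) = p\<^sup>2 * q\<^sup>2" by (simp add: power2_eq_square)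
    fix x y :: int
    obtain i where i: "i \<in> {..<p}" "[0 + int i = x] (mod int p)" by (rule low_digit[OF assms(1)])
    have "[int i = x] (mod int p)" using i(2) by simp
    then obtain i' where i': "i' \<in> {..<p}" "[int i + \<alpha> i * int p + int i' * int p = x] (mod (int p)\<^sup>2)"
      by (rule high_digit[OF assms(1)])
    obtain j where j: "j \<in> {..<q\<^sup>2}" "[\<kappa> i' + int j = y] (mod (int q)\<^sup>2)" by (rule both_digits[OF assms(2)])
    have "elt p q (i + \<alpha> i * int p) j \<in> A" unfolding A
      by (intro CollectI exI conjI, rule refl) (rule i(1) i'(1) j(1))+
    moreover have "elt p q (i' * int p) (\<kappa> i') \<in> B" unfolding B
      by (intro CollectI exI conjI, rule refl) (rule i(1) i'(1) j(1))+
    ultimately show "\<exists>a\<in>A. \<exists>b\<in>B. [fst a + fst b = x] (mod (int p)\<^sup>2) \<and> [snd a + snd b = y] (mod (int q)\<^sup>2)"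
      by (rule elt_cover) (use i'(2) j(2) in \<open>simp_all add: algebra_simps\<close>)
  qed
qed

lemma form_19_tiling:
  assumes "p > 0" and "q > 0" and "form_19 p q A B"
  shows "tiling ((int p)\<^sup>2) ((int q)\<^sup>2) A B"
proof -
  obtain \<alpha> where
    A: "A = {elt p q (i + \<alpha> i j * int p) j |(i::nat) (j::nat). i \<in> {..<p} \<and> j \<in> {..<q\<^sup>2}}" and
    B: "B = {elt p q (i * int p) 0 |(i::nat). i \<in> {..<p}}"
    using assms(3) unfolding form_19_def by (elim exE conjE) (rule that)
  show ?thesis
  proof (rule tilingI_grid[OF assms(1,2)])
    show "finite A" "card A \<le> p * q\<^sup>2" unfolding A by (rule card_grid2)+
    show "finite B" "card B \<le> p" unfolding B by (rule card_grid1)+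
    show "(p * q\<^sup>2) * (p) = p\<^sup>2 * q\<^sup>2" by (simp add: power2_eq_square)
    fix x y :: int
    obtain i where i: "i \<in> {..<p}" "[0 + int i = x] (mod int p)" by (rule low_digit[OF assms(1)])
    obtain j where j: "j \<in> {..<q\<^sup>2}" "[0 + int j = y] (mod (int q)\<^sup>2)" by (rule both_digits[OF assms(2)])
    have "[int i = x] (mod int p)" using i(2) by simp
    then obtain i' where i': "i' \<in> {..<p}" "[int i + \<alpha> i j * int p + int i' * int p = x] (mod (int p)\<^sup>2)"
      by (rule high_digit[OF assms(1)])
    have "elt p q (i + \<alpha> i j * int p) j \<in> A" unfolding A
      by (intro CollectI exI conjI, rule refl) (rule i(1) j(1) i'(1))+
    moreover have "elt p q (i' * int p) 0 \<in> B" unfolding B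
      by (intro CollectI exI conjI, rule refl) (rule i(1) j(1) i'(1))+
    ultimately show "\<exists>a\<in>A. \<exists>b\<in>B. [fst a + fst b = x] (mod (int p)\<^sup>2) \<and> [snd a + snd b = y] (mod (int q)\<^sup>2)"
      by (rule elt_cover) (use i'(2) j(2) in \<open>simp_all add: algebra_simps\<close>)
  qed
qed

section \<open>Exchange of the two coordinates\<close>

lemma swap_elt [simp]: "prod.swap (elt p q x y) = elt q p y x"
  by (simp add: elt_def)

lemma swap_image_eq_iff: "prod.swap ` X = Y \<longleftrightarrow> X = prod.swap ` Y"
  by (auto simp: image_image)

lemma swap_grid1: "prod.swap ` A = {elt q p (f i) (g i) |i. P i} \<longleftrightarrow> A = {elt p q (g i) (f i) |i. P i}"
proof -
  have *: "prod.swap ` {elt q p (f i) (g i) |i. P i} = {elt p q (g i) (f i) |i. P i}"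
    by (force simp: image_iff)
  show ?thesis unfolding swap_image_eq_iff * ..
qed

lemma swap_grid2: "prod.swap ` A = {elt q p (f i j) (g i j) |i j. P i j} \<longleftrightarrow> A = {elt p q (g i j) (f i j) |i j. P i j}"
proof -
  have *: "prod.swap ` {elt q p (f i j) (g i j) |i j. P i j} = {elt p q (g i j) (f i j) |i j. P i j}"
    by (force simp: image_iff)
  show ?thesis unfolding swap_image_eq_iff * ..
qed

lemma swap_grid3:
  "prod.swap ` A = {elt q p (f i j k) (g i j k) |i j k. P i j k} \<longleftrightarrow> A = {elt p q (g i j k) (f i j k) |i j k. P i j k}"
proof -
  have *: "prod.swap ` {elt q p (f i j k) (g i j k) |i j k. P i j k} = {elt p q (g i j k) (f i j k) |i j k. P i j k}"
    by (force simp: image_iff)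
  show ?thesis unfolding swap_image_eq_iff * ..
qed

lemma form_2_swap: "form_1 q p (prod.swap ` A) (prod.swap ` B) \<longleftrightarrow> form_2 p q A B"
proof -
  have *: "{elt p q j (i * int q) |(i::nat) (j::nat). i \<in> {..<q} \<and> j \<in> {..<p\<^sup>2}} =
      {elt p q i (j * int q) |(i::nat) (j::nat). i \<in> {..<p\<^sup>2} \<and> j \<in> {..<q}}" by blast
  show ?thesis unfolding form_1_def form_2_def swap_grid1 swap_grid2 * by blast
qed

lemma grid_transpose: "{f i j |i j. i \<in> I \<and> j \<in> J} = {f j i |i j. i \<in> J \<and> j \<in> I}"
  by blast

lemma form_4_swap: "form_3 q p (prod.swap ` A) (prod.swap ` B) \<longleftrightarrow> form_4 p q A B"
proof -
  have transpose: "{elt p q (int j + \<kappa> i j * int p) (int i * int q) |i j. i \<in> {..<q} \<and> j \<in> {..<p}} =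
      {elt p q (int i + \<kappa> j i * int p) (int j * int q) |i j. i \<in> {..<p} \<and> j \<in> {..<q}}" for \<kappa>
    by blast
  show ?thesis
  proof
    assume "form_3 q p (prod.swap ` A) (prod.swap ` B)"
    then obtain \<alpha> \<kappa> where "\<alpha> 0 = 0" "\<kappa> 0 0 = 0"
      "A = {elt p q (\<alpha> i + int j * int p) (int i + \<alpha> i * int q) |i j. i \<in> {..<q} \<and> j \<in> {..<p}}"
      "B = {elt p q (int i + \<kappa> j i * int p) (int j * int q) |i j. i \<in> {..<p} \<and> j \<in> {..<q}}"
      unfolding form_3_def swap_grid2 transpose by (elim exE conjE) (rule that)
    then show "form_4 p q A B"
      unfolding form_4_def by - (rule exI[of _ \<alpha>], rule exI[of _ "\<lambda>i j. \<kappa> j i"], intro conjI)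
  next
    assume "form_4 p q A B"
    then obtain \<alpha> \<kappa> where "\<alpha> 0 = 0" "\<kappa> 0 0 = 0"
      "A = {elt p q (\<alpha> i + int j * int p) (int i + \<alpha> i * int q) |i j. i \<in> {..<q} \<and> j \<in> {..<p}}"
      "B = {elt p q (int i + \<kappa> i j * int p) (int j * int q) |i j. i \<in> {..<p} \<and> j \<in> {..<q}}"
      unfolding form_4_def by (elim exE conjE) (rule that)
    then show "form_3 q p (prod.swap ` A) (prod.swap ` B)"
      unfolding form_3_def swap_grid2 transpose
      by - (rule exI[of _ \<alpha>], rule exI[of _ "\<lambda>i j. \<kappa> j i"], intro conjI)
  qed
qed

lemma form_5_swap: "form_7 q p (prod.swap ` A) (prod.swap ` B) \<longleftrightarrow> form_5 p q A B"
  unfolding form_7_def form_5_def swap_grid2 by blast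

lemma form_8_swap: "form_6 q p (prod.swap ` A) (prod.swap ` B) \<longleftrightarrow> form_8 p q A B"
  unfolding form_6_def form_8_def swap_grid2 by blast

lemma form_12_swap: "form_17 q p (prod.swap ` A) (prod.swap ` B) \<longleftrightarrow> form_12 p q A B"
  unfolding form_17_def form_12_def swap_grid1 swap_grid2 ..

lemma form_16_swap: "form_11 q p (prod.swap ` A) (prod.swap ` B) \<longleftrightarrow> form_16 p q A B"
  unfolding form_11_def form_16_def swap_grid1 swap_grid2 ..

lemma form_18_swap: "form_13 q p (prod.swap ` A) (prod.swap ` B) \<longleftrightarrow> form_18 p q A B"
  unfolding form_13_def form_18_def swap_grid1 swap_grid3 ..

lemma form_10_swap: "form_15 q p (prod.swap ` A) (prod.swap ` B) \<longleftrightarrow> form_10 p q A B"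
  unfolding form_15_def form_10_def swap_grid1 swap_grid3 by (simp only: mult.commute)

lemma form_15_swap: "form_10 q p (prod.swap ` A) (prod.swap ` B) \<longleftrightarrow> form_15 p q A B"
  unfolding form_15_def form_10_def swap_grid1 swap_grid3 by (simp only: mult.commute)

lemma form_9_swap:
  assumes "form_9 q p (prod.swap ` A) (prod.swap ` B)"
  shows "form_9 p q A B"
proof -
  obtain \<alpha> where "\<alpha> 0 0 = 0"
    and A: "A = {elt p q (int j + \<alpha> i j * int p) (int i + \<alpha> i j * int q) |i j. i \<in> {..<q} \<and> j \<in> {..<p}}"
    and B: "B = {elt p q (int j * int p) (int i * int q) |i j. i \<in> {..<q} \<and> j \<in> {..<p}}"
    using assms unfolding form_9_def swap_grid2 by (elim exE conjE) (rule that)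
  then show ?thesis
    unfolding form_9_def A B grid_transpose[of _ "{..<q}"]
    by - (rule exI[of _ "\<lambda>i j. \<alpha> j i"], intro conjI refl)
qed

lemma form_14_swap:
  assumes "form_19 q p (prod.swap ` A) (prod.swap ` B)"
  shows "form_14 p q A B"
proof -
  obtain \<alpha> where "\<alpha> 0 0 = 0"
    and A: "A = {elt p q (int j) (int i + \<alpha> i j * int q) |i j. i \<in> {..<q} \<and> j \<in> {..<p\<^sup>2}}"
    and B: "B = {elt p q 0 (int i * int q) |i. i \<in> {..<q}}"
    using assms unfolding form_19_def swap_grid1 swap_grid2 by (elim exE conjE) (rule that)
  then show ?thesis
    unfolding form_14_def A B grid_transpose[of _ "{..<q}"]
    by - (rule exI[of _ "\<lambda>i j. \<alpha> j i"], intro conjI refl)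
qed

lemma form_19_swap:
  assumes "form_14 q p (prod.swap ` A) (prod.swap ` B)"
  shows "form_19 p q A B"
proof -
  obtain \<alpha> where "\<alpha> 0 0 = 0"
    and A: "A = {elt p q (int j + \<alpha> i j * int p) (int i) |i j. i \<in> {..<q\<^sup>2} \<and> j \<in> {..<p}}"
    and B: "B = {elt p q (int i * int p) 0 |i. i \<in> {..<p}}"
    using assms unfolding form_14_def swap_grid1 swap_grid2 by (elim exE conjE) (rule that)
  then show ?thesis
    unfolding form_19_def A B grid_transpose[of _ "{..<q\<^sup>2}"]
    by - (rule exI[of _ "\<lambda>i j. \<alpha> j i"], intro conjI refl)
qed

section \<open>Perfect codes in Cayley digraphs\<close>

lemma carrier_Zsq:
  assumes "p > 0" and "q > 0"
  shows "carrier (Zsq p q) = {0..<(int p)\<^sup>2} \<times> {0..<(int q)\<^sup>2}"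
  using assms by (simp add: Zsq_def carrier_integer_mod_group)

lemma one_Zsq: "\<one>\<^bsub>Zsq p q\<^esub> = (0, 0)"
  by (simp add: Zsq_def)

lemma mult_Zsq: "u \<otimes>\<^bsub>Zsq p q\<^esub> v = ((fst u + fst v) mod (int p)\<^sup>2, (snd u + snd v) mod (int q)\<^sup>2)"
  by (cases u; cases v) (simp add: Zsq_def)

lemma inv_Zsq:
  assumes "u \<in> carrier (Zsq p q)"
  shows "inv\<^bsub>Zsq p q\<^esub> u = ((- fst u) mod (int p)\<^sup>2, (- snd u) mod (int q)\<^sup>2)"
  using assms by (cases u) (simp add: Zsq_def inv_DirProd)

text \<open>
  Otherwise \<open>S\<close> lies in the proper subgroup \<open>pG\<close>.
\<close>
lemma generate_not_dvd_fst:
  assumes "p > 1" and "q > 0" and "S \<subseteq> carrier (Zsq p q)" and "generate (Zsq p q) S = carrier (Zsq p q)"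
  shows "\<exists>s\<in>S. \<not> int p dvd fst s"
proof (rule ccontr)
  assume "\<not> ?thesis"
  then have S: "int p dvd fst s" if "s \<in> S" for s using that by blast
  have mod: "int p dvd x mod (int p)\<^sup>2 \<longleftrightarrow> int p dvd x" for x
    by (simp add: dvd_mod_iff power2_eq_square)
  have "int p dvd fst u" if "u \<in> generate (Zsq p q) S" for u
    using that
  proof induction
    case (inv h)
    then have "h \<in> carrier (Zsq p q)" using assms(3) by blast
    then show ?case using S inv by (simp add: inv_Zsq mod)
  qed (use S in \<open>auto simp: one_Zsq mult_Zsq mod\<close>)
  moreover have "(1, 0) \<in> carrier (Zsq p q)"
    using assms(1,2) by (simp add: carrier_Zsq one_less_power)
  ultimately have "int p dvd fst (1::int, 0::int)" using assms(4) by blast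
  then show False using assms(1) by simp
qed

lemma generate_not_dvd_snd:
  assumes "p > 0" and "q > 1" and "S \<subseteq> carrier (Zsq p q)" and "generate (Zsq p q) S = carrier (Zsq p q)"
  shows "\<exists>s\<in>S. \<not> int q dvd snd s"
proof (rule ccontr)
  assume "\<not> ?thesis"
  then have S: "int q dvd snd s" if "s \<in> S" for s using that by blast
  have mod: "int q dvd x mod (int q)\<^sup>2 \<longleftrightarrow> int q dvd x" for x
    by (simp add: dvd_mod_iff power2_eq_square)
  have "int q dvd snd u" if "u \<in> generate (Zsq p q) S" for u
    using that
  proof induction
    case (inv h)
    then have "h \<in> carrier (Zsq p q)" using assms(3) by blast
    then show ?case using S inv by (simp add: inv_Zsq mod)
  qed (use S in \<open>auto simp: one_Zsq mult_Zsq mod\<close>)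
  moreover have "(0, 1) \<in> carrier (Zsq p q)"
    using assms(1,2) by (simp add: carrier_Zsq one_less_power)
  ultimately have "int q dvd snd (0::int, 1::int)" using assms(4) by blast
  then show False using assms(2) by simp
qed

text \<open>
  The closed out-neighbourhood of \<open>c\<close> is the translate \<open>S\<^sub>0 + c\<close>.
\<close>
lemma perfect_code_iff_tiling:
  assumes "p > 0" and "q > 0" and S: "S \<subseteq> carrier (Zsq p q) - {\<one>\<^bsub>Zsq p q\<^esub>}"
    and C: "C \<subseteq> carrier (Zsq p q)"
  shows "perfect_code (Cay (Zsq p q) S) C \<longleftrightarrow>
    tiling ((int p)\<^sup>2) ((int q)\<^sup>2) (S \<union> {\<one>\<^bsub>Zsq p q\<^esub>}) C"
proof -
  let ?P = "(int p)\<^sup>2" and ?Q = "(int q)\<^sup>2" and ?S0 = "S \<union> {(0, 0)}"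
  define s where "s = (\<lambda>(a, b). ((fst a + fst b) mod ?P, (snd a + snd b) mod ?Q))"
  let ?N = "\<lambda>c. {c} \<union> {v. c \<rightarrow>\<^bsub>Cay (Zsq p q) S\<^esub> v}"
  have pos: "?P > 0" "?Q > 0" using assms by simp_all
  note car = carrier_Zsq[OF assms(1,2)]
  have arc: "c \<rightarrow>\<^bsub>Cay (Zsq p q) S\<^esub> v \<longleftrightarrow> v \<in> (\<lambda>a. s (a, c)) ` S" if c: "c \<in> carrier (Zsq p q)" for c v
  proof
    assume "c \<rightarrow>\<^bsub>Cay (Zsq p q) S\<^esub> v"
    then have v: "v \<in> carrier (Zsq p q)" "v \<otimes>\<^bsub>Zsq p q\<^esub> inv\<^bsub>Zsq p q\<^esub> c \<in> S"
      by (auto simp: Cay_def arcs_ends_conv)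
    have "v = s (v \<otimes>\<^bsub>Zsq p q\<^esub> inv\<^bsub>Zsq p q\<^esub> c, c)"
      using v(1) by (auto simp: s_def mult_Zsq inv_Zsq[OF c] car mod_simps)
    then show "v \<in> (\<lambda>a. s (a, c)) ` S" using v(2) by blast
  next
    assume "v \<in> (\<lambda>a. s (a, c)) ` S"
    then obtain a where a: "a \<in> S" "v = s (a, c)" by blast
    then have "v \<in> carrier (Zsq p q)" using pos by (simp add: s_def car)
    moreover have "a \<in> carrier (Zsq p q)" using a(1) S by blast
    then have "v \<otimes>\<^bsub>Zsq p q\<^esub> inv\<^bsub>Zsq p q\<^esub> c = a"
      by (auto simp: a(2) s_def mult_Zsq inv_Zsq[OF c] car mod_simps)
    ultimately show "c \<rightarrow>\<^bsub>Cay (Zsq p q) S\<^esub> v"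
      using a(1) c by (force simp: Cay_def arcs_ends_conv)
  qed
  have N: "?N c = (\<lambda>a. s (a, c)) ` ?S0" if "c \<in> C" for c
  proof -
    have c: "c \<in> carrier (Zsq p q)" using that C by blast
    then have "s ((0, 0), c) = c" by (auto simp: s_def car)
    then show ?thesis using arc[OF c] by auto
  qed
  have inj1: "a = a'" if "a \<in> ?S0" "a' \<in> ?S0" "s (a, c) = s (a', c)" for a a' c
  proof -
    have "a \<in> {0..<?P} \<times> {0..<?Q}" "a' \<in> {0..<?P} \<times> {0..<?Q}" using that(1,2) S pos by (auto simp: car)
    moreover have "[fst a + fst c = fst a' + fst c] (mod ?P)" "[snd a + snd c = snd a' + snd c] (mod ?Q)"
      using that(3) by (simp_all add: s_def cong_def)
    then have "[fst a = fst a'] (mod ?P)" "[snd a = snd a'] (mod ?Q)"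
      by (simp_all only: cong_add_rcancel)
    ultimately show ?thesis by (auto simp: cong_def)
  qed
  have cover: "(\<Union>c\<in>C. ?N c) = s ` (?S0 \<times> C)"
  proof -
    have "(\<Union>c\<in>C. ?N c) = (\<Union>c\<in>C. (\<lambda>a. s (a, c)) ` ?S0)" using N by (intro SUP_cong refl)
    also have "\<dots> = s ` (?S0 \<times> C)" by blast
    finally show ?thesis .
  qed
  have disj: "disjoint_family_on ?N C \<longleftrightarrow> inj_on s (?S0 \<times> C)"
  proof
    assume d: "disjoint_family_on ?N C"
    show "inj_on s (?S0 \<times> C)"
    proof (rule inj_onI)
      fix u v assume uv: "u \<in> ?S0 \<times> C" "v \<in> ?S0 \<times> C" "s u = s v"
      obtain a c a' c' where u: "u = (a, c)" and v: "v = (a', c')" by (cases u, cases v)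
      have mem: "a \<in> ?S0" "c \<in> C" "a' \<in> ?S0" "c' \<in> C" using uv(1,2) by (simp_all add: u v)
      have "s (a, c) \<in> ?N c" "s (a', c') \<in> ?N c'"
        unfolding N[OF mem(2)] N[OF mem(4)] using mem by blast+
      then have "?N c \<inter> ?N c' \<noteq> {}" using uv(3) unfolding u v by (metis IntI empty_iff)
      then have "c = c'" using d mem unfolding disjoint_family_on_def by blast
      then show "u = v" using uv(3) inj1[OF mem(1,3)] by (simp add: u v)
    qed
  next
    assume i: "inj_on s (?S0 \<times> C)"
    show "disjoint_family_on ?N C"
      unfolding disjoint_family_on_def
    proof (intro ballI impI)
      fix c c' assume c: "c \<in> C" "c' \<in> C" "c \<noteq> c'"
      show "?N c \<inter> ?N c' = {}"
        unfolding N[OF c(1)] N[OF c(2)] using inj_onD[OF i] c by blast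
    qed
  qed
  have verts: "verts (Cay (Zsq p q) S) = {0..<?P} \<times> {0..<?Q}" by (simp add: Cay_def car)
  have "C \<subseteq> verts (Cay (Zsq p q) S)" using C car verts by simp
  then show ?thesis
    unfolding perfect_code_def cover disj verts one_Zsq tiling_def bij_betw_def s_def by simp
qed

section \<open>The classification\<close>

context factor_pair
begin

text \<open>
  If neither \<open>u\<close> nor \<open>v\<close> is a unit in both coordinates, their difference is.
\<close>
lemma unit_difference:
  assumes "(0, 0) \<in> X" and "u \<in> X" "\<not> int p dvd fst u" and "v \<in> X" "\<not> int q dvd snd v"
  shows "\<exists>a\<in>X. \<exists>b\<in>X. x0 a \<noteq> x0 b \<and> y0 a \<noteq> y0 b"
proof -
  have u: "x0 u \<noteq> 0" and v: "y0 v \<noteq> 0"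
    using assms(3,5) lo_eq_iff_dvd[OF p_pos, of "fst u" 0] lo_eq_iff_dvd[OF q_pos, of "snd v" 0] by simp_all
  consider "y0 u \<noteq> 0" | "x0 v \<noteq> 0" | "y0 u = 0" "x0 v = 0" by blast
  then show ?thesis
  proof cases
    case 1
    then show ?thesis using u assms by (intro bexI[of _ u] bexI[of _ "(0, 0)"]) auto
  next
    case 2
    then show ?thesis using v assms by (intro bexI[of _ v] bexI[of _ "(0, 0)"]) auto
  next
    case 3
    then show ?thesis using u v assms by (intro bexI[of _ u] bexI[of _ v]) auto
  qed
qed

text \<open>
  Otherwise both factors have a difference with both coordinates units, that is, of the same type.
\<close>
lemma B_in_proper_subgroup:
  assumes "a \<in> A" "\<not> int p dvd fst a" and "a' \<in> A" "\<not> int q dvd snd a'"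
  shows "(\<forall>b\<in>B. int p dvd fst b) \<or> (\<forall>b\<in>B. int q dvd snd b)"
proof (rule ccontr)
  assume "\<not> ?thesis"
  then obtain b b' where "b \<in> B" "b' \<in> B" "x0 b \<noteq> x0 b'" "y0 b \<noteq> y0 b'"
    using unit_difference[OF zero_B] by blast
  moreover obtain c c' where "c \<in> A" "c' \<in> A" "x0 c \<noteq> x0 c'" "y0 c \<noteq> y0 c'"
    using unit_difference[OF zero_A assms] by blast
  ultimately show False using no_common_type[of c c' b b'] by metis
qed

lemma swapped: "factor_pair q p (prod.swap ` A) (prod.swap ` B)"
proof
  show "tiling ((int q)\<^sup>2) ((int p)\<^sup>2) (prod.swap ` A) (prod.swap ` B)" using tiling_swap[OF tiling] by simp
  show "(0, 0) \<in> prod.swap ` A" "(0, 0) \<in> prod.swap ` B" using zero_A zero_B by force+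
qed (use prime_p prime_q p_neq_q A_sub B_sub in auto)

end

text \<open>
  The alternatives in which \<open>B\<close> lies in \<open>pG\<close> whatever the parameters are.
\<close>
definition p_forms :: "nat \<Rightarrow> nat \<Rightarrow> (int \<times> int) set \<Rightarrow> (int \<times> int) set \<Rightarrow> bool" where
  "p_forms p q A B \<longleftrightarrow> form_1 p q A B \<or> form_3 p q A B \<or> form_6 p q A B \<or> form_7 p q A B \<or> form_9 p q A B \<or>
    form_10 p q A B \<or> form_11 p q A B \<or> form_13 p q A B \<or> form_14 p q A B \<or> form_15 p q A B \<or>
    form_17 p q A B \<or> form_19 p q A B"

lemma (in factor_pair_p) p_forms:
  assumes "\<not> coprime (card A) (card B)"
  shows "p_forms p q A B"
  using card_cases[OF assms] form_if_card_p forms_if_card_pq forms_if_card_p2q forms_if_card_pq2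
  unfolding p_forms_def by blast

lemma p_forms_tiling:
  assumes "p > 0" and "q > 0" and "p_forms p q A B"
  shows "tiling ((int p)\<^sup>2) ((int q)\<^sup>2) A B"
  using assms(3) unfolding p_forms_def
  by (elim disjE)
    (erule form_1_tiling[OF assms(1,2)] form_3_tiling[OF assms(1,2)] form_6_tiling[OF assms(1,2)] form_7_tiling[OF assms(1,2)]
      form_9_tiling[OF assms(1,2)] form_10_tiling[OF assms(1,2)] form_11_tiling[OF assms(1,2)] form_13_tiling[OF assms(1,2)]
      form_14_tiling[OF assms(1,2)] form_15_tiling[OF assms(1,2)] form_17_tiling[OF assms(1,2)] form_19_tiling[OF assms(1,2)])+

definition all_forms :: "nat \<Rightarrow> nat \<Rightarrow> (int \<times> int) set \<Rightarrow> (int \<times> int) set \<Rightarrow> bool" where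
  "all_forms p q A B \<longleftrightarrow> form_1 p q A B \<or> form_2 p q A B \<or> form_3 p q A B \<or> form_4 p q A B \<or> form_5 p q A B \<or>
    form_6 p q A B \<or> form_7 p q A B \<or> form_8 p q A B \<or> form_9 p q A B \<or> form_10 p q A B \<or> form_11 p q A B \<or>
    form_12 p q A B \<or> form_13 p q A B \<or> form_14 p q A B \<or> form_15 p q A B \<or> form_16 p q A B \<or> form_17 p q A B \<or>
    form_18 p q A B \<or> form_19 p q A B"

text \<open>
  The list of alternatives is closed under exchanging the coordinates, and each of them has \<open>B \<subseteq> pG\<close> or
  arises from one that has by this symmetry.
\<close>
lemma all_forms_iff: "all_forms p q A B \<longleftrightarrow> p_forms p q A B \<or> p_forms q p (prod.swap ` A) (prod.swap ` B)"
  unfolding all_forms_def p_forms_def form_2_swap form_4_swap form_5_swap form_8_swap form_12_swap form_16_swap form_18_swap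
    form_10_swap form_15_swap
  using form_9_swap[of q p A B] form_14_swap[of q p A B] form_19_swap[of q p A B] by argo

lemma perfect_code_iff_all_forms:
  assumes "prime p" and "prime q" and "p \<noteq> q"
    and "S \<subset> carrier (Zsq p q) - {\<one>\<^bsub>Zsq p q\<^esub>}"
    and "generate (Zsq p q) S = carrier (Zsq p q)"
    and "S0 = S \<union> {\<one>\<^bsub>Zsq p q\<^esub>}"
    and "\<one>\<^bsub>Zsq p q\<^esub> \<in> C" and "C \<subseteq> carrier (Zsq p q)"
    and "\<not> coprime (card C) (card S0)"
  shows "perfect_code (Cay (Zsq p q) S) C \<longleftrightarrow> all_forms p q S0 C"
proof -
  have pos: "p > 0" "q > 0" and gt1: "p > 1" "q > 1"
    using assms(1,2) prime_gt_0_nat prime_gt_1_nat by auto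
  note car = carrier_Zsq[OF pos]
  have S: "S \<subseteq> carrier (Zsq p q) - {\<one>\<^bsub>Zsq p q\<^esub>}" "S \<subseteq> carrier (Zsq p q)" using assms(4) by auto
  have "perfect_code (Cay (Zsq p q) S) C \<longleftrightarrow> tiling ((int p)\<^sup>2) ((int q)\<^sup>2) S0 C"
    using perfect_code_iff_tiling[OF pos S(1) assms(8)] by (simp add: assms(6))
  also have "\<dots> \<longleftrightarrow> all_forms p q S0 C"
  proof
    assume til: "tiling ((int p)\<^sup>2) ((int q)\<^sup>2) S0 C"
    have "factor_pair p q S0 C"
    proof
      show "S0 \<subseteq> {0..<(int p)\<^sup>2} \<times> {0..<(int q)\<^sup>2}" using S(2) pos by (simp add: assms(6) car one_Zsq)
      show "C \<subseteq> {0..<(int p)\<^sup>2} \<times> {0..<(int q)\<^sup>2}" using assms(8) by (simp add: car)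
      show "(0, 0) \<in> S0" "(0, 0) \<in> C" using assms(6,7) by (simp_all add: one_Zsq)
    qed (use assms(1-3) til in simp_all)
    then interpret factor_pair p q S0 C .
    obtain s t where s: "s \<in> S" "\<not> int p dvd fst s" and t: "t \<in> S" "\<not> int q dvd snd t"
      using generate_not_dvd_fst[OF gt1(1) pos(2) S(2) assms(5)] generate_not_dvd_snd[OF pos(1) gt1(2) S(2) assms(5)]
      by blast
    have nc: "\<not> coprime (card S0) (card C)" using assms(9) by (simp add: coprime_commute)
    consider "\<forall>c\<in>C. int p dvd fst c" | "\<forall>c\<in>C. int q dvd snd c"
      using B_in_proper_subgroup[of s t] s t assms(6) by blast
    then show "all_forms p q S0 C"
    proof cases
      case 1
      then interpret factor_pair_p p q S0 C by unfold_locales blast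
      show ?thesis using p_forms[OF nc] by (simp add: all_forms_iff)
    next
      case 2
      interpret swap: factor_pair q p "prod.swap ` S0" "prod.swap ` C" by (rule swapped)
      interpret swap: factor_pair_p q p "prod.swap ` S0" "prod.swap ` C" by unfold_locales (use 2 in auto)
      show ?thesis using swap.p_forms nc by (simp add: all_forms_iff card_image)
    qed
  next
    assume "all_forms p q S0 C"
    then consider "p_forms p q S0 C" | "p_forms q p (prod.swap ` S0) (prod.swap ` C)"
      unfolding all_forms_iff by blast
    then show "tiling ((int p)\<^sup>2) ((int q)\<^sup>2) S0 C"
    proof cases
      case 1
      then show ?thesis using p_forms_tiling pos by blast
    next
      case 2
      then have "tiling ((int p)\<^sup>2) ((int q)\<^sup>2) (prod.swap ` prod.swap ` S0) (prod.swap ` prod.swap ` C)"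
        using pos by (intro tiling_swap p_forms_tiling) simp_all
      then show ?thesis by (simp add: image_image)
    qed
  qed
  finally show ?thesis .
qed

theorem theorem6p6:
  fixes p q :: nat and S S0 C :: "(int \<times> int) set"
  assumes "prime p" and "prime q" and "p \<noteq> q"
    and "S \<subset> carrier (Zsq p q) - {\<one>\<^bsub>Zsq p q\<^esub>}"
    and "generate (Zsq p q) S = carrier (Zsq p q)"
    and "S0 = S \<union> {\<one>\<^bsub>Zsq p q\<^esub>}"
    and "\<one>\<^bsub>Zsq p q\<^esub> \<in> C" and "C \<subseteq> carrier (Zsq p q)"
    and "\<not> coprime (card C) (card S0)"
  shows "perfect_code (Cay (Zsq p q) S) C \<longleftrightarrow>
      (\<exists>(\<alpha> :: nat \<Rightarrow> int) (\<beta> :: nat \<Rightarrow> int).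
        \<alpha> 0 = 0 \<and> \<beta> 0 = 0 \<and>
        S0 = {elt p q (i + \<alpha> i * p) (\<beta> i) | i. i \<in> {..<p}} \<and>
        C = {elt p q (i * p) j | i j. i \<in> {..<p} \<and> j \<in> {..<q\<^sup>2}}) \<or>
      (\<exists>(\<alpha> :: nat \<Rightarrow> int) (\<beta> :: nat \<Rightarrow> int).
        \<alpha> 0 = 0 \<and> \<beta> 0 = 0 \<and>
        S0 = {elt p q (\<alpha> i) (i + \<beta> i * q) | i. i \<in> {..<q}} \<and>
        C = {elt p q i (j * q) | i j. i \<in> {..<p\<^sup>2} \<and> j \<in> {..<q}}) \<or>
      (\<exists>(\<alpha> :: nat \<Rightarrow> int) (\<kappa> :: nat \<Rightarrow> nat \<Rightarrow> int).
        \<alpha> 0 = 0 \<and> \<kappa> 0 0 = 0 \<and>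
        S0 = {elt p q (i + \<alpha> i * p) (\<alpha> i + j * q) | i j. i \<in> {..<p} \<and> j \<in> {..<q}} \<and>
        C = {elt p q (i * p) (j + \<kappa> i j * q) | i j. i \<in> {..<p} \<and> j \<in> {..<q}}) \<or>
      (\<exists>(\<alpha> :: nat \<Rightarrow> int) (\<kappa> :: nat \<Rightarrow> nat \<Rightarrow> int).
        \<alpha> 0 = 0 \<and> \<kappa> 0 0 = 0 \<and>
        S0 = {elt p q (\<alpha> i + j * p) (i + \<alpha> i * q) | i j. i \<in> {..<q} \<and> j \<in> {..<p}} \<and>
        C = {elt p q (i + \<kappa> i j * p) (j * q) | i j. i \<in> {..<p} \<and> j \<in> {..<q}}) \<or>
      (\<exists>(\<alpha>' :: nat \<Rightarrow> nat \<Rightarrow> int) (\<alpha> :: nat \<Rightarrow> int) (\<kappa> :: nat \<Rightarrow> int).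
        \<alpha>' 0 0 = 0 \<and> \<alpha> 0 = 0 \<and> \<kappa> 0 = 0 \<and>
        S0 = {elt p q (j + \<alpha>' i j * p) (i + \<alpha> i * q) | i j. i \<in> {..<q} \<and> j \<in> {..<p}} \<and>
        C = {elt p q (\<kappa> i + j * p) (i * q) | i j. i \<in> {..<q} \<and> j \<in> {..<p}}) \<or>
      (\<exists>(\<alpha>' :: nat \<Rightarrow> nat \<Rightarrow> int) (\<alpha> :: nat \<Rightarrow> int) (\<kappa> :: nat \<Rightarrow> int).
        \<alpha>' 0 0 = 0 \<and> \<alpha> 0 = 0 \<and> \<kappa> 0 = 0 \<and>
        S0 = {elt p q (i + \<alpha>' i j * p) (\<alpha> i + j * q) | i j. i \<in> {..<p} \<and> j \<in> {..<q}} \<and>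
        C = {elt p q (j * p) (i + \<kappa> i * q) | i j. i \<in> {..<q} \<and> j \<in> {..<p}}) \<or>
      (\<exists>(\<alpha> :: nat \<Rightarrow> int) (\<alpha>' :: nat \<Rightarrow> nat \<Rightarrow> int) (\<kappa> :: nat \<Rightarrow> int).
        \<alpha> 0 = 0 \<and> \<alpha>' 0 0 = 0 \<and> \<kappa> 0 = 0 \<and>
        S0 = {elt p q (i + \<alpha> i * p) (j + \<alpha>' i j * q) | i j. i \<in> {..<p} \<and> j \<in> {..<q}} \<and>
        C = {elt p q (i * p) (\<kappa> i + j * q) | i j. i \<in> {..<p} \<and> j \<in> {..<q}}) \<or>
      (\<exists>(\<alpha> :: nat \<Rightarrow> int) (\<alpha>' :: nat \<Rightarrow> nat \<Rightarrow> int) (\<kappa> :: nat \<Rightarrow> int).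
        \<alpha> 0 = 0 \<and> \<alpha>' 0 0 = 0 \<and> \<kappa> 0 = 0 \<and>
        S0 = {elt p q (\<alpha> i + j * p) (i + \<alpha>' i j * q) | i j. i \<in> {..<q} \<and> j \<in> {..<p}} \<and>
        C = {elt p q (i + \<kappa> i * p) (j * q) | i j. i \<in> {..<p} \<and> j \<in> {..<q}}) \<or>
      (\<exists>\<alpha> :: nat \<Rightarrow> nat \<Rightarrow> int.
        \<alpha> 0 0 = 0 \<and>
        S0 = {elt p q (i + \<alpha> i j * p) (j + \<alpha> i j * q) | i j. i \<in> {..<p} \<and> j \<in> {..<q}} \<and>
        C = {elt p q (i * p) (j * q) | i j. i \<in> {..<p} \<and> j \<in> {..<q}}) \<or>
      (\<exists>(\<alpha> :: nat \<Rightarrow> nat \<Rightarrow> int) (\<kappa> :: nat \<Rightarrow> int).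
        \<alpha> 0 0 = 0 \<and> \<kappa> 0 = 0 \<and>
        S0 = {elt p q (j + k * p) (i + \<alpha> i j * q) | i j k. i \<in> {..<q} \<and> j \<in> {..<p} \<and> k \<in> {..<p}} \<and>
        C = {elt p q (p * \<kappa> i) (i * q) | i. i \<in> {..<q}}) \<or>
      (\<exists>(\<alpha> :: nat \<Rightarrow> int) (\<kappa> :: nat \<Rightarrow> int).
        \<alpha> 0 = 0 \<and> \<kappa> 0 = 0 \<and>
        S0 = {elt p q i (\<alpha> i + j * q) | i j. i \<in> {..<p\<^sup>2} \<and> j \<in> {..<q}} \<and>
        C = {elt p q 0 (i + \<kappa> i * q) | i. i \<in> {..<q}}) \<or>
      (\<exists>(\<alpha> :: nat \<Rightarrow> int) (\<kappa> :: nat \<Rightarrow> int).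
        \<alpha> 0 = 0 \<and> \<kappa> 0 = 0 \<and>
        S0 = {elt p q j (i + \<alpha> i * q) | i j. i \<in> {..<q} \<and> j \<in> {..<p\<^sup>2}} \<and>
        C = {elt p q (\<kappa> i) (i * q) | i. i \<in> {..<q}}) \<or>
      (\<exists>(\<alpha> :: nat \<Rightarrow> int) (\<kappa> :: nat \<Rightarrow> int).
        \<alpha> 0 = 0 \<and> \<kappa> 0 = 0 \<and>
        S0 = {elt p q (i + j * p) (\<alpha> i + k * q) | i j k. i \<in> {..<p} \<and> j \<in> {..<p} \<and> k \<in> {..<q}} \<and>
        C = {elt p q (p * \<kappa> i) (i + q * \<kappa> i) | i. i \<in> {..<q}}) \<or>
      (\<exists>\<alpha> :: nat \<Rightarrow> nat \<Rightarrow> int.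
        \<alpha> 0 0 = 0 \<and>
        S0 = {elt p q i (j + \<alpha> i j * q) | i j. i \<in> {..<p\<^sup>2} \<and> j \<in> {..<q}} \<and>
        C = {elt p q 0 (i * q) | i. i \<in> {..<q}}) \<or>
      (\<exists>(\<alpha> :: nat \<Rightarrow> nat \<Rightarrow> int) (\<kappa> :: nat \<Rightarrow> int).
        \<alpha> 0 0 = 0 \<and> \<kappa> 0 = 0 \<and>
        S0 = {elt p q (i + \<alpha> i j * p) (j + k * q) | i j k. i \<in> {..<p} \<and> j \<in> {..<q} \<and> k \<in> {..<q}} \<and>
        C = {elt p q (i * p) (\<kappa> i * q) | i. i \<in> {..<p}}) \<or>
      (\<exists>(\<alpha> :: nat \<Rightarrow> int) (\<kappa> :: nat \<Rightarrow> int).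
        \<alpha> 0 = 0 \<and> \<kappa> 0 = 0 \<and>
        S0 = {elt p q (\<alpha> i + j * p) i | i j. i \<in> {..<q\<^sup>2} \<and> j \<in> {..<p}} \<and>
        C = {elt p q (i + \<kappa> i * p) 0 | i. i \<in> {..<p}}) \<or>
      (\<exists>(\<alpha> :: nat \<Rightarrow> int) (\<kappa> :: nat \<Rightarrow> int).
        \<alpha> 0 = 0 \<and> \<kappa> 0 = 0 \<and>
        S0 = {elt p q (i + \<alpha> i * p) j | i j. i \<in> {..<p} \<and> j \<in> {..<q\<^sup>2}} \<and>
        C = {elt p q (i * p) (\<kappa> i) | i. i \<in> {..<p}}) \<or>
      (\<exists>(\<alpha> :: nat \<Rightarrow> int) (\<kappa> :: nat \<Rightarrow> int).
        \<alpha> 0 = 0 \<and> \<kappa> 0 = 0 \<and>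
        S0 = {elt p q (\<alpha> i + j * p) (i + k * q) | i k j. i \<in> {..<q} \<and> k \<in> {..<q} \<and> j \<in> {..<p}} \<and>
        C = {elt p q (i + p * \<kappa> i) (q * \<kappa> i) | i. i \<in> {..<p}}) \<or>
      (\<exists>\<alpha> :: nat \<Rightarrow> nat \<Rightarrow> int.
        \<alpha> 0 0 = 0 \<and>
        S0 = {elt p q (i + \<alpha> i j * p) j | i j. i \<in> {..<p} \<and> j \<in> {..<q\<^sup>2}} \<and>
        C = {elt p q (i * p) 0 | i. i \<in> {..<p}})"
  using perfect_code_iff_all_forms[OF assms]
  unfolding all_forms_def form_1_def form_2_def form_3_def form_4_def form_5_def form_6_def form_7_def form_8_def
    form_9_def form_10_def form_11_def form_12_def form_13_def form_14_def form_15_def form_16_def form_17_def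
    form_18_def form_19_def of_nat_mult of_nat_add .

end
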